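(* Fix Hodge polygon data $\mathbf k=(\mathbf k^{(i)})_{i\in\mathbb{Z}/f\mathbb{Z}}$, $\mathbf k^{(i)}=(k_{i1}\ge k_{i2}\ge\dots\ge k_{id})$. The assignment sending $(A)=(A^{(0)},\dots,A^{(f-1)})\in\mathrm{GL}_d(\mathscr O_F)^f$ to the strongly divisible lattice $L=\prod_iL^{(i)}$ which has $\mathscr O_F$-bases $\{e_1^{(i)},\dots,e_d^{(i)}\}$ of $L^{(i)}$ adapted to the filtration, in which $\varphi_L^{(i)}(e_1^{(i-1)},\dots,e_d^{(i-1)})=(e_1^{(i)},\dots,e_d^{(i)})A^{(i)}\Delta_{\mathbf k^{(i-1)}}$, induces a bijection \[\Theta:\mathrm{GL}_d(\mathscr O_F)^f/\!\sim_{\mathbf k}\ \longrightarrow\ \{\text{isomorphism classes of strongly divisible lattices with Hodge polygon data }\mathbf k\}.\]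
   Context: $K=\mathbb{Q}_{p^f}$ with ring of integers $\mathscr O_K$, $F/\mathbb{Q}_p$ finite with ring of integers $\mathscr O_F$ and a fixed embedding $\tau_0:K\hookrightarrow F$; $\tau_i=\tau_0\circ\sigma_K^{-i}$ and $\mathscr O_F\otimes_{\mathbb{Z}_p}\mathscr O_K\cong\prod_{i\in\mathbb{Z}/f\mathbb{Z}}\mathscr O_F$ via $x\otimes y\mapsto(x\tau_i(y))_i$, with idempotents $\mathfrak e_i$. For a weakly admissible filtered $\varphi$-module $D$ over $F\otimes_{\mathbb{Q}_p}K$, a $\varphi$-lattice is an $\mathscr O_F\otimes\mathscr O_K$-submodule $L$ spanning $D$ with $\varphi(L)\subseteq L$, given the induced filtration $\mathrm{Fil}^jL=\mathrm{Fil}^jD\cap L$; it decomposes as $L=\prod_iL^{(i)}$, $L^{(i)}=\mathfrak e_iL$, with $\mathscr O_F$-linear partial Frobenii $\varphi^{(i)}:L^{(i-1)}\to L^{(i)}$. $L$ is strongly divisible if $\varphi(\mathrm{Fil}^jL)\subseteq p^jL$ for all $j$ and $\sum_jp^{-j}\varphi(\mathrm{Fil}^jL)=L$. $D$ (and $L$) has Hodge polygon data $\mathbf k$ if the filtration jumps of $D^{(i)}$ are $k_{i1}\ge\dots\ge k_{id}$ with multiplicity. A basis $\{e_1^{(i)},\dots,e_d^{(i)}\}$ of $L^{(i)}$ is adapted to the filtration if for every $j$, $\{e_1^{(i)},\dots,e_{\dim\mathrm{Fil}^jL^{(i)}}^{(i)}\}$ is a basis of $\mathrm{Fil}^jL^{(i)}$.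 Isomorphisms of strongly divisible lattices are $\mathscr O_F\otimes\mathscr O_K$-linear bijections compatible with $\varphi$ and filtrations. $\Delta_{\mathbf k^{(i)}}=\mathrm{Diag}(p^{k_{i1}},\dots,p^{k_{id}})$. With $r_{ij}=\dim_F\mathrm{Fil}^{k_{ij}}D^{(i)}$, the parabolic group $\mathscr P_{\mathbf k^{(i)}}(\mathscr O_F)\subset\mathrm{GL}_d(\mathscr O_F)$ consists of block upper-triangular matrices with invertible diagonal blocks in $\mathrm{GL}_{r_{i1}}(\mathscr O_F),\mathrm{GL}_{r_{i2}-r_{i1}}(\mathscr O_F),\dots,\mathrm{GL}_{d-r_{i(d-1)}}(\mathscr O_F)$ and arbitrary $\mathscr O_F$-entries above; $\mathscr P_{\mathbf k}=\prod_i\mathscr P_{\mathbf k^{(i)}}$. $(A)\sim_{\mathbf k}(B)$ iff there is $(C^{(i)})\in\mathscr P_{\mathbf k}(\mathscr O_F)$ with $B^{(i)}=C^{(i)}A^{(i)}\Delta_{\mathbf k^{(i-1)}}(C^{(i-1)})^{-1}\Delta_{\mathbf k^{(i-1)}}^{-1}$ for all $i$.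
   Formalization: Formally all k_ij ≥ 0 (a negative k_ij allows no lattice with φ(L)⊆L, yet GL_d(O_F)^f is nonempty) and lattices are finitely generated (else L=D qualifies but has no O_F-basis); all lattices are taken inside one fixed underlying group of F-dimension df. *)

theory Defs
  imports
    Complex_Main
    "HOL-Library.FuncSet"
    "HOL-Computational_Algebra.Primes"
    "Jordan_Normal_Form.Matrix"
    "Jordan_Normal_Form.Determinant"
    "Jordan_Normal_Form.Gauss_Jordan_Elimination"
begin

section \<open>The fields\<close>

definition padic_abs :: "nat \<Rightarrow> rat \<Rightarrow> real" where
  "padic_abs p x =
     (if x = 0 then 0
      else real p powi (int (multiplicity (int p) (snd (quotient_of x)))
                        - int (multiplicity (int p) (fst (quotient_of x)))))"

definition nonarch_abs :: "('x::field \<Rightarrow> real) \<Rightarrow> bool" where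
  "nonarch_abs v \<longleftrightarrow>
     (\<forall>x. 0 \<le> v x) \<and> (\<forall>x. v x = 0 \<longleftrightarrow> x = 0) \<and>
     (\<forall>x y. v (x * y) = v x * v y) \<and> (\<forall>x y. v (x + y) \<le> max (v x) (v y))"

text \<open>The type \<open>'q\<close> with the absolute value \<open>v\<close> is the field of \<open>p\<close>-adic numbers,
  i.e. the completion of the rationals with respect to the \<open>p\<close>-adic absolute value.\<close>

definition is_padic_field :: "nat \<Rightarrow> ('q::field_char_0 \<Rightarrow> real) \<Rightarrow> bool" where
  "is_padic_field p v \<longleftrightarrow>
     prime p \<and> nonarch_abs v \<and>
     (\<forall>r. v (of_rat r) = padic_abs p r) \<and>
     (\<forall>x. \<forall>\<epsilon>>0. \<exists>r. v (x - of_rat r) < \<epsilon>) \<and>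
     (\<forall>X::nat \<Rightarrow> 'q. (\<forall>\<epsilon>>0. \<exists>N. \<forall>m\<ge>N. \<forall>n\<ge>N. v (X m - X n) < \<epsilon>) \<longrightarrow>
        (\<exists>l. \<forall>\<epsilon>>0. \<exists>N. \<forall>n\<ge>N. v (X n - l) < \<epsilon>))"

text \<open>The types \<open>'q\<close>, \<open>'a\<close>, \<open>'k\<close> are the \<open>p\<close>-adic numbers, \<open>F\<close> and \<open>K\<close>.
  \<open>F\<close> and \<open>K\<close> are given with their structure maps from the \<open>p\<close>-adic numbers and with the
  (unique) extensions of the \<open>p\<close>-adic absolute value; \<open>emb0\<close> is \<open>\<tau>\<^sub>0\<close> and \<open>frob\<close> is
  \<open>\<sigma>\<^sub>K\<close>.\<close>

record ('q, 'a, 'k) coeff_data =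
  char_p :: nat
  res_deg :: nat
  absQ :: "'q \<Rightarrow> real"
  absF :: "'a \<Rightarrow> real"
  absK :: "'k \<Rightarrow> real"
  inclF :: "'q \<Rightarrow> 'a"
  inclK :: "'q \<Rightarrow> 'k"
  emb0 :: "'k \<Rightarrow> 'a"
  frob :: "'k \<Rightarrow> 'k"

definition ringF :: "('q, 'a, 'k) coeff_data \<Rightarrow> 'a set" where
  "ringF S = {x. absF S x \<le> 1}"

definition ringK :: "('q, 'a, 'k) coeff_data \<Rightarrow> 'k set" where
  "ringK S = {x. absK S x \<le> 1}"

definition residue_field_K :: "('q, 'a, 'k::field) coeff_data \<Rightarrow> 'k set set" where
  "residue_field_K S = ringK S // {(x, y). x \<in> ringK S \<and> y \<in> ringK S \<and> absK S (x - y) < 1}"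

text \<open>\<open>K\<close> is the unramified extension of degree \<open>f\<close>: its degree \<open>f\<close> equals its residue degree,
  i.e. its residue field has \<open>p ^ f\<close> elements.\<close>

definition coeff_datum :: "('q::field_char_0, 'a::field, 'k::field) coeff_data \<Rightarrow> bool" where
  "coeff_datum S \<longleftrightarrow>
     is_padic_field (char_p S) (absQ S) \<and>
     field_hom (inclF S) \<and>
     (\<exists>B. finite B \<and> Modules.module.span (\<lambda>q x. inclF S q * x) B = UNIV) \<and>
     nonarch_abs (absF S) \<and> (\<forall>q. absF S (inclF S q) = absQ S q) \<and>
     field_hom (inclK S) \<and>
     res_deg S > 0 \<and> Vector_Spaces.vector_space.dim (\<lambda>q x. inclK S q * x) (UNIV :: 'k set) = res_deg S \<and>
     nonarch_abs (absK S) \<and> (\<forall>q. absK S (inclK S q) = absQ S q) \<and>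
     card (residue_field_K S) = char_p S ^ res_deg S \<and>
     field_hom (emb0 S) \<and> (\<forall>q. emb0 S (inclK S q) = inclF S q) \<and>
     field_hom (frob S) \<and> bij (frob S) \<and> (\<forall>q. frob S (inclK S q) = inclK S q) \<and>
     (\<forall>x\<in>ringK S. absK S (frob S x - x ^ char_p S) < 1)"

definition ordF :: "('q, 'a, 'k) coeff_data \<Rightarrow> 'a \<Rightarrow> real" where
  "ordF S x = - log (real (char_p S)) (absF S x)"

definition emb :: "('q, 'a, 'k) coeff_data \<Rightarrow> nat \<Rightarrow> 'k \<Rightarrow> 'a" where
  "emb S i = emb0 S \<circ> (inv_into UNIV (frob S) ^^ i)"

text \<open>Elements of \<open>\<int>/f\<int>\<close> are represented by \<open>0, \<dots>, f - 1\<close>.\<close>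

definition prev :: "('q, 'a, 'k) coeff_data \<Rightarrow> nat \<Rightarrow> nat" where
  "prev S i = (i + res_deg S - 1) mod res_deg S"


section \<open>Filtered \<open>\<phi>\<close>-modules\<close>

text \<open>A module over the tensor product of \<open>F\<close> and \<open>K\<close> over the \<open>p\<close>-adic numbers is an abelian
  group with commuting actions of \<open>F\<close> and \<open>K\<close> that agree on the \<open>p\<close>-adic numbers. Its
  submodules are the subgroups stable under both actions; likewise for the rings of integers.\<close>

record ('a, 'k, 'v) fil_phi_module =
  sF :: "'a \<Rightarrow> 'v \<Rightarrow> 'v"
  sK :: "'k \<Rightarrow> 'v \<Rightarrow> 'v"
  phi :: "'v \<Rightarrow> 'v"
  Fil :: "int \<Rightarrow> 'v set"

definition submod ::
  "('a, 'k, 'v::ab_group_add) fil_phi_module \<Rightarrow> 'a set \<Rightarrow> 'k set \<Rightarrow> 'v set \<Rightarrow> bool" where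
  "submod D R R' M \<longleftrightarrow>
     0 \<in> M \<and> (\<forall>x\<in>M. \<forall>y\<in>M. x + y \<in> M) \<and> (\<forall>x\<in>M. - x \<in> M) \<and>
     (\<forall>a\<in>R. \<forall>x\<in>M. sF D a x \<in> M) \<and> (\<forall>b\<in>R'. \<forall>x\<in>M. sK D b x \<in> M)"

definition filtered_phi_module ::
  "('q, 'a::field, 'k::field) coeff_data \<Rightarrow> ('a, 'k, 'v::ab_group_add) fil_phi_module \<Rightarrow> bool" where
  "filtered_phi_module S D \<longleftrightarrow>
     Vector_Spaces.vector_space (sF D) \<and> Vector_Spaces.vector_space (sK D) \<and>
     (\<forall>a b x. sF D a (sK D b x) = sK D b (sF D a x)) \<and>
     (\<forall>q x. sF D (inclF S q) x = sK D (inclK S q) x) \<and>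
     (\<exists>B. finite B \<and> Modules.module.span (sF D) B = UNIV) \<and>
     Vector_Spaces.linear (sF D) (sF D) (phi D) \<and>
     (\<forall>b x. phi D (sK D b x) = sK D (frob S b) (phi D x)) \<and>
     bij (phi D) \<and>
     (\<forall>j. submod D UNIV UNIV (Fil D j)) \<and>
     (\<forall>j. Fil D (j + 1) \<subseteq> Fil D j) \<and>
     (\<exists>j. Fil D j = UNIV) \<and> (\<exists>j. Fil D j = {0})"

definition hodge_number ::
  "('a::field, 'k, 'v::ab_group_add) fil_phi_module \<Rightarrow> 'v set \<Rightarrow> int" where
  "hodge_number D W =
     (\<Sum>j | Fil D j \<inter> W \<noteq> Fil D (j + 1) \<inter> W.
        j * (int (Vector_Spaces.vector_space.dim (sF D) (Fil D j \<inter> W))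
             - int (Vector_Spaces.vector_space.dim (sF D) (Fil D (j + 1) \<inter> W))))"

text \<open>\<open>R\<close> is a subring of \<open>F\<close>.\<close>

definition is_basis ::
  "('a::field, 'k, 'v::ab_group_add) fil_phi_module \<Rightarrow> 'a set \<Rightarrow> 'v set \<Rightarrow> nat \<Rightarrow> (nat \<Rightarrow> 'v) \<Rightarrow> bool"
  where
  "is_basis D R M n b \<longleftrightarrow>
     M = {(\<Sum>l<n. sF D (c l) (b l)) | c. c ` {..<n} \<subseteq> R} \<and>
     (\<forall>c. c ` {..<n} \<subseteq> R \<longrightarrow> (\<Sum>l<n. sF D (c l) (b l)) = 0 \<longrightarrow> (\<forall>l<n. c l = 0))"

text \<open>The determinant of \<open>\<phi>\<close>, as an \<open>F\<close>-linear endomorphism of the \<open>\<phi>\<close>-stable subspace \<open>W\<close>.\<close>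

definition det_phi :: "('a::field, 'k, 'v::ab_group_add) fil_phi_module \<Rightarrow> 'v set \<Rightarrow> 'a" where
  "det_phi D W =
     (THE \<delta>. \<exists>n b M. is_basis D UNIV W n b \<and> M \<in> carrier_mat n n \<and>
        (\<forall>m<n. phi D (b m) = (\<Sum>l<n. sF D (M $$ (l, m)) (b l))) \<and> \<delta> = det M)"

text \<open>\<open>hodge_number\<close> and \<open>newton_number\<close> are both normalised with respect to \<open>F\<close>; they are
  Fontaine's numbers for the underlying filtered module over \<open>K\<close> multiplied by
  \<open>f / [F : \<rat>\<^sub>p]\<close>.\<close>

definition newton_number ::
  "('q, 'a::field, 'k) coeff_data \<Rightarrow> ('a, 'k, 'v::ab_group_add) fil_phi_module \<Rightarrow> 'v set \<Rightarrow> real" where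
  "newton_number S D W = ordF S (det_phi D W)"

definition weakly_admissible ::
  "('q, 'a::field, 'k::field) coeff_data \<Rightarrow> ('a, 'k, 'v::ab_group_add) fil_phi_module \<Rightarrow> bool" where
  "weakly_admissible S D \<longleftrightarrow>
     filtered_phi_module S D \<and>
     real_of_int (hodge_number D UNIV) = newton_number S D UNIV \<and>
     (\<forall>W. submod D UNIV UNIV W \<longrightarrow> phi D ` W \<subseteq> W \<longrightarrow>
        real_of_int (hodge_number D W) \<le> newton_number S D W)"


section \<open>Idempotents and components\<close>

text \<open>A list of pairs \<open>(x, y)\<close> represents the tensor \<open>\<Sum> x \<otimes> y\<close>.
  The idempotent \<open>\<ee>\<^sub>i\<close> is the element of the tensor product of the rings of integers whose image
  under \<open>x \<otimes> y \<mapsto> (x \<tau>\<^sub>l(y))\<^sub>l\<close> is the \<open>i\<close>-th unit vector; since that map is an isomorphism, the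
  action of \<open>\<ee>\<^sub>i\<close> does not depend on the representing list.\<close>

definition tensor_act ::
  "('a, 'k, 'v::ab_group_add) fil_phi_module \<Rightarrow> ('a \<times> 'k) list \<Rightarrow> 'v \<Rightarrow> 'v" where
  "tensor_act D t v = (\<Sum>(x, y)\<leftarrow>t. sF D x (sK D y v))"

definition idem :: "('q, 'a::field, 'k) coeff_data \<Rightarrow> nat \<Rightarrow> ('a \<times> 'k) list" where
  "idem S i = (SOME t. set t \<subseteq> ringF S \<times> ringK S \<and>
     (\<forall>l<res_deg S. (\<Sum>(x, y)\<leftarrow>t. x * emb S l y) = (if l = i then 1 else 0)))"

definition component ::
  "('q, 'a::field, 'k) coeff_data \<Rightarrow> ('a, 'k, 'v::ab_group_add) fil_phi_module \<Rightarrow> nat \<Rightarrow> 'v set \<Rightarrow> 'v set"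
  where
  "component S D i M = tensor_act D (idem S i) ` M"


section \<open>Strongly divisible lattices\<close>

definition phi_lattice ::
  "('q, 'a::field, 'k::field) coeff_data \<Rightarrow> ('a, 'k, 'v::ab_group_add) fil_phi_module \<Rightarrow> 'v set \<Rightarrow> bool"
  where
  "phi_lattice S D L \<longleftrightarrow>
     submod D (ringF S) (ringK S) L \<and>
     (\<exists>B. finite B \<and> L = submod D (ringF S) (ringK S) hull B) \<and>
     submod D UNIV UNIV hull L = UNIV \<and>
     phi D ` L \<subseteq> L"

definition FilL :: "('a, 'k, 'v) fil_phi_module \<Rightarrow> 'v set \<Rightarrow> int \<Rightarrow> 'v set" where
  "FilL D L j = Fil D j \<inter> L"

definition scale_p ::
  "('q, 'a::field, 'k) coeff_data \<Rightarrow> ('a, 'k, 'v) fil_phi_module \<Rightarrow> int \<Rightarrow> 'v \<Rightarrow> 'v" where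
  "scale_p S D j = sF D (of_nat (char_p S) powi j)"

definition strongly_divisible ::
  "('q, 'a::field, 'k::field) coeff_data \<Rightarrow> ('a, 'k, 'v::ab_group_add) fil_phi_module \<Rightarrow> 'v set \<Rightarrow> bool"
  where
  "strongly_divisible S D L \<longleftrightarrow>
     weakly_admissible S D \<and> phi_lattice S D L \<and>
     (\<forall>j. phi D ` FilL D L j \<subseteq> scale_p S D j ` L) \<and>
     {(\<Sum>j\<in>J. scale_p S D (- j) (phi D (x j))) | J x. finite J \<and> (\<forall>j\<in>J. x j \<in> FilL D L j)} = L"

text \<open>Positions \<open>1, \<dots>, d\<close> are numbered \<open>0, \<dots>, d - 1\<close> throughout.\<close>

definition has_hodge_data ::
  "('q, 'a::field, 'k) coeff_data \<Rightarrow> nat \<Rightarrow> (nat \<Rightarrow> nat \<Rightarrow> int) \<Rightarrow>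
   ('a, 'k, 'v::ab_group_add) fil_phi_module \<Rightarrow> bool" where
  "has_hodge_data S d k D \<longleftrightarrow>
     (\<forall>i<res_deg S. \<forall>j.
        int (Vector_Spaces.vector_space.dim (sF D) (component S D i (Fil D j)))
        - int (Vector_Spaces.vector_space.dim (sF D) (component S D i (Fil D (j + 1))))
        = int (card {m. m < d \<and> k i m = j}))"

definition SDL ::
  "('q, 'a::field, 'k::field) coeff_data \<Rightarrow> nat \<Rightarrow> (nat \<Rightarrow> nat \<Rightarrow> int) \<Rightarrow>
   (('a, 'k, 'v::ab_group_add) fil_phi_module \<times> 'v set) set" where
  "SDL S d k = {(D, L). strongly_divisible S D L \<and> has_hodge_data S d k D}"

definition lattice_iso ::
  "('q, 'a, 'k) coeff_data \<Rightarrow> ('a, 'k, 'v::ab_group_add) fil_phi_module \<times> 'v set \<Rightarrow>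
   ('a, 'k, 'v) fil_phi_module \<times> 'v set \<Rightarrow> ('v \<Rightarrow> 'v) \<Rightarrow> bool" where
  "lattice_iso S = (\<lambda>(D, L) (D', L') h.
     bij_betw h L L' \<and>
     (\<forall>x\<in>L. \<forall>y\<in>L. h (x + y) = h x + h y) \<and>
     (\<forall>a\<in>ringF S. \<forall>x\<in>L. h (sF D a x) = sF D' a (h x)) \<and>
     (\<forall>b\<in>ringK S. \<forall>x\<in>L. h (sK D b x) = sK D' b (h x)) \<and>
     (\<forall>x\<in>L. h (phi D x) = phi D' (h x)) \<and>
     (\<forall>j. h ` FilL D L j = FilL D' L' j))"

definition iso_rel ::
  "('q, 'a::field, 'k::field) coeff_data \<Rightarrow> nat \<Rightarrow> (nat \<Rightarrow> nat \<Rightarrow> int) \<Rightarrow>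
   ((('a, 'k, 'v::ab_group_add) fil_phi_module \<times> 'v set) \<times>
    (('a, 'k, 'v) fil_phi_module \<times> 'v set)) set" where
  "iso_rel S d k = {(X, Y). X \<in> SDL S d k \<and> Y \<in> SDL S d k \<and> (\<exists>h. lattice_iso S X Y h)}"

text \<open>\<open>vector_space.dim\<close> of a set is the dimension of its span, so on a sublattice it is the rank
  over the ring of integers of \<open>F\<close>.\<close>

definition adapted_basis ::
  "('q, 'a::field, 'k) coeff_data \<Rightarrow> nat \<Rightarrow> ('a, 'k, 'v::ab_group_add) fil_phi_module \<Rightarrow> 'v set \<Rightarrow>
   nat \<Rightarrow> (nat \<Rightarrow> 'v) \<Rightarrow> bool" where
  "adapted_basis S d D L i e \<longleftrightarrow>
     is_basis D (ringF S) (component S D i L) d e \<and>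
     (\<forall>j. is_basis D (ringF S) (component S D i (FilL D L j))
            (Vector_Spaces.vector_space.dim (sF D) (component S D i (FilL D L j))) e)"


section \<open>Matrices\<close>

definition GLO :: "('q, 'a::field, 'k) coeff_data \<Rightarrow> nat \<Rightarrow> 'a mat set" where
  "GLO S n = {A \<in> carrier_mat n n. elements_mat A \<subseteq> ringF S \<and>
     (\<exists>B \<in> carrier_mat n n. elements_mat B \<subseteq> ringF S \<and> A * B = 1\<^sub>m n \<and> B * A = 1\<^sub>m n)}"

definition GLO_tuples :: "('q, 'a::field, 'k) coeff_data \<Rightarrow> nat \<Rightarrow> (nat \<Rightarrow> 'a mat) set" where
  "GLO_tuples S d = ({..<res_deg S} \<rightarrow>\<^sub>E GLO S d)"

abbreviation minv :: "'a::field mat \<Rightarrow> 'a mat" where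
  "minv A \<equiv> the (mat_inverse A)"

definition Delta :: "('q, 'a::field, 'k) coeff_data \<Rightarrow> nat \<Rightarrow> (nat \<Rightarrow> int) \<Rightarrow> 'a mat" where
  "Delta S d ki = mat_diag d (\<lambda>m. of_nat (char_p S) powi ki m)"

text \<open>\<open>block_bound d ki j\<close> is \<open>r\<^sub>i\<^sub>j\<close>, with \<open>r\<^sub>i\<^sub>0 = 0\<close>: for \<open>j \<ge> 1\<close> it is the dimension of
  \<open>Fil\<close> in degree \<open>k\<^sub>i\<^sub>j\<close> on a component with jumps \<open>ki\<close>. The \<open>j\<close>-th diagonal block occupies
  the rows and columns from \<open>block_bound d ki j\<close> up to, but excluding,
  \<open>block_bound d ki (j + 1)\<close>; it is empty if \<open>k\<^sub>i\<^sub>j\<close> is repeated.\<close>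

definition block_bound :: "nat \<Rightarrow> (nat \<Rightarrow> int) \<Rightarrow> nat \<Rightarrow> nat" where
  "block_bound d ki j = (if j = 0 then 0 else card {m. m < d \<and> ki (j - 1) \<le> ki m})"

definition parabolic :: "('q, 'a::field, 'k) coeff_data \<Rightarrow> nat \<Rightarrow> (nat \<Rightarrow> int) \<Rightarrow> 'a mat set" where
  "parabolic S d ki = {C \<in> GLO S d.
     (\<forall>j\<le>d. \<forall>a<d. \<forall>b<d. block_bound d ki j \<le> a \<longrightarrow> b < block_bound d ki j \<longrightarrow> C $$ (a, b) = 0) \<and>
     (\<forall>j<d. let r = block_bound d ki j; n = block_bound d ki (j + 1) - r
        in mat n n (\<lambda>(a, b). C $$ (r + a, r + b)) \<in> GLO S n)}"

definition sim ::
  "('q, 'a::field, 'k) coeff_data \<Rightarrow> nat \<Rightarrow> (nat \<Rightarrow> nat \<Rightarrow> int) \<Rightarrow>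
   ((nat \<Rightarrow> 'a mat) \<times> (nat \<Rightarrow> 'a mat)) set" where
  "sim S d k = {(A, B). A \<in> GLO_tuples S d \<and> B \<in> GLO_tuples S d \<and>
     (\<exists>C. (\<forall>i<res_deg S. C i \<in> parabolic S d (k i)) \<and>
        (\<forall>i<res_deg S. B i =
           C i * A i * Delta S d (k (prev S i)) * minv (C (prev S i))
             * minv (Delta S d (k (prev S i)))))}"

definition presented_by ::
  "('q, 'a::field, 'k) coeff_data \<Rightarrow> nat \<Rightarrow> (nat \<Rightarrow> nat \<Rightarrow> int) \<Rightarrow> (nat \<Rightarrow> 'a mat) \<Rightarrow>
   ('a, 'k, 'v::ab_group_add) fil_phi_module \<times> 'v set \<Rightarrow> bool" where
  "presented_by S d k A = (\<lambda>(D, L). \<exists>e :: nat \<Rightarrow> nat \<Rightarrow> 'v.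
     (\<forall>i<res_deg S. adapted_basis S d D L i (e i)) \<and>
     (\<forall>i<res_deg S. \<forall>m<d.
        phi D (e (prev S i) m)
        = (\<Sum>l<d. sF D ((A i * Delta S d (k (prev S i))) $$ (l, m)) (e i l))))"

definition Theta ::
  "('q, 'a::field, 'k::field) coeff_data \<Rightarrow> nat \<Rightarrow> (nat \<Rightarrow> nat \<Rightarrow> int) \<Rightarrow> (nat \<Rightarrow> 'a mat) set \<Rightarrow>
   (('a, 'k, 'v::ab_group_add) fil_phi_module \<times> 'v set) set" where
  "Theta S d k T = {X \<in> SDL S d k. \<exists>A\<in>T. presented_by S d k A X}"

end

theory Submission
  imports Defs "HOL-Number_Theory.Cong"
begin

text \<open>
  The idempotents come from an element \<open>a\<close> of \<open>\<O>\<^sub>K\<close> whose conjugates \<open>\<tau>\<^sub>l(a)\<close> differ pairwise by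
  units: they are Lagrange interpolation polynomials evaluated at \<open>a\<close>. Hence a module splits into
  eigenspaces on which \<open>K\<close> acts through \<open>\<tau>\<^sub>i\<close>, and \<open>\<phi>\<close> permutes them cyclically.

  Over the valuation ring \<open>\<O>\<^sub>F\<close> a finitely generated lattice has a basis adapted to any chain of
  subspaces: modulo a hyperplane, all generators are integral multiples of one of them, which can be
  used to clear the others. In adapted bases the divided images \<open>p\<^sup>-\<^sup>j \<phi>(Fil\<^sup>j L)\<close> of a lattice are
  spanned by the columns of \<open>A\<close>, where \<open>A \<Delta>\<close> is the matrix of \<open>\<phi>\<close>; so strong divisibility says
  exactly that \<open>A\<close> lies in \<open>GL\<^sub>d(\<O>\<^sub>F)\<close>. Two adapted bases differ by a parabolic matrix, which is the
  relation \<open>\<sim>\<^sub>k\<close>, and a lattice is determined up to isomorphism by the matrices of \<open>\<phi>\<close>.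

  Conversely, every \<open>A\<close> defines a lattice in coordinates. Its weak admissibility follows by
  intersecting the lattice with a \<open>\<phi>\<close>-stable subspace: in an adapted basis the matrix of \<open>\<phi>\<close> is an
  integral matrix times \<open>Diag(p\<^sup>h)\<close>, so the Newton number is at least the Hodge number, with equality
  on the whole space.
\<close>

section \<open>Non-archimedean absolute values\<close>

locale nonarch_field =
  fixes v :: "'x::field \<Rightarrow> real"
  assumes nonarch: "nonarch_abs v"
begin

lemma nonneg [simp]: "0 \<le> v x"
  and eq_0_iff [simp]: "v x = 0 \<longleftrightarrow> x = 0"
  and mult: "v (x * y) = v x * v y"
  and add_le: "v (x + y) \<le> max (v x) (v y)"
  using nonarch by (auto simp: nonarch_abs_def)

lemma zero [simp]: "v 0 = 0"
  by simp

lemma pos_iff [simp]: "0 < v x \<longleftrightarrow> x \<noteq> 0"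
  using nonneg[of x] eq_0_iff[of x] by linarith

lemma one [simp]: "v 1 = 1"
  using mult[of 1 1] eq_0_iff[of 1] by simp

lemma minus [simp]: "v (- x) = v x"
proof -
  have "v (- 1) * v (- 1) = 1" using mult[of "- 1" "- 1"] by simp
  hence "(v (- 1) - 1) * (v (- 1) + 1) = 0" by (simp add: algebra_simps)
  hence "v (- 1) = 1" using nonneg[of "- 1"] by (auto simp: add_eq_0_iff)
  thus ?thesis using mult[of "- 1" x] by simp
qed

lemma diff_commute: "v (x - y) = v (y - x)"
  using minus[of "x - y"] by simp

lemma diff_le: "v (x - y) \<le> max (v x) (v y)"
  using add_le[of x "- y"] by simp

lemma power: "v (x ^ n) = v x ^ n"
  by (induction n) (auto simp: mult)

lemma inverse: "v (inverse x) = inverse (v x)"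
proof (cases "x = 0")
  case False
  have "v x * v (inverse x) = 1" using mult[of x "inverse x"] False by simp
  thus ?thesis using False by (simp add: field_simps)
qed simp

lemma divide: "v (x / y) = v x / v y"
  by (simp add: divide_inverse mult inverse)

lemma powi: "v (x powi n) = v x powi n"
  by (simp add: power_int_def power inverse)

lemma prod: "v (prod g A) = (\<Prod>x\<in>A. v (g x))"
  by (induction A rule: infinite_finite_induct) (auto simp: mult)

lemma sum_le: "(\<And>x. x \<in> A \<Longrightarrow> v (g x) \<le> C) \<Longrightarrow> 0 \<le> C \<Longrightarrow> v (sum g A) \<le> C"
proof (induction A rule: infinite_finite_induct)
  case (insert a A)
  thus ?case using add_le[of "g a" "sum g A"] by fastforce
qed auto

lemma sum_less: "(\<And>x. x \<in> A \<Longrightarrow> v (g x) < C) \<Longrightarrow> 0 < C \<Longrightarrow> v (sum g A) < C"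
proof (induction A rule: infinite_finite_induct)
  case (insert a A)
  thus ?case using add_le[of "g a" "sum g A"] by fastforce
qed auto

lemma of_nat_le_1: "v (of_nat n) \<le> 1"
  using sum_le[of "{..<n}" "\<lambda>_. 1" 1] by simp

lemma of_int_le_1: "v (of_int n) \<le> 1"
  using of_nat_le_1[of "nat \<bar>n\<bar>"] by (cases "n \<ge> 0") (auto simp: abs_if)

lemma le_1_mult: "v x \<le> 1 \<Longrightarrow> v y \<le> 1 \<Longrightarrow> v (x * y) \<le> 1"
  by (simp add: mult mult_le_one)

lemma le_1_add: "v x \<le> 1 \<Longrightarrow> v y \<le> 1 \<Longrightarrow> v (x + y) \<le> 1"
  using add_le[of x y] by simp

lemma le_1_diff: "v x \<le> 1 \<Longrightarrow> v y \<le> 1 \<Longrightarrow> v (x - y) \<le> 1"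
  using diff_le[of x y] by simp

lemma le_1_power: "v x \<le> 1 \<Longrightarrow> v (x ^ n) \<le> 1"
  by (simp add: power power_le_one)

lemma le_1_prod: "(\<And>x. x \<in> A \<Longrightarrow> v (g x) \<le> 1) \<Longrightarrow> v (prod g A) \<le> 1"
  by (simp add: prod prod_le_1)

lemma add_less: "v x < C \<Longrightarrow> v y < C \<Longrightarrow> v (x + y) < C"
  using add_le[of x y] by simp

lemma diff_less: "v x < C \<Longrightarrow> v y < C \<Longrightarrow> v (x - y) < C"
  using diff_le[of x y] by simp

lemma mult_less_1: "v x < 1 \<Longrightarrow> v y \<le> 1 \<Longrightarrow> v (x * y) < 1"
  using mult_left_le[of "v y" "v x"] nonneg[of x] by (simp add: mult)

lemma unit_if_inverse_integral: "v x \<le> 1 \<Longrightarrow> v y \<le> 1 \<Longrightarrow> x * y = 1 \<Longrightarrow> v x = 1"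
  using mult[of x y] mult_left_le[of "v y" "v x"] by simp

lemma dominant_coefficient:
  fixes n :: nat
  assumes "i < n" "c i \<noteq> 0"
  shows "\<exists>j<n. c j \<noteq> 0 \<and> (\<forall>l<n. v (c l / c j) \<le> 1)"
proof -
  obtain j where j: "j < n" "Max ((\<lambda>l. v (c l)) ` {..<n}) = v (c j)"
    using obtains_MAX[of "{..<n}" "\<lambda>l. v (c l)"] assms(1) by auto
  have max: "v (c l) \<le> v (c j)" if "l < n" for l
    unfolding j(2)[symmetric] using that by (intro Max_ge) auto
  have "c j \<noteq> 0" using max[OF assms(1)] assms(2) by (metis eq_0_iff nonneg order_antisym)
  thus ?thesis using j(1) max by (auto simp: divide divide_le_eq)
qed

lemma power_diff_less_1:
  assumes "v x \<le> 1" "v y \<le> 1" "v (x - y) < 1"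
  shows "v (x ^ n - y ^ n) < 1"
proof (induction n)
  case (Suc n)
  have "x ^ Suc n - y ^ Suc n = (x - y) * x ^ n + (x ^ n - y ^ n) * y"
    by (simp add: algebra_simps)
  thus ?case
    using assms Suc by (auto intro!: add_less mult_less_1 le_1_power)
qed simp

text \<open>The reduction map is injective on \<open>T\<close>.\<close>

definition unit_separated :: "'x set \<Rightarrow> bool" where
  "unit_separated T \<longleftrightarrow> (\<forall>x\<in>T. v x \<le> 1) \<and> (\<forall>x\<in>T. \<forall>y\<in>T. x \<noteq> y \<longrightarrow> v (x - y) = 1)"

lemma unit_separatedD:
  assumes "unit_separated T" "x \<in> T"
  shows "v x \<le> 1" and "y \<in> T \<Longrightarrow> x \<noteq> y \<Longrightarrow> v (x - y) = 1"
  using assms by (auto simp: unit_separated_def)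

lemma unit_separated_subset: "unit_separated T \<Longrightarrow> U \<subseteq> T \<Longrightarrow> unit_separated U"
  unfolding unit_separated_def by blast

definition residue_relation :: "('x \<times> 'x) set" where
  "residue_relation = {(x, y). v x \<le> 1 \<and> v y \<le> 1 \<and> v (x - y) < 1}"

lemma equiv_residue_relation: "equiv {x. v x \<le> 1} residue_relation"
proof (rule equivI)
  show "refl_on {x. v x \<le> 1} residue_relation" "residue_relation \<subseteq> {x. v x \<le> 1} \<times> {x. v x \<le> 1}"
    by (auto simp: residue_relation_def refl_on_def)
  show "sym residue_relation" by (auto simp: residue_relation_def sym_def diff_commute)
  show "trans residue_relation"
  proof (rule transI)
    fix x y z assume "(x, y) \<in> residue_relation" "(y, z) \<in> residue_relation"
    thus "(x, z) \<in> residue_relation"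
      using add_less[of "x - y" 1 "y - z"] by (auto simp: residue_relation_def)
  qed
qed

lemma residue_representatives:
  "\<exists>r. inj_on r ({x. v x \<le> 1} // residue_relation) \<and>
    unit_separated (r ` ({x. v x \<le> 1} // residue_relation))"
proof -
  let ?Q = "{x. v x \<le> 1} // residue_relation"
  define r where "r c = (SOME x. x \<in> c)" for c :: "'x set"
  have r_in: "r c \<in> c" if "c \<in> ?Q" for c
    unfolding r_def
    using in_quotient_imp_non_empty[OF equiv_residue_relation that] by (simp add: some_in_eq)
  have integral: "v (r c) \<le> 1" if "c \<in> ?Q" for c
    using r_in[OF that] in_quotient_imp_subset[OF equiv_residue_relation that] by blast
  have same_class: "c = c'" if "c \<in> ?Q" "c' \<in> ?Q" "v (r c - r c') < 1" for c c'
    using quotient_eqI[OF equiv_residue_relation that(1,2) r_in r_in] integral that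
    by (auto simp: residue_relation_def)
  have "v (r c - r c') = 1" if "c \<in> ?Q" "c' \<in> ?Q" "r c \<noteq> r c'" for c c'
    using same_class[of c c'] le_1_diff[OF integral integral, of c c'] that by fastforce
  hence "unit_separated (r ` ?Q)" using integral by (auto simp: unit_separated_def)
  moreover have "inj_on r ?Q" by (rule inj_onI) (simp add: same_class)
  ultimately show ?thesis by blast
qed

lemma le_1_poly: "(\<And>n. v (coeff p n) \<le> 1) \<Longrightarrow> v x \<le> 1 \<Longrightarrow> v (poly p x) \<le> 1"
  unfolding poly_altdef by (intro sum_le) (auto intro!: le_1_mult le_1_power)

lemma coeff_synthetic_div_le_1:
  assumes "\<And>n. v (coeff p n) \<le> 1" "v a \<le> 1"
  shows "v (coeff (synthetic_div p a) n) \<le> 1"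
  using assms(1)
proof (induction p arbitrary: n)
  case (pCons c p)
  have "v (coeff p m) \<le> 1" for m
    using pCons.prems[of "Suc m"] by simp
  thus ?case
    using pCons.IH le_1_poly[of p a] assms(2) by (cases n) (auto simp: synthetic_div_pCons)
qed auto

lemma coeff_prod_le_1:
  assumes "\<And>m n. m \<in> A \<Longrightarrow> v (coeff (q m) n) \<le> 1"
  shows "v (coeff (\<Prod>m\<in>A. q m) n) \<le> 1"
  using assms
proof (induction A arbitrary: n rule: infinite_finite_induct)
  case (insert m A)
  thus ?case by (auto simp: coeff_mult intro!: sum_le le_1_mult)
qed auto

lemma card_residue_roots_le_degree:
  assumes "finite T" and "unit_separated T"
    and "\<And>n. v (coeff p n) \<le> 1" and "v (lead_coeff p) = 1"
    and "\<And>x. x \<in> T \<Longrightarrow> v (poly p x) < 1"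
  shows "card T \<le> degree p"
  using assms
proof (induction "degree p" arbitrary: p T)
  case 0
  then obtain c where "p = [:c:]" by (metis degree_eq_zeroE)
  hence "T = {}" using 0 by fastforce
  thus ?case by simp
next
  case (Suc N p T)
  show ?case
  proof (cases "T = {}")
    case False
    then obtain a where a: "a \<in> T" by auto
    define q where "q = synthetic_div p a"
    have deg_q: "degree q = N" using Suc.hyps(2) by (simp add: q_def degree_synthetic_div)
    have "coeff (p + smult a q) (Suc N) = coeff (pCons (poly p a) q) (Suc N)"
      by (simp only: q_def synthetic_div_correct)
    hence lead_q: "lead_coeff q = lead_coeff p"
      using deg_q Suc.hyps(2)[symmetric] by (simp add: coeff_eq_0)
    have factor: "poly p x - poly p a = (x - a) * poly q x" for x
      using arg_cong[OF synthetic_div_correct'[of a p], of "\<lambda>r. poly r x"]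
      by (simp add: q_def algebra_simps)
    have "v (poly q x) < 1" if "x \<in> T - {a}" for x
    proof -
      have "v (poly p x - poly p a) < 1" using that a Suc.prems(5) by (intro diff_less) auto
      moreover have "v (x - a) = 1" using unit_separatedD(2)[OF Suc.prems(2)] that a by simp
      ultimately show ?thesis unfolding factor mult by simp
    qed
    moreover have "v (coeff q n) \<le> 1" for n
      unfolding q_def using Suc.prems(3) unit_separatedD(1)[OF Suc.prems(2) a]
      by (rule coeff_synthetic_div_le_1)
    ultimately have "card (T - {a}) \<le> degree q"
      using Suc.hyps(1)[of q "T - {a}"] deg_q lead_q Suc.prems(1,4)
        unit_separated_subset[OF Suc.prems(2), of "T - {a}"] by auto
    thus ?thesis using a Suc.prems(1) deg_q Suc.hyps(2)[symmetric] by simp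
  qed simp
qed

lemma integral_lagrange_basis_poly:
  assumes "finite X" "unit_separated X" "x \<in> X"
  shows "\<exists>q. (\<forall>n. v (coeff q n) \<le> 1) \<and> (\<forall>y\<in>X. poly q y = (if y = x then 1 else 0))"
proof (intro exI conjI allI ballI)
  let ?q = "\<Prod>z\<in>X - {x}. smult (inverse (x - z)) [:- z, 1:]"
  show "v (coeff ?q n) \<le> 1" for n
  proof (rule coeff_prod_le_1)
    fix z n assume z: "z \<in> X - {x}"
    have "v (coeff [:- z, 1:] n) \<le> 1"
      using unit_separatedD(1)[OF assms(2)] z by (auto simp: coeff_pCons split: nat.split)
    moreover have "v (x - z) = 1" using unit_separatedD(2)[OF assms(2,3)] z by auto
    ultimately show "v (coeff (smult (inverse (x - z)) [:- z, 1:]) n) \<le> 1"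
      by (simp only: coeff_smult mult inverse) simp
  qed
  have eval: "poly (smult (inverse (x - z)) [:- z, 1:]) y = (y - z) / (x - z)" for y z
    by (simp add: divide_inverse algebra_simps)
  show "poly ?q y = (if y = x then 1 else 0)" if "y \<in> X" for y
    unfolding poly_prod eval using assms(1) that by (auto intro!: prod.neutral)
qed

end

lemma polyfun_zero_of_many_roots:
  fixes c :: "nat \<Rightarrow> 'x::idom"
  assumes "n \<le> card X" "\<And>x. x \<in> X \<Longrightarrow> (\<Sum>j<n. c j * x ^ j) = 0" "j < n"
  shows "c j = 0"
proof -
  define p where "p = (\<Sum>j<n. monom (c j) j)"
  have "degree p \<le> n - 1" unfolding p_def
    by (rule degree_sum_le) (auto intro: order.trans[OF degree_monom_le])
  moreover have "poly p x = 0" if "x \<in> X" for x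
    using assms(2)[OF that] by (simp add: p_def poly_sum poly_monom)
  ultimately have "p = 0" using assms(1,3) by (intro poly_eqI_degree[of X]) auto
  hence "coeff p j = 0" by simp
  thus ?thesis using assms(3) by (simp add: p_def coeff_sum if_distrib cong: if_cong)
qed

section \<open>Matrices\<close>

lemma index_mult_mat_sum:
  assumes "A \<in> carrier_mat n m" "B \<in> carrier_mat m r" "i < n" "j < r"
  shows "(A * B) $$ (i, j) = (\<Sum>l<m. A $$ (i, l) * B $$ (l, j))"
  using assms by (simp add: scalar_prod_def atLeast0LessThan)

lemma minv_eq:
  fixes A :: "'x::field mat"
  assumes A: "A \<in> carrier_mat n n" and B: "B \<in> carrier_mat n n" and "A * B = 1\<^sub>m n"
  shows "minv A = B"
proof -
  have BA: "B * A = 1\<^sub>m n" using assms by (rule mat_mult_left_right_inverse)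
  have "A \<in> Units (ring_mat TYPE('x) n ())"
    using assms BA unfolding Units_def by (auto simp: ring_mat_simps)
  then obtain B' where B': "mat_inverse A = Some B'"
    using mat_inverse(1)[OF A, where b = "()"] by (cases "mat_inverse A") auto
  hence AB': "A * B' = 1\<^sub>m n" and B'_carrier: "B' \<in> carrier_mat n n" using mat_inverse(2)[OF A] by auto
  have "B' = (B * A) * B'" using BA B'_carrier by simp
  also have "\<dots> = B * (A * B')" using assoc_mult_mat[OF B A B'_carrier] .
  also have "\<dots> = B" using AB' B by simp
  finally show ?thesis using B' by simp
qed

lemma det_mat_diag: "det (mat_diag n g) = (\<Prod>i<n. g i :: 'x::comm_ring_1)"
proof -
  have "upper_triangular (mat_diag n g)" by (auto simp: mat_diag_def)
  hence "det (mat_diag n g) = prod_list (diag_mat (mat_diag n g))"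
    using mat_diag_dim by (rule det_upper_triangular)
  also have "diag_mat (mat_diag n g) = map g [0..<n]"
    by (auto simp: diag_mat_def mat_diag_def intro!: map_cong)
  also have "prod_list (map g [0..<n]) = (\<Prod>i<n. g i)"
    by (simp add: prod.distinct_set_conv_list[symmetric] atLeast0LessThan)
  finally show ?thesis .
qed

lemma matrix_inverse_mult_cancel:
  fixes x :: "nat \<Rightarrow> 'x::comm_ring_1"
  assumes "T \<in> carrier_mat d d" "U \<in> carrier_mat d d" "U * T = 1\<^sub>m d" "m < d"
  shows "(\<Sum>l<d. U $$ (m, l) * (\<Sum>j<d. T $$ (l, j) * x j)) = x m"
proof -
  have "(\<Sum>l<d. U $$ (m, l) * (\<Sum>j<d. T $$ (l, j) * x j)) = (\<Sum>l<d. \<Sum>j<d. U $$ (m, l) * T $$ (l, j) * x j)"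
    by (simp add: sum_distrib_left mult.assoc)
  also have "\<dots> = (\<Sum>j<d. (U * T) $$ (m, j) * x j)"
    using assms(1,2,4)
    by (subst sum.swap, intro sum.cong refl)
      (simp add: index_mult_mat_sum[of _ d d _ d] sum_distrib_right del: index_mult_mat)
  also have "\<dots> = x m"
    using assms(4) unfolding assms(3) by (subst sum.mono_neutral_right[of _ "{m}"]) auto
  finally show ?thesis .
qed

definition zero_below :: "nat \<Rightarrow> 'x::zero mat \<Rightarrow> bool" where
  "zero_below r C \<longleftrightarrow> (\<forall>a b. r \<le> a \<longrightarrow> a < dim_row C \<longrightarrow> b < r \<longrightarrow> C $$ (a, b) = 0)"

lemma leading_block_det_nonzero:
  fixes C :: "'x::field mat"
  assumes C: "C \<in> carrier_mat d d" and "r \<le> d" and "zero_below r C" and "det C \<noteq> 0"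
  shows "det (mat r r (\<lambda>(a, b). C $$ (a, b))) \<noteq> 0"
proof -
  define P where "P = mat r r (\<lambda>(a, b). C $$ (a, b))"
  define Q where "Q = mat r (d - r) (\<lambda>(a, b). C $$ (a, r + b))"
  define R where "R = mat (d - r) (d - r) (\<lambda>(a, b). C $$ (r + a, r + b))"
  have "C = four_block_mat P Q (0\<^sub>m (d - r) r) R"
    using C \<open>r \<le> d\<close> \<open>zero_below r C\<close> by (intro eq_matI) (auto simp: P_def Q_def R_def zero_below_def)
  also have "det \<dots> = det P * det R"
    by (rule det_four_block_mat_lower_left_zero) (auto simp: P_def Q_def R_def)
  finally show ?thesis using \<open>det C \<noteq> 0\<close> by (auto simp: P_def)
qed

text \<open>The lower left block \<open>X\<close> of the inverse and the leading block \<open>P\<close> of \<open>C\<close> satisfy \<open>X P = 0\<close>.\<close>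

lemma zero_below_inverse:
  fixes C :: "'x::field mat"
  assumes C: "C \<in> carrier_mat d d" and B: "B \<in> carrier_mat d d" and BC: "B * C = 1\<^sub>m d"
    and r: "r \<le> d" and zero: "zero_below r C"
  shows "zero_below r B"
  unfolding zero_below_def
proof (intro allI impI)
  fix a b assume ab: "r \<le> a" "a < dim_row B" "b < r"
  define P where "P = mat r r (\<lambda>(i, j). C $$ (i, j))"
  have P: "P \<in> carrier_mat r r" by (simp add: P_def)
  have "det B * det C = 1" using det_mult[OF B C] BC by simp
  hence "det C \<noteq> 0" by auto
  hence "det P \<noteq> 0" unfolding P_def by (rule leading_block_det_nonzero[OF C r zero])
  hence "det (transpose_mat P) \<noteq> 0" by (simp add: det_transpose[OF P])
  define z where "z = vec r (\<lambda>c. B $$ (a, c))"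
  have "transpose_mat P *\<^sub>v z = 0\<^sub>v r"
  proof (rule eq_vecI)
    fix j assume "j < dim_vec (0\<^sub>v r)"
    hence j: "j < r" by simp
    have "(transpose_mat P *\<^sub>v z) $ j = (\<Sum>c<r. B $$ (a, c) * C $$ (c, j))"
      using j by (simp add: P_def z_def scalar_prod_def atLeast0LessThan mult.commute)
    also have "\<dots> = (\<Sum>c<d. B $$ (a, c) * C $$ (c, j))"
      using r zero j C by (intro sum.mono_neutral_left) (auto simp: zero_below_def)
    also have "\<dots> = (B * C) $$ (a, j)" using index_mult_mat_sum[OF B C] ab B j r by simp
    also have "\<dots> = 0" unfolding BC using ab B j r by simp
    finally show "(transpose_mat P *\<^sub>v z) $ j = 0\<^sub>v r $ j" using j by simp
  qed (simp add: P_def)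
  moreover have "z \<in> carrier_vec r" by (simp add: z_def)
  ultimately have "z = 0\<^sub>v r"
    using det_0_iff_vec_prod_zero_field[of "transpose_mat P" r] \<open>det (transpose_mat P) \<noteq> 0\<close> P by auto
  from arg_cong[OF this, of "\<lambda>z. z $ b"] show "B $$ (a, b) = 0" using ab(3) by (simp add: z_def)
qed

definition diag_block :: "nat \<Rightarrow> nat \<Rightarrow> 'x mat \<Rightarrow> 'x mat" where
  "diag_block r n C = mat n n (\<lambda>(a, b). C $$ (r + a, r + b))"

lemma diag_block_mult:
  assumes C: "C \<in> carrier_mat d d" and B: "B \<in> carrier_mat d d" and "r + n \<le> d"
    and "zero_below r C" "zero_below (r + n) B"
  shows "diag_block r n (C * B) = diag_block r n C * diag_block r n B"
proof (rule eq_matI)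
  fix a b
  assume "a < dim_row (diag_block r n C * diag_block r n B)"
    and "b < dim_col (diag_block r n C * diag_block r n B)"
  hence ab: "a < n" "b < n" by (auto simp: diag_block_def)
  have "diag_block r n (C * B) $$ (a, b) = (\<Sum>c<d. C $$ (r + a, c) * B $$ (c, r + b))"
    using ab \<open>r + n \<le> d\<close> index_mult_mat_sum[OF C B] by (simp add: diag_block_def)
  also have "\<dots> = (\<Sum>c\<in>{r..<r + n}. C $$ (r + a, c) * B $$ (c, r + b))"
    using assms ab by (intro sum.mono_neutral_right) (auto simp: zero_below_def)
  also have "\<dots> = (\<Sum>c<n. C $$ (r + a, r + c) * B $$ (r + c, r + b))"
    by (rule sum.reindex_bij_witness[of _ "\<lambda>c. r + c" "\<lambda>c. c - r"]) auto
  also have "\<dots> = (diag_block r n C * diag_block r n B) $$ (a, b)"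
    using ab by (subst index_mult_mat_sum[of _ n n _ n]) (auto simp: diag_block_def)
  finally show "diag_block r n (C * B) $$ (a, b) = (diag_block r n C * diag_block r n B) $$ (a, b)" .
qed (auto simp: diag_block_def)

context nonarch_field
begin

definition integral_mat :: "nat \<Rightarrow> 'x mat \<Rightarrow> bool" where
  "integral_mat n A \<longleftrightarrow> A \<in> carrier_mat n n \<and> (\<forall>i<n. \<forall>j<n. v (A $$ (i, j)) \<le> 1)"

lemma integral_mat_carrier: "integral_mat n A \<Longrightarrow> A \<in> carrier_mat n n"
  by (simp add: integral_mat_def)

lemma integral_mat_one: "integral_mat n (1\<^sub>m n)"
  by (simp add: integral_mat_def)

lemma integral_mat_mult:
  assumes A: "integral_mat n A" and B: "integral_mat n B"
  shows "integral_mat n (A * B)"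
proof -
  note carrier = integral_mat_carrier[OF A] integral_mat_carrier[OF B]
  have "v ((A * B) $$ (i, j)) \<le> 1" if "i < n" "j < n" for i j
    unfolding index_mult_mat_sum[OF carrier that]
    using A B that by (intro sum_le le_1_mult) (auto simp: integral_mat_def)
  thus ?thesis using carrier by (auto simp: integral_mat_def)
qed

lemma integral_mat_diag_block: "integral_mat d A \<Longrightarrow> r + n \<le> d \<Longrightarrow> integral_mat n (diag_block r n A)"
  by (simp add: integral_mat_def diag_block_def)

lemma det_integral:
  assumes A: "integral_mat n A"
  shows "v (det A) \<le> 1"
proof -
  have "v (signof \<pi> * (\<Prod>i = 0..<n. A $$ (i, \<pi> i))) \<le> 1" if "\<pi> permutes {0..<n}" for \<pi>
  proof (rule le_1_mult)
    have "\<pi> i < n" if "i < n" for i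
      using that \<open>\<pi> permutes {0..<n}\<close> permutes_in_image[of \<pi> "{0..<n}" i] by auto
    thus "v (\<Prod>i = 0..<n. A $$ (i, \<pi> i)) \<le> 1"
      using A by (intro le_1_prod) (auto simp: integral_mat_def)
  qed (auto simp: sign_def)
  thus ?thesis unfolding det_def'[OF integral_mat_carrier[OF A]] by (intro sum_le) auto
qed

lemma det_unit_if_inverse_integral:
  assumes "integral_mat n A" "integral_mat n B" "A * B = 1\<^sub>m n"
  shows "v (det A) = 1"
  using assms det_mult[of A n B] det_integral unit_if_inverse_integral[of "det A" "det B"]
  by (auto simp: integral_mat_carrier)

end

section \<open>Families of vectors\<close>

text \<open>A copy of the library locale, whose global interpretation for real vector spaces would otherwise
  shadow the constants defined here.\<close>

locale lin_space = vector_space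
begin

definition indep_family :: "nat \<Rightarrow> (nat \<Rightarrow> 'b) \<Rightarrow> bool" where
  "indep_family n b \<longleftrightarrow> (\<forall>c. (\<Sum>l<n. scale (c l) (b l)) = 0 \<longrightarrow> (\<forall>l<n. c l = 0))"

lemma indep_familyD: "indep_family n b \<Longrightarrow> (\<Sum>l<n. scale (c l) (b l)) = 0 \<Longrightarrow> l < n \<Longrightarrow> c l = 0"
  unfolding indep_family_def by blast

lemma sum_in_span: "(\<Sum>l<(n::nat). scale (c l) (b l)) \<in> span (b ` {..<n})"
  by (intro span_sum span_scale span_base) auto

lemma sum_unit_coeff: "j < (n::nat) \<Longrightarrow> (\<Sum>l<n. scale (if l = j then 1 else 0) (b l)) = b j"
  by (subst sum.mono_neutral_right[of _ "{j}"]) auto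

lemma span_family: "span (b ` {..<n::nat}) = range (\<lambda>c. \<Sum>l<n. scale (c l) (b l))"
proof
  show "range (\<lambda>c. \<Sum>l<n. scale (c l) (b l)) \<subseteq> span (b ` {..<n})"
    by (auto intro: sum_in_span)
  show "span (b ` {..<n}) \<subseteq> range (\<lambda>c. \<Sum>l<n. scale (c l) (b l))"
  proof (induction n)
    case (Suc n)
    show ?case
    proof
      fix x assume "x \<in> span (b ` {..<Suc n})"
      then obtain a where "x - scale a (b n) \<in> span (b ` {..<n})"
        by (auto simp: lessThan_Suc span_breakdown_eq)
      then obtain c where "x - scale a (b n) = (\<Sum>l<n. scale (c l) (b l))" using Suc.IH by auto
      hence "x = (\<Sum>l<Suc n. scale ((c(n := a)) l) (b l))" by (simp add: diff_eq_eq)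
      thus "x \<in> range (\<lambda>c. \<Sum>l<Suc n. scale (c l) (b l))" by (rule range_eqI[of _ _ "c(n := a)"])
    qed
  qed simp
qed

lemma indep_family_coeff_eq:
  assumes "indep_family n b" "(\<Sum>l<n. scale (c l) (b l)) = (\<Sum>l<n. scale (c' l) (b l))" "l < n"
  shows "c l = c' l"
proof -
  have "(\<Sum>l<n. scale (c l - c' l) (b l)) = 0"
    using assms(2) by (simp add: scale_left_diff_distrib sum_subtractf)
  from indep_familyD[OF assms(1) this assms(3)] show ?thesis by simp
qed

lemma indep_family_Suc:
  "indep_family (Suc n) b \<longleftrightarrow> indep_family n b \<and> b n \<notin> span (b ` {..<n})"
proof
  assume indep: "indep_family (Suc n) b"
  have "c l = 0" if "(\<Sum>l<n. scale (c l) (b l)) = 0" "l < n" for c l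
    using indep_familyD[OF indep, of "c(n := 0)" l] that by simp
  moreover have "b n \<notin> span (b ` {..<n})"
  proof
    assume "b n \<in> span (b ` {..<n})"
    then obtain c where "b n = (\<Sum>l<n. scale (c l) (b l))" unfolding span_family by auto
    thus False using indep_familyD[OF indep, of "c(n := - 1)" n] by simp
  qed
  ultimately show "indep_family n b \<and> b n \<notin> span (b ` {..<n})" unfolding indep_family_def by blast
next
  assume indep: "indep_family n b \<and> b n \<notin> span (b ` {..<n})"
  have "c l = 0" if sum: "(\<Sum>l<Suc n. scale (c l) (b l)) = 0" and "l < Suc n" for c l
  proof -
    have last: "c n = 0"
    proof (rule ccontr)
      assume "c n \<noteq> 0"
      have "scale (c n) (b n) = - (\<Sum>l<n. scale (c l) (b l))"
        using sum by (simp add: eq_neg_iff_add_eq_0 add.commute)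
      hence "scale (inverse (c n)) (scale (c n) (b n)) \<in> span (b ` {..<n})"
        by (simp only: span_scale span_neg sum_in_span)
      thus False using indep \<open>c n \<noteq> 0\<close> by simp
    qed
    hence "(\<Sum>l<n. scale (c l) (b l)) = 0" using sum by simp
    thus ?thesis using indep last \<open>l < Suc n\<close> by (cases "l = n") (auto intro: indep_familyD)
  qed
  thus "indep_family (Suc n) b" unfolding indep_family_def by blast
qed

lemma indep_family_0 [simp]: "indep_family 0 b"
  by (simp add: indep_family_def)

lemma indep_family_mono: "indep_family n b \<Longrightarrow> m \<le> n \<Longrightarrow> indep_family m b"
  by (induction n) (auto simp: indep_family_Suc le_Suc_eq)

lemma indep_family_cong: "(\<And>l. l < n \<Longrightarrow> b l = b' l) \<Longrightarrow> indep_family n b \<longleftrightarrow> indep_family n b'"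
  by (simp add: indep_family_def)

lemma indep_family_fun_upd:
  "indep_family n b \<Longrightarrow> x \<notin> span (b ` {..<n}) \<Longrightarrow> indep_family (Suc n) (b(n := x))"
  using indep_family_cong[of n b "b(n := x)"] by (simp add: indep_family_Suc)

lemma finite_dimensional_if_finite_basis:
  assumes "independent B" "span B = UNIV" "finite B"
  shows "finite_dimensional_vector_space scale (extend_basis {})"
proof unfold_locales
  show "independent (extend_basis {})" "span (extend_basis {}) = UNIV"
    using independent_extend_basis span_extend_basis independent_empty by auto
  thus "finite (extend_basis {})" using independent_span_bound[of B] assms by simp
qed

lemma finite_dimensional_if_spanned:
  assumes "finite B" "span B = UNIV"
  shows "finite_dimensional_vector_space scale (extend_basis {})"
proof -
  obtain C where "independent C" "UNIV \<subseteq> span C" by (rule basis_exists[of UNIV])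
  thus ?thesis
    using independent_span_bound[of B C] assms by (intro finite_dimensional_if_finite_basis[of C]) auto
qed

lemma finite_dimensional_if_dim_pos:
  assumes "dim UNIV > 0"
  shows "finite_dimensional_vector_space scale (extend_basis {})"
proof -
  obtain C where "independent C" "UNIV \<subseteq> span C" "card C = dim UNIV" by (rule basis_exists[of UNIV])
  thus ?thesis
    using assms card_ge_0_finite[of C] by (intro finite_dimensional_if_finite_basis[of C]) auto
qed

definition row_mult :: "nat \<Rightarrow> (nat \<Rightarrow> 'b) \<Rightarrow> 'a mat \<Rightarrow> nat \<Rightarrow> 'b" where
  "row_mult n e T m = (\<Sum>l<n. scale (T $$ (l, m)) (e l))"

lemma row_mult_assoc:
  assumes "T \<in> carrier_mat n n" "U \<in> carrier_mat n n" "m < n"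
  shows "row_mult n (row_mult n e T) U m = row_mult n e (T * U) m"
proof -
  have "row_mult n (row_mult n e T) U m = (\<Sum>l<n. \<Sum>l'<n. scale (T $$ (l', l) * U $$ (l, m)) (e l'))"
    by (simp add: row_mult_def scale_sum_right mult.commute)
  also have "\<dots> = (\<Sum>l'<n. scale (\<Sum>l<n. T $$ (l', l) * U $$ (l, m)) (e l'))"
    by (subst sum.swap) (simp add: scale_sum_left)
  also have "\<dots> = row_mult n e (T * U) m"
    unfolding row_mult_def using assms
    by (intro sum.cong refl) (simp add: index_mult_mat_sum[of _ n n _ n] del: index_mult_mat)
  finally show ?thesis .
qed

lemma row_mult_one: "m < n \<Longrightarrow> row_mult n e (1\<^sub>m n) m = e m"
  unfolding row_mult_def by (subst sum.mono_neutral_right[of _ "{m}"]) auto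

lemma row_mult_cong: "(\<And>l. l < n \<Longrightarrow> e l = e' l) \<Longrightarrow> row_mult n e T m = row_mult n e' T m"
  by (simp add: row_mult_def)

lemma row_mult_inj:
  assumes "indep_family n e" "T \<in> carrier_mat n n" "U \<in> carrier_mat n n"
    and "\<And>m. m < n \<Longrightarrow> row_mult n e T m = row_mult n e U m"
  shows "T = U"
  using assms indep_family_coeff_eq[OF assms(1) assms(4)[unfolded row_mult_def]]
  by (intro eq_matI) auto

lemma sum_row_mult:
  "(\<Sum>m<n. scale (c m) (row_mult n e T m)) = (\<Sum>l<n. scale (\<Sum>m<n. T $$ (l, m) * c m) (e l))"
  by (simp add: row_mult_def scale_sum_right scale_sum_left mult.commute) (rule sum.swap)

lemma indep_family_row_mult:
  assumes e: "indep_family n e" and TU: "T \<in> carrier_mat n n" "U \<in> carrier_mat n n" "U * T = 1\<^sub>m n"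
  shows "indep_family n (row_mult n e T)"
  unfolding indep_family_def
proof (intro allI impI)
  fix c j assume "(\<Sum>m<n. scale (c m) (row_mult n e T m)) = 0" and j: "j < n"
  hence "(\<Sum>m<n. T $$ (l, m) * c m) = 0" if "l < n" for l
    using indep_familyD[OF e _ that, of "\<lambda>l. \<Sum>m<n. T $$ (l, m) * c m"] by (simp add: sum_row_mult)
  thus "c j = 0" using matrix_inverse_mult_cancel[OF TU j, of c] by simp
qed

lemma row_mult_exists:
  assumes "\<And>m. m < n \<Longrightarrow> x m \<in> span (b ` {..<n})"
  shows "\<exists>T\<in>carrier_mat n n. \<forall>m<n. x m = row_mult n b T m"
proof -
  have "\<forall>m. \<exists>c. m < n \<longrightarrow> x m = (\<Sum>l<n. scale (c l) (b l))"
    using assms unfolding span_family by blast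
  then obtain c where "\<And>m. m < n \<Longrightarrow> x m = (\<Sum>l<n. scale (c m l) (b l))" by metis
  thus ?thesis by (intro bexI[of _ "mat n n (\<lambda>(l, m). c m l)"]) (auto simp: row_mult_def)
qed

lemma linear_row_mult:
  assumes "Vector_Spaces.linear scale scale \<phi>"
  shows "\<phi> (row_mult n e T m) = row_mult n (\<lambda>l. \<phi> (e l)) T m"
proof -
  interpret \<phi>: Vector_Spaces.linear scale scale \<phi> by fact
  show ?thesis by (simp add: row_mult_def \<phi>.sum \<phi>.scale)
qed

lemma det_basis_independent:
  assumes \<phi>: "Vector_Spaces.linear scale scale \<phi>"
    and b': "indep_family n b'" and span_eq: "span (b ` {..<n}) = span (b' ` {..<n})"
    and M: "M \<in> carrier_mat n n" "\<And>m. m < n \<Longrightarrow> \<phi> (b m) = row_mult n b M m"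
    and M': "M' \<in> carrier_mat n n" "\<And>m. m < n \<Longrightarrow> \<phi> (b' m) = row_mult n b' M' m"
  shows "det M' = det M"
proof -
  have "b' m \<in> span (b ` {..<n})" "b m \<in> span (b' ` {..<n})" if "m < n" for m
    using span_base[of "b' m" "b' ` {..<n}"] span_base[of "b m" "b ` {..<n}"] that span_eq by auto
  then obtain T U where T: "T \<in> carrier_mat n n" "\<And>m. m < n \<Longrightarrow> b' m = row_mult n b T m"
    and U: "U \<in> carrier_mat n n" "\<And>m. m < n \<Longrightarrow> b m = row_mult n b' U m"
    using row_mult_exists[of n b' b] row_mult_exists[of n b b'] by metis
  have UT: "U * T = 1\<^sub>m n"
  proof (rule row_mult_inj[OF b'])
    fix m assume m: "m < n"
    have "row_mult n b' (U * T) m = row_mult n (row_mult n b' U) T m"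
      using row_mult_assoc[OF U(1) T(1) m] by simp
    also have "\<dots> = b' m" using U(2) T(2)[OF m] row_mult_cong[of n b "row_mult n b' U"] by simp
    finally show "row_mult n b' (U * T) m = row_mult n b' (1\<^sub>m n) m" by (simp add: row_mult_one[OF m])
  qed (use T U in auto)
  have "M' = U * M * T"
  proof (rule row_mult_inj[OF b' M'(1)])
    show "U * M * T \<in> carrier_mat n n" using T(1) U(1) M(1) by auto
    fix m assume m: "m < n"
    have "row_mult n b' M' m = row_mult n (\<lambda>l. \<phi> (b l)) T m"
      using M'(2)[OF m] T(2)[OF m] linear_row_mult[OF \<phi>] by simp
    also have "\<dots> = row_mult n (row_mult n b M) T m" using M(2) by (rule row_mult_cong)
    also have "\<dots> = row_mult n b (M * T) m" using M(1) T(1) m by (rule row_mult_assoc)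
    also have "\<dots> = row_mult n (row_mult n b' U) (M * T) m" using U(2) by (rule row_mult_cong)
    also have "\<dots> = row_mult n b' (U * M * T) m"
      using M(1) T(1) U(1) m by (subst row_mult_assoc) (auto simp: assoc_mult_mat[of _ n n _ n _ n])
    finally show "row_mult n b' M' m = row_mult n b' (U * M * T) m" .
  qed
  hence "det M' = det U * det M * det T"
    using det_mult[of "U * M" n T] det_mult[OF U(1) M(1)] T(1) U(1) M(1) by auto
  moreover have "det U * det T = 1" using det_mult[OF U(1) T(1)] UT by simp
  ultimately show ?thesis by (simp add: mult.commute mult.left_commute)
qed

lemma det_nonzero_if_inj:
  assumes \<phi>: "Vector_Spaces.linear scale scale \<phi>" and inj: "inj \<phi>"
    and b: "indep_family n b" and M: "M \<in> carrier_mat n n"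
    and matrix: "\<And>m. m < n \<Longrightarrow> \<phi> (b m) = row_mult n b M m"
  shows "det M \<noteq> 0"
proof
  interpret \<phi>: Vector_Spaces.linear scale scale \<phi> by fact
  assume "det M = 0"
  then obtain x where x: "x \<in> carrier_vec n" "x \<noteq> 0\<^sub>v n" "M *\<^sub>v x = 0\<^sub>v n"
    using det_0_iff_vec_prod_zero_field[OF M] by blast
  have "\<phi> (\<Sum>m<n. scale (x $ m) (b m)) = (\<Sum>l<n. scale (\<Sum>m<n. M $$ (l, m) * x $ m) (b l))"
    using matrix by (simp add: \<phi>.sum \<phi>.scale flip: sum_row_mult)
  also have "\<dots> = (\<Sum>l<n. scale ((M *\<^sub>v x) $ l) (b l))"
    using M x(1) by (simp add: scalar_prod_def atLeast0LessThan)
  also have "\<dots> = \<phi> 0" unfolding x(3) by simp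
  finally have "(\<Sum>m<n. scale (x $ m) (b m)) = 0" by (rule injD[OF inj])
  hence "x = 0\<^sub>v n" using x(1) indep_familyD[OF b, of "\<lambda>m. x $ m"] by (intro eq_vecI) auto
  thus False using x(2) by simp
qed

end

locale fin_dim_lin_space = lin_space + finite_dimensional_vector_space
begin

lemma indep_family_iff_dim: "indep_family n b \<longleftrightarrow> dim (b ` {..<n}) = n"
proof (induction n)
  case (Suc n)
  have "dim (b ` {..<n}) \<le> n"
    using dim_le_card[OF span_superset, of "b ` {..<n}"] card_image_le[of "{..<n}" b] by simp
  thus ?case using Suc by (auto simp: indep_family_Suc lessThan_Suc dim_insert)
qed simp

lemma indep_family_spans:
  assumes "subspace U" "indep_family (dim U) b" "b ` {..<dim U} \<subseteq> U"
  shows "span (b ` {..<dim U}) = U"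
  using assms dim_eq_span[of "b ` {..<dim U}" U] by (simp add: indep_family_iff_dim)

lemma proper_subspace_above_chain:
  assumes V: "subspace V" "dim V > 0"
    and subspaces: "\<forall>W\<in>C. subspace W \<and> W \<subseteq> V" and chain: "chain_subset C"
  shows "\<exists>U. subspace U \<and> U \<subset> V \<and> (\<forall>W\<in>C. W = V \<or> W \<subseteq> U)"
proof (cases "C - {V} = {}")
  case True
  have "{0} \<subset> V" using V dim_eq_0[of V] subspace_0[OF V(1)] by auto
  thus ?thesis using True by (intro exI[of _ "{0}"]) auto
next
  case False
  then obtain W0 where W0: "W0 \<in> C - {V}" by blast
  have "\<exists>U. U \<in> C - {V} \<and> (\<forall>W. W \<in> C - {V} \<longrightarrow> dim W \<le> dim U)"
    using W0 by (rule ex_has_greatest_nat[of _ _ _ "Suc (dim V)"])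
      (use subspaces dim_subset in \<open>auto simp: less_Suc_eq_le\<close>)
  then obtain U where U: "U \<in> C - {V}" and max: "\<And>W. W \<in> C - {V} \<Longrightarrow> dim W \<le> dim U"
    by auto
  have "W \<subseteq> U" if W: "W \<in> C - {V}" for W
  proof (cases "W \<subseteq> U")
    case False
    hence "U \<subseteq> W" using chain U W unfolding chain_subset_def by blast
    thus ?thesis using subspace_dim_equal[of U W] subspaces U W max[OF W] by auto
  qed simp
  thus ?thesis using U subspaces by (intro exI[of _ U]) auto
qed

lemma hyperplane_above_chain:
  assumes V: "subspace V" "dim V = Suc n"
    and C: "\<forall>W\<in>C. subspace W \<and> W \<subseteq> V" "chain_subset C"
  shows "\<exists>H b. subspace H \<and> dim H = n \<and> b \<notin> H \<and> V = span (insert b H) \<and>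
    (\<forall>W\<in>C. W = V \<or> W \<subseteq> H)"
proof -
  obtain U where U: "subspace U" "U \<subset> V" "\<forall>W\<in>C. W = V \<or> W \<subseteq> U"
    using proper_subspace_above_chain[OF V(1) _ C] V(2) by auto
  obtain B where B: "B \<subseteq> U" "independent B" "span B = U" using basis_subspace_exists[OF U(1)] .
  have "B \<subseteq> V" using B(1) U(2) by blast
  then obtain B' where B': "B \<subseteq> B'" "B' \<subseteq> V" "independent B'" "V \<subseteq> span B'"
    by (rule maximal_independent_subset_extend[OF _ B(2)])
  have span_B': "span B' = V" using span_subspace[OF B'(2,4) V(1)] .
  have "B' \<noteq> B" using span_B' B(3) U(2) by blast
  then obtain b where b: "b \<in> B'" "b \<notin> B" using B'(1) by blast
  have "card B' = Suc n" using basis_card_eq_dim[OF B'(2,4,3)] V(2) by simp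
  hence "dim (span (B' - {b})) = n"
    using b(1) dim_eq_card_independent[OF independent_mono[OF B'(3)], of "B' - {b}"] by simp
  moreover have "b \<notin> span (B' - {b})" using B'(3) b(1) unfolding dependent_def by blast
  moreover have "V = span (insert b (span (B' - {b})))"
    unfolding span_B'[symmetric] span_insert[of b "span _"] span_span
    by (simp only: span_insert[symmetric] insert_Diff[OF b(1)])
  moreover have "U \<subseteq> span (B' - {b})"
    unfolding B(3)[symmetric] using b(2) B'(1) by (intro span_mono) auto
  hence "\<forall>W\<in>C. W = V \<or> W \<subseteq> span (B' - {b})" using U(3) by blast
  ultimately show ?thesis using subspace_span[of "B' - {b}"]
    by (intro exI[of _ "span (B' - {b})"] exI[of _ b]) simp
qed

end

text \<open>A basis indexed by \<open>{..<a} \<times> {..<b}\<close> together with its coordinate functions; only the values at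
  such indices are meaningful.\<close>

locale grid_coordinates = lin_space scale
  for scale :: "'a::field \<Rightarrow> 'b::ab_group_add \<Rightarrow> 'b" +
  fixes a b :: nat and e :: "nat \<Rightarrow> nat \<Rightarrow> 'b" and co :: "'b \<Rightarrow> nat \<Rightarrow> nat \<Rightarrow> 'a"
  assumes expand: "(\<Sum>i<a. \<Sum>m<b. scale (co x i m) (e i m)) = x"
    and co_sum: "i < a \<Longrightarrow> m < b \<Longrightarrow> co (\<Sum>i<a. \<Sum>m<b. scale (c i m) (e i m)) i m = c i m"
begin

definition grid_vector :: "(nat \<Rightarrow> nat \<Rightarrow> 'a) \<Rightarrow> 'b" where
  "grid_vector c = (\<Sum>i<a. \<Sum>m<b. scale (c i m) (e i m))"

lemma grid_vector_co [simp]: "grid_vector (co x) = x"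
  by (simp add: grid_vector_def expand)

lemma co_grid_vector [simp]: "i < a \<Longrightarrow> m < b \<Longrightarrow> co (grid_vector c) i m = c i m"
  by (simp add: grid_vector_def co_sum)

lemma co_eqI:
  assumes "\<And>i m. i < a \<Longrightarrow> m < b \<Longrightarrow> co x i m = co y i m"
  shows "x = y"
proof -
  have "grid_vector (co x) = grid_vector (co y)"
    unfolding grid_vector_def using assms by (intro sum.cong) auto
  thus ?thesis by simp
qed

lemma co_add [simp]:
  assumes "i < a" "m < b"
  shows "co (x + y) i m = co x i m + co y i m"
proof -
  have "x + y = grid_vector (\<lambda>i m. co x i m + co y i m)"
    by (simp add: grid_vector_def scale_left_distrib sum.distrib expand)
  thus ?thesis using assms by simp
qed

lemma co_scale [simp]:
  assumes "i < a" "m < b"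
  shows "co (scale r x) i m = r * co x i m"
proof -
  have "scale r x = grid_vector (\<lambda>i m. r * co x i m)"
    using arg_cong[OF expand[of x], of "scale r"] by (simp add: grid_vector_def scale_sum_right)
  thus ?thesis using assms by simp
qed

lemma co_zero [simp]: "i < a \<Longrightarrow> m < b \<Longrightarrow> co 0 i m = 0"
  using co_scale[of i m 0 0] by simp

lemma co_minus [simp]: "i < a \<Longrightarrow> m < b \<Longrightarrow> co (- x) i m = - co x i m"
  using co_scale[of i m "- 1" x] by simp

lemma co_sum_set: "i < a \<Longrightarrow> m < b \<Longrightarrow> co (sum h J) i m = (\<Sum>x\<in>J. co (h x) i m)"
  by (induction J rule: infinite_finite_induct) auto

lemma co_basis [simp]:
  assumes "i < a" "m < b" "i' < a" "m' < b"
  shows "co (e i' m') i m = (if i = i' \<and> m = m' then 1 else 0)"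
proof -
  have "grid_vector (\<lambda>i m. if i = i' \<and> m = m' then 1 else 0)
      = (\<Sum>i<a. \<Sum>m<b. if i = i' then if m = m' then e i m else 0 else 0)"
    unfolding grid_vector_def by (intro sum.cong) auto
  also have "\<dots> = (\<Sum>i<a. if i = i' then \<Sum>m<b. if m = m' then e i m else 0 else 0)"
    by (intro sum.cong) auto
  also have "\<dots> = e i' m'" using assms by simp
  finally show ?thesis
    using co_grid_vector[OF assms(1,2), of "\<lambda>i m. if i = i' \<and> m = m' then 1 else 0"] by simp
qed

lemma co_row_sum:
  assumes "i < a" "n \<le> b" "i' < a" "m < b"
  shows "co (\<Sum>m<n. scale (c m) (e i m)) i' m = (if i' = i \<and> m < n then c m else 0)"
proof -
  have "co (\<Sum>m<n. scale (c m) (e i m)) i' m = (\<Sum>m'<n. if i' = i \<and> m = m' then c m' else 0)"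
    using assms by (auto simp: co_sum_set intro!: sum.cong)
  also have "\<dots> = (if i' = i \<and> m < n then c m else 0)" by (cases "i' = i") auto
  finally show ?thesis .
qed

lemma indep_family_row:
  assumes "i < a"
  shows "indep_family b (e i)"
  unfolding indep_family_def
proof (intro allI impI)
  fix c m assume "(\<Sum>l<b. scale (c l) (e i l)) = 0" "m < b"
  thus "c m = 0" using co_row_sum[OF assms order_refl assms, of m c] assms by simp
qed

lemma row_sum_iff:
  assumes i: "i < a" and n: "n \<le> b"
  shows "x = (\<Sum>m<n. scale (c m) (e i m)) \<longleftrightarrow>
    (\<forall>i'<a. \<forall>m<b. co x i' m = (if i' = i \<and> m < n then c m else 0))"
  using co_row_sum[OF i n] by (auto intro: co_eqI)

lemma mem_if_grid_terms:
  assumes terms: "\<And>i m. i < a \<Longrightarrow> m < b \<Longrightarrow> co x i m \<noteq> 0 \<Longrightarrow> scale (co x i m) (e i m) \<in> M"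
    and zero: "0 \<in> M" and add: "\<And>x y. x \<in> M \<Longrightarrow> y \<in> M \<Longrightarrow> x + y \<in> M"
  shows "x \<in> M"
proof -
  have sums: "sum h I \<in> M" if "\<And>i. i \<in> I \<Longrightarrow> h i \<in> M" for I :: "nat set" and h
    using that by (induction I rule: infinite_finite_induct) (auto intro: zero add)
  have "scale (co x i m) (e i m) \<in> M" if "i < a" "m < b" for i m
    using terms[OF that] zero by (cases "co x i m = 0") auto
  hence "(\<Sum>i<a. \<Sum>m<b. scale (co x i m) (e i m)) \<in> M" by (intro sums) auto
  thus ?thesis by (simp add: expand)
qed

end

lemma (in lin_space) grid_coordinates_exist:
  assumes B: "finite B" "card B = a * b" "independent B" "span B = UNIV"
  shows "\<exists>e co. grid_coordinates scale a b e co"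
proof -
  let ?I = "{..<a} \<times> {..<b}"
  obtain \<beta> where \<beta>: "bij_betw \<beta> ?I B"
    using finite_same_card_bij[of ?I B] B by auto
  define e where "e i m = \<beta> (i, m)" for i m
  have sum_eq: "(\<Sum>i<a. \<Sum>m<b. scale (u (e i m)) (e i m)) = (\<Sum>x\<in>B. scale (u x) x)"
    for u :: "'b \<Rightarrow> 'a"
    using sum.reindex_bij_betw[OF \<beta>, of "\<lambda>x. scale (u x) x"]
    by (simp add: e_def sum.cartesian_product case_prod_beta)
  have "grid_coordinates scale a b e (\<lambda>x i m. representation B x (e i m))"
  proof unfold_locales
    show "(\<Sum>i<a. \<Sum>m<b. scale (representation B x (e i m)) (e i m)) = x" for x
      unfolding sum_eq using B by (intro sum_representation_eq) auto
    fix i m c assume im: "i < a" "m < b"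
    define u :: "'b \<Rightarrow> 'a" where "u x = (case inv_into ?I \<beta> x of (i, m) \<Rightarrow> c i m)" for x
    have u: "u (e i m) = c i m" if "i < a" "m < b" for i m
      using that \<beta> by (simp add: u_def e_def bij_betw_def)
    have "representation B (\<Sum>x\<in>B. scale (u x) x) x = u x" if "x \<in> B" for x
      using B that
      by (simp add: representation_sum representation_scale representation_basis span_base span_scale
          if_distrib[of "(*) _"] cong: if_cong)
    moreover have "e i m \<in> B" using \<beta> im by (auto simp: e_def bij_betw_def)
    ultimately show "representation B (\<Sum>i<a. \<Sum>m<b. scale (c i m) (e i m)) (e i m) = c i m"
      using u im sum_eq[of u] by simp
  qed
  thus ?thesis by blast
qed

section \<open>Lattices over the valuation ring\<close>

locale nonarch_space = fin_dim_lin_space scale Basis + nonarch_field v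
  for scale :: "'a::field \<Rightarrow> 'b::ab_group_add \<Rightarrow> 'b" and Basis and v :: "'a \<Rightarrow> real"
begin

definition integral_submodule :: "'b set \<Rightarrow> bool" where
  "integral_submodule M \<longleftrightarrow> 0 \<in> M \<and> (\<forall>x\<in>M. \<forall>y\<in>M. x + y \<in> M) \<and>
    (\<forall>a. \<forall>x\<in>M. v a \<le> 1 \<longrightarrow> scale a x \<in> M)"

lemma integral_submodule_zero: "integral_submodule M \<Longrightarrow> 0 \<in> M"
  and integral_submodule_add: "integral_submodule M \<Longrightarrow> x \<in> M \<Longrightarrow> y \<in> M \<Longrightarrow> x + y \<in> M"
  and integral_submodule_scale: "integral_submodule M \<Longrightarrow> v a \<le> 1 \<Longrightarrow> x \<in> M \<Longrightarrow> scale a x \<in> M"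
  by (simp_all add: integral_submodule_def)

lemma integral_submodule_sum:
  "integral_submodule M \<Longrightarrow> (\<And>x. x \<in> A \<Longrightarrow> h x \<in> M) \<Longrightarrow> sum h A \<in> M"
  by (induction A rule: infinite_finite_induct)
    (auto intro: integral_submodule_zero integral_submodule_add)

lemma integral_submodule_subspace: "subspace M \<Longrightarrow> integral_submodule M"
  by (simp add: integral_submodule_def subspace_def)

lemma integral_submodule_Int:
  "integral_submodule M \<Longrightarrow> integral_submodule M' \<Longrightarrow> integral_submodule (M \<inter> M')"
  by (simp add: integral_submodule_def)

lemma integral_submodule_vimage:
  assumes "integral_submodule M"
    and "\<And>x y. h (x + y) = h x + h y" "\<And>a x. h (scale a x) = scale a (h x)"
  shows "integral_submodule {x. h x \<in> M}"
  using assms assms(3)[of 0 0] by (simp add: integral_submodule_def)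

lemma integral_submodule_adjoin:
  assumes M: "integral_submodule M"
  shows "integral_submodule {y + scale a x | y a. y \<in> M \<and> v a \<le> 1}" (is "integral_submodule ?N")
  unfolding integral_submodule_def
proof (intro conjI ballI allI impI)
  show "0 \<in> ?N" using integral_submodule_zero[OF M] by (intro CollectI exI[of _ 0]) auto
next
  fix z z' assume "z \<in> ?N" "z' \<in> ?N"
  then obtain y a y' a' where "y \<in> M" "v a \<le> 1" "z = y + scale a x"
    and "y' \<in> M" "v a' \<le> 1" "z' = y' + scale a' x" by blast
  thus "z + z' \<in> ?N" using integral_submodule_add[OF M] le_1_add
    by (intro CollectI exI[of _ "y + y'"] exI[of _ "a + a'"]) (simp add: algebra_simps)
next
  fix r z assume "z \<in> ?N" and r: "v r \<le> 1"
  then obtain y a where "y \<in> M" "v a \<le> 1" "z = y + scale a x" by blast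
  thus "scale r z \<in> ?N" using integral_submodule_scale[OF M r] le_1_mult[OF r]
    by (intro CollectI exI[of _ "scale r y"] exI[of _ "r * a"]) (simp add: algebra_simps)
qed

lemma integral_multiple:
  assumes M: "integral_submodule M" and "x \<in> span M"
  shows "\<exists>a. a \<noteq> 0 \<and> v a \<le> 1 \<and> scale a x \<in> M"
  using assms(2)
proof (induction rule: span_induct_alt)
  case base
  show ?case using integral_submodule_zero[OF M] by (intro exI[of _ 1]) auto
next
  case (step c x y)
  then obtain a where a: "a \<noteq> 0" "v a \<le> 1" "scale a y \<in> M" by blast
  show ?case
  proof (cases "v c \<le> 1")
    case True
    have "scale (a * c) x \<in> M"
      using step.hyps a True by (intro integral_submodule_scale[OF M] le_1_mult)
    hence "scale (a * c) x + scale a y \<in> M" using a(3) by (rule integral_submodule_add[OF M])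
    thus ?thesis using a by (intro exI[of _ a]) (simp add: scale_right_distrib)
  next
    case False
    hence c: "c \<noteq> 0" "v (inverse c) \<le> 1" by (auto simp: inverse inverse_le_1_iff)
    have "scale a x + scale (inverse c) (scale a y) \<in> M"
      using integral_submodule_scale[OF M a(2) step.hyps] integral_submodule_scale[OF M c(2) a(3)]
      by (rule integral_submodule_add[OF M])
    moreover have "scale (a * inverse c) (scale c x + y) = scale a x + scale (inverse c) (scale a y)"
      using c by (simp add: scale_right_distrib mult.commute)
    ultimately show ?thesis using a c
      by (intro exI[of _ "a * inverse c"]) (auto intro: le_1_mult)
  qed
qed

lemma span_Int_subspace:
  assumes M: "integral_submodule M" and U: "subspace U" "U \<subseteq> span M"
  shows "span (M \<inter> U) = U"
proof
  show "span (M \<inter> U) \<subseteq> U" using U by (intro span_minimal) auto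
  show "U \<subseteq> span (M \<inter> U)"
  proof
    fix x assume x: "x \<in> U"
    then obtain a where a: "a \<noteq> 0" "scale a x \<in> M" using integral_multiple[OF M] U by blast
    hence "scale (inverse a) (scale a x) \<in> span (M \<inter> U)"
      using x U by (intro span_scale span_base) (auto intro: subspace_scale)
    thus "x \<in> span (M \<inter> U)" using a by simp
  qed
qed

definition integral_span :: "nat \<Rightarrow> (nat \<Rightarrow> 'b) \<Rightarrow> 'b set" where
  "integral_span n e = {(\<Sum>l<n. scale (c l) (e l)) | c. \<forall>l<n. v (c l) \<le> 1}"

lemma integral_spanI: "(\<And>l. l < n \<Longrightarrow> v (c l) \<le> 1) \<Longrightarrow> (\<Sum>l<n. scale (c l) (e l)) \<in> integral_span n e"
  unfolding integral_span_def by blast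

lemma integral_spanE:
  assumes "x \<in> integral_span n e"
  obtains c where "x = (\<Sum>l<n. scale (c l) (e l))" "\<And>l. l < n \<Longrightarrow> v (c l) \<le> 1"
  using assms unfolding integral_span_def by blast

lemma integral_span_0 [simp]: "integral_span 0 e = {0}"
  by (simp add: integral_span_def)

lemma integral_span_base: "l < n \<Longrightarrow> e l \<in> integral_span n e"
  using integral_spanI[of n "\<lambda>m. if m = l then 1 else 0" e] by (simp add: sum_unit_coeff)

lemma integral_span_cong: "(\<And>l. l < n \<Longrightarrow> e l = e' l) \<Longrightarrow> integral_span n e = integral_span n e'"
  by (simp add: integral_span_def)

lemma integral_span_Suc:
  "integral_span (Suc n) e = {y + scale a (e n) | y a. y \<in> integral_span n e \<and> v a \<le> 1}"
proof (intro equalityI subsetI)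
  fix x assume "x \<in> integral_span (Suc n) e"
  then obtain c where "x = (\<Sum>l<Suc n. scale (c l) (e l))" "\<And>l. l < Suc n \<Longrightarrow> v (c l) \<le> 1"
    by (auto elim: integral_spanE)
  thus "x \<in> {y + scale a (e n) | y a. y \<in> integral_span n e \<and> v a \<le> 1}"
    using integral_spanI[of n c e] by auto
next
  fix x assume "x \<in> {y + scale a (e n) | y a. y \<in> integral_span n e \<and> v a \<le> 1}"
  then obtain c a where "v a \<le> 1" "x = (\<Sum>l<n. scale (c l) (e l)) + scale a (e n)"
    and "\<And>l. l < n \<Longrightarrow> v (c l) \<le> 1"
    by (auto elim: integral_spanE)
  thus "x \<in> integral_span (Suc n) e" using integral_spanI[of "Suc n" "c(n := a)" e] by simp
qed

lemma integral_submodule_integral_span: "integral_submodule (integral_span n e)"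
proof (induction n)
  case 0
  show ?case by (simp add: integral_submodule_def)
next
  case (Suc n)
  thus ?case unfolding integral_span_Suc by (rule integral_submodule_adjoin)
qed

lemma integral_span_minimal:
  assumes M: "integral_submodule M" and "\<And>l. l < n \<Longrightarrow> e l \<in> M"
  shows "integral_span n e \<subseteq> M"
  using assms by (auto simp: integral_span_def
      intro: integral_submodule_sum integral_submodule_scale)

lemma integral_hull_eq_integral_span: "integral_submodule hull (e ` {..<n}) = integral_span n e"
proof
  show "integral_submodule hull (e ` {..<n}) \<subseteq> integral_span n e"
    by (rule hull_minimal) (auto intro: integral_span_base integral_submodule_integral_span)
  show "integral_span n e \<subseteq> integral_submodule hull (e ` {..<n})"
    unfolding hull_def by (rule Inter_greatest, rule integral_span_minimal) auto
qed

lemma finite_integral_hull: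
  assumes "finite B"
  shows "\<exists>n e. integral_submodule hull B = integral_span n e"
proof -
  obtain n :: nat and e where "B = e ` {l. l < n}"
    using finite_imp_nat_seg_image_inj_on[OF assms] by blast
  thus ?thesis using integral_hull_eq_integral_span[of e n] by (auto simp: lessThan_def)
qed

lemma integral_span_subset_span: "integral_span n e \<subseteq> span (e ` {..<n})"
  by (intro integral_span_minimal integral_submodule_subspace subspace_span span_base) auto

lemma span_integral_span: "span (integral_span n e) = span (e ` {..<n})"
proof (rule antisym)
  show "span (integral_span n e) \<subseteq> span (e ` {..<n})"
    by (intro span_minimal subspace_span integral_span_subset_span)
  show "span (e ` {..<n}) \<subseteq> span (integral_span n e)"
    by (intro span_mono) (auto intro: integral_span_base)
qed

text \<open>Dividing by a coefficient of maximal absolute value makes a linear relation integral.\<close>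

lemma indep_family_if_integral:
  assumes "\<And>c. (\<And>l. l < n \<Longrightarrow> v (c l) \<le> 1) \<Longrightarrow> (\<Sum>l<n. scale (c l) (b l)) = 0 \<Longrightarrow> (\<forall>l<n. c l = 0)"
  shows "indep_family n b"
  unfolding indep_family_def
proof (intro allI impI, rule ccontr)
  fix c l assume c: "(\<Sum>l<n. scale (c l) (b l)) = 0" and l: "l < n" "c l \<noteq> 0"
  obtain m where m: "m < n" "c m \<noteq> 0" "\<And>l. l < n \<Longrightarrow> v (c l / c m) \<le> 1"
    using dominant_coefficient[of l n c, OF l] by blast
  have "(\<Sum>l<n. scale (c l / c m) (b l)) = scale (1 / c m) (\<Sum>l<n. scale (c l) (b l))"
    by (simp add: scale_sum_right)
  hence "\<forall>l<n. c l / c m = 0"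
    using c m(3) by (intro assms) auto
  thus False using m(1,2) by auto
qed

lemma pivot_generator:
  fixes N :: nat
  assumes H: "subspace H" and g: "g ` {..<N} \<subseteq> span (insert b H)" "\<not> g ` {..<N} \<subseteq> H"
  shows "\<exists>j<N. g j \<notin> H \<and> (\<forall>l<N. \<exists>r. v r \<le> 1 \<and> g l - scale r (g j) \<in> H)"
proof -
  have "\<exists>a. g l - scale a b \<in> H" if "l < N" for l
    using g(1) that
    by (auto simp only: image_subset_iff lessThan_iff span_breakdown_eq span_eq_iff[THEN iffD2, OF H])
  then obtain a where a: "\<And>l. l < N \<Longrightarrow> g l - scale (a l) b \<in> H" by metis
  obtain l0 where l0: "l0 < N" "g l0 \<notin> H" using g(2) by auto
  hence "a l0 \<noteq> 0" using a[OF l0(1)] by auto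
  then obtain j where j: "j < N" "a j \<noteq> 0" and dominant: "\<And>l. l < N \<Longrightarrow> v (a l / a j) \<le> 1"
    using dominant_coefficient[of l0 N a, OF l0(1)] by blast
  have clear: "g l - scale (a l / a j) (g j) \<in> H" if "l < N" for l
  proof -
    have "(g l - scale (a l) b) - scale (a l / a j) (g j - scale (a j) b) \<in> H"
      by (rule subspace_diff[OF H a[OF that] subspace_scale[OF H a[OF j(1)]]])
    thus ?thesis using j(2) by (simp add: scale_right_diff_distrib)
  qed
  have "g j \<notin> H"
  proof
    assume "g j \<in> H"
    hence "(g l0 - scale (a l0 / a j) (g j)) + scale (a l0 / a j) (g j) \<in> H"
      using clear[OF l0(1)] H by (intro subspace_add subspace_scale)
    thus False using l0(2) by simp
  qed
  thus ?thesis using j(1) clear dominant by blast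
qed

lemma integral_span_hyperplane_section:
  assumes H: "subspace H" and b: "b \<notin> H" and span_g: "span (g ` {..<N}) = span (insert b H)"
  shows "\<exists>g' x. x \<notin> H \<and> integral_span N g \<inter> H = integral_span N g' \<and>
    integral_span N g = {y + scale a x | y a. y \<in> integral_span N g' \<and> v a \<le> 1}"
proof -
  have "b \<in> span (g ` {..<N})" unfolding span_g by (simp add: span_base)
  hence "\<not> g ` {..<N} \<subseteq> H" using b span_minimal[OF _ H] by blast
  moreover have "g ` {..<N} \<subseteq> span (insert b H)" unfolding span_g[symmetric] by (rule span_superset)
  ultimately obtain j r where j: "j < N" "g j \<notin> H"
    and r: "\<And>l. l < N \<Longrightarrow> v (r l) \<le> 1 \<and> g l - scale (r l) (g j) \<in> H"
    using pivot_generator[OF H] by metis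
  define g' where "g' l = g l - scale (r l) (g j)" for l
  define M where "M = {y + scale a (g j) | y a. y \<in> integral_span N g' \<and> v a \<le> 1}"
  note submodule = integral_submodule_integral_span
  have section_H: "integral_span N g' \<subseteq> H"
    using r H by (intro integral_span_minimal integral_submodule_subspace) (auto simp: g'_def)
  have "g l \<in> M" if "l < N" for l
    unfolding M_def using r[OF that] integral_span_base[OF that, of g']
    by (intro CollectI exI[of _ "g' l"] exI[of _ "r l"]) (simp add: g'_def)
  hence "integral_span N g \<subseteq> M"
    unfolding M_def by (intro integral_span_minimal integral_submodule_adjoin submodule)
  moreover have "g l + scale (- r l) (g j) \<in> integral_span N g" if "l < N" for l
    using that r j(1) submodule[of N g]
    by (intro integral_submodule_add integral_submodule_scale integral_span_base) auto
  hence section_M: "integral_span N g' \<subseteq> integral_span N g"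
    by (intro integral_span_minimal submodule) (simp add: g'_def)
  hence "M \<subseteq> integral_span N g"
    unfolding M_def using submodule[of N g] integral_span_base[OF j(1)]
    by (auto intro!: integral_submodule_add integral_submodule_scale)
  ultimately have M: "integral_span N g = M" by blast
  have "a = 0" if "y + scale a (g j) \<in> H" "y \<in> H" for y a
  proof (rule ccontr)
    assume "a \<noteq> 0"
    have "scale (inverse a) ((y + scale a (g j)) - y) \<in> H"
      using that H by (intro subspace_scale subspace_diff)
    thus False using j(2) \<open>a \<noteq> 0\<close> by simp
  qed
  hence "M \<inter> H \<subseteq> integral_span N g'" using section_H unfolding M_def by fastforce
  hence "integral_span N g \<inter> H = integral_span N g'" using section_M section_H M by blast
  thus ?thesis using j(2) M unfolding M_def by blast
qed

lemma integral_span_fun_upd: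
  "m \<le> n \<Longrightarrow> integral_span m (e(n := x)) = integral_span m e"
  "integral_span (Suc n) (e(n := x)) = {y + scale a x | y a. y \<in> integral_span n e \<and> v a \<le> 1}"
proof -
  show below: "integral_span m (e(n := x)) = integral_span m e" if "m \<le> n" for m
    using that by (intro integral_span_cong) auto
  show "integral_span (Suc n) (e(n := x)) = {y + scale a x | y a. y \<in> integral_span n e \<and> v a \<le> 1}"
    unfolding integral_span_Suc below[OF order_refl] by simp
qed

text \<open>Induction on the rank: the top vector is a generator lying outside a hyperplane that contains all
  proper members of the chain.\<close>

theorem integral_basis_adapted_to_chain:
  assumes "dim (span (g ` {..<N})) = n" and "\<forall>W\<in>C. subspace W \<and> W \<subseteq> span (g ` {..<N})"
    and "chain_subset C"
  shows "\<exists>e. indep_family n e \<and> integral_span N g = integral_span n e \<and>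
    (\<forall>W\<in>C. integral_span N g \<inter> W = integral_span (dim W) e)"
  using assms
proof (induction n arbitrary: C g)
  case 0
  hence V: "span (g ` {..<N}) \<subseteq> {0}" by (simp only: dim_eq_0)
  hence "integral_span N g = {0}"
    using integral_submodule_zero[OF integral_submodule_integral_span] integral_span_subset_span
    by blast
  moreover have "W = {0} \<and> dim W = 0" if "W \<in> C" for W
    unfolding dim_eq_0 using 0(2) that subspace_0[of W] V by blast
  ultimately show ?case by (intro exI[of _ g]) (auto simp del: dim_eq_0)
next
  case (Suc n)
  let ?V = "span (g ` {..<N})"
  from hyperplane_above_chain[OF subspace_span Suc.prems]
  obtain H b where H: "subspace H" "dim H = n" "b \<notin> H" "?V = span (insert b H)"
    and below: "\<forall>W\<in>C. W = ?V \<or> W \<subseteq> H"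
    by (elim exE conjE) (rule that; assumption)
  obtain g' x where x: "x \<notin> H" and g': "integral_span N g \<inter> H = integral_span N g'"
    and M: "integral_span N g = {y + scale a x | y a. y \<in> integral_span N g' \<and> v a \<le> 1}"
    using integral_span_hyperplane_section[OF H(1,3,4)] by blast
  have "H \<subseteq> ?V" unfolding H(4) using span_superset[of "insert b H"] by blast
  hence span_g': "span (g' ` {..<N}) = H"
    using span_Int_subspace[OF integral_submodule_integral_span H(1), of N g]
    by (simp only: g' span_integral_span)
  have "\<forall>W\<in>C - {?V}. subspace W \<and> W \<subseteq> span (g' ` {..<N})"
    using Suc.prems(2) below unfolding span_g' by blast
  moreover have "chain_subset (C - {?V})" using Suc.prems(3) by (simp add: chain_subset_def)
  ultimately obtain e where e: "indep_family n e" "integral_span N g' = integral_span n e"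
    "\<And>W. W \<in> C - {?V} \<Longrightarrow> integral_span N g' \<inter> W = integral_span (dim W) e"
    using Suc.IH[of g' "C - {?V}"] H(2) unfolding span_g' by blast
  have top: "integral_span N g = integral_span (Suc n) (e(n := x))"
    unfolding M e(2) integral_span_fun_upd(2) ..
  have "integral_span N g \<inter> W = integral_span (dim W) (e(n := x))" if W: "W \<in> C" for W
  proof (cases "W = ?V")
    case True
    thus ?thesis using Suc.prems(1) top integral_span_subset_span[of N g] by auto
  next
    case False
    hence "W \<subseteq> H" using below W by blast
    hence "integral_span N g \<inter> W = integral_span (dim W) e" using g' e(3)[of W] W False by blast
    thus ?thesis using dim_subset[OF \<open>W \<subseteq> H\<close>] H(2) integral_span_fun_upd(1) by simp
  qed
  moreover have "span (e ` {..<n}) = H" using span_g' e(2) span_integral_span by metis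
  hence "indep_family (Suc n) (e(n := x))" using indep_family_fun_upd[OF e(1)] x by simp
  ultimately show ?case using top by blast
qed

lemma integral_transition_matrix:
  assumes "\<And>m. m < n \<Longrightarrow> r m \<le> n \<and> x m \<in> integral_span (r m) e"
  shows "\<exists>T. integral_mat n T \<and> (\<forall>m<n. x m = row_mult n e T m) \<and>
    (\<forall>l<n. \<forall>m<n. r m \<le> l \<longrightarrow> T $$ (l, m) = 0)"
proof -
  have "\<exists>c. x m = (\<Sum>l<n. scale (c l) (e l)) \<and> (\<forall>l<n. v (c l) \<le> 1 \<and> (r m \<le> l \<longrightarrow> c l = 0))"
    if m: "m < n" for m
  proof -
    obtain c where c: "x m = (\<Sum>l<r m. scale (c l) (e l))" "\<And>l. l < r m \<Longrightarrow> v (c l) \<le> 1"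
      using assms[OF m] by (auto elim: integral_spanE)
    have "x m = (\<Sum>l<n. scale (if l < r m then c l else 0) (e l))"
      unfolding c(1) using assms[OF m] by (intro sum.mono_neutral_cong_left) auto
    thus ?thesis using c(2) by (intro exI[of _ "\<lambda>l. if l < r m then c l else 0"]) auto
  qed
  then obtain c where c: "\<And>m. m < n \<Longrightarrow> x m = (\<Sum>l<n. scale (c m l) (e l)) \<and>
      (\<forall>l<n. v (c m l) \<le> 1 \<and> (r m \<le> l \<longrightarrow> c m l = 0))" by metis
  thus ?thesis
    by (intro exI[of _ "mat n n (\<lambda>(l, m). c m l)"]) (auto simp: integral_mat_def row_mult_def)
qed

lemma integral_right_inverse_if_span_subset:
  assumes e: "indep_family n e" and T: "T \<in> carrier_mat n n"
    and generates: "integral_span n e \<subseteq> integral_span n (row_mult n e T)"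
  shows "\<exists>U. integral_mat n U \<and> T * U = 1\<^sub>m n"
proof -
  obtain U where U: "integral_mat n U" "\<And>m. m < n \<Longrightarrow> e m = row_mult n (row_mult n e T) U m"
    using integral_transition_matrix[of n "\<lambda>_. n" e "row_mult n e T"] integral_span_base generates
    by blast
  note carrier = integral_mat_carrier[OF U(1)]
  have "T * U = 1\<^sub>m n"
  proof (rule row_mult_inj[OF e])
    fix m assume m: "m < n"
    show "row_mult n e (T * U) m = row_mult n e (1\<^sub>m n) m"
      using U(2)[OF m] row_mult_assoc[OF T carrier m] row_mult_one[OF m] by simp
  qed (use T carrier in auto)
  thus ?thesis using U(1) by blast
qed

end

locale nonarch_grid = nonarch_space scale Basis v + grid_coordinates scale a b e co
  for scale :: "'a::field \<Rightarrow> 'b::ab_group_add \<Rightarrow> 'b" and Basis and v :: "'a \<Rightarrow> real" and a b e co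
begin

lemma integral_span_row:
  assumes i: "i < a" and n: "n \<le> b"
  shows "integral_span n (e i)
    = {x. \<forall>i'<a. \<forall>m<b. (co x i' m \<noteq> 0 \<longrightarrow> i' = i \<and> m < n) \<and> v (co x i' m) \<le> 1}" (is "_ = ?R")
proof (intro equalityI subsetI)
  fix x assume "x \<in> integral_span n (e i)"
  then obtain c where "x = (\<Sum>m<n. scale (c m) (e i m))" "\<And>m. m < n \<Longrightarrow> v (c m) \<le> 1"
    by (auto elim: integral_spanE)
  thus "x \<in> ?R" using co_row_sum[OF i n] by simp
next
  fix x assume x: "x \<in> ?R"
  hence "x = (\<Sum>m<n. scale (co x i m) (e i m))" unfolding row_sum_iff[OF i n] by auto
  moreover have "v (co x i m) \<le> 1" if "m < n" for m using x i n that by simp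
  ultimately show "x \<in> integral_span n (e i)" using integral_spanI[of n "co x i"] by metis
qed

lemma integral_hull_grid:
  "integral_submodule hull (\<lambda>(i, m). e i m) ` ({..<a} \<times> {..<b}) = {x. \<forall>i<a. \<forall>m<b. v (co x i m) \<le> 1}"
  (is "_ hull ?E = ?M")
proof
  have "integral_submodule ?M" by (auto simp: integral_submodule_def le_1_add le_1_mult)
  thus "integral_submodule hull ?E \<subseteq> ?M" by (intro hull_minimal) auto
  show "?M \<subseteq> integral_submodule hull ?E"
  proof (intro subsetI, unfold hull_def, intro InterI, elim CollectE conjE)
    fix x M assume M: "integral_submodule M" "?E \<subseteq> M" and x: "\<forall>i<a. \<forall>m<b. v (co x i m) \<le> 1"
    have "e i m \<in> M" if "i < a" "m < b" for i m using M(2) that by auto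
    thus "x \<in> M"
      using x M(1) by (auto intro!: mem_if_grid_terms[of x M] integral_submodule_zero
          integral_submodule_add integral_submodule_scale)
  qed
qed

end

section \<open>Unramified extensions of the \<open>p\<close>-adic numbers\<close>

lemma sum_powers_less_power:
  fixes p :: nat
  assumes "1 < p"
  shows "(\<Sum>n<m. p ^ n) < p ^ m"
proof (induction m)
  case (Suc m)
  have "p ^ m + p ^ m \<le> p ^ Suc m" using mult_le_mono1[OF Suc_leI[OF assms], of "p ^ m"] by simp
  thus ?case using Suc by simp
qed simp

locale padic_field =
  fixes p :: nat and v :: "'q::field_char_0 \<Rightarrow> real"
  assumes padic: "is_padic_field p v"
begin

lemma prime_p: "prime p"
  and abs_of_rat: "v (of_rat r) = padic_abs p r"
  and rat_dense: "\<epsilon> > 0 \<Longrightarrow> \<exists>r. v (x - of_rat r) < \<epsilon>"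
  using padic by (auto simp: is_padic_field_def)

sublocale nonarch_field v
  using padic by unfold_locales (simp add: is_padic_field_def)

lemma p_gt_1: "p > 1"
  using prime_p by (rule prime_gt_1_nat)

lemma abs_of_int: "v (of_int a) = (if a = 0 then 0 else real p powi - int (multiplicity (int p) a))"
  using abs_of_rat[of "of_int a"] by (simp add: padic_abs_def)

lemma abs_p: "v (of_nat p) = 1 / real p"
proof -
  have "multiplicity (int p) (int p) = 1"
    using p_gt_1 prime_p by (intro multiplicity_self) auto
  thus ?thesis using abs_of_int[of "int p"] p_gt_1 by (simp add: power_int_minus field_simps)
qed

lemma abs_of_int_dvd:
  assumes "int p dvd a"
  shows "v (of_int a) < 1"
proof -
  obtain t where "a = int p * t" using assms by auto
  moreover have "v (of_nat p * of_int t) < 1"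
    using abs_p p_gt_1 of_int_le_1 by (intro mult_less_1) simp_all
  ultimately show ?thesis by simp
qed

lemma abs_of_int_not_dvd: "\<not> int p dvd a \<Longrightarrow> v (of_int a) = 1"
  using abs_of_int[of a] by (auto simp: not_dvd_imp_multiplicity_0)

lemma integral_of_rat:
  assumes "v (of_rat r) \<le> 1"
  obtains a b where "of_rat r = (of_int a / of_int b :: 'q)" "b \<noteq> 0" "\<not> int p dvd b"
proof -
  obtain a b where ab: "quotient_of r = (a, b)" by force
  have b: "b > 0" and coprime: "coprime a b" and "r = of_int a / of_int b"
    using quotient_of_denom_pos[OF ab] quotient_of_coprime[OF ab] quotient_of_div[OF ab] by auto
  hence r: "of_rat r = (of_int a / of_int b :: 'q)" by (simp add: of_rat_divide)
  have "\<not> int p dvd b"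
  proof
    assume "int p dvd b"
    hence "\<not> int p dvd a"
      using coprime_common_divisor[OF coprime, of "int p"] p_gt_1 by auto
    hence "v (of_rat r) > 1"
      using abs_of_int_dvd[OF \<open>int p dvd b\<close>] abs_of_int_not_dvd b by (simp add: r divide)
    thus False using assms by simp
  qed
  thus thesis using that[OF r] b by simp
qed

lemma residue_of_rat:
  assumes "v (of_rat r) \<le> 1"
  shows "\<exists>n<p. v (of_rat r - of_nat n) < 1"
proof -
  obtain a b where r: "of_rat r = (of_int a / of_int b :: 'q)" and b: "b \<noteq> 0" "\<not> int p dvd b"
    using assms by (rule integral_of_rat)
  have "coprime b (int p)"
    using prime_imp_coprime[of "int p" b] prime_p b(2) by (simp add: coprime_commute)
  then obtain c where c: "[b * c = 1] (mod int p)" using cong_solve_coprime_int by blast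
  define n where "n = nat ((a * c) mod int p)"
  have n: "int n = (a * c) mod int p" "n < p"
    using p_gt_1 by (auto simp: n_def nat_less_iff)
  have "[int n * b = a * c * b] (mod int p)" using n by (intro cong_mult) (auto simp: cong_def)
  moreover have "[a * (b * c) = a * 1] (mod int p)" using c by (intro cong_mult) auto
  ultimately have "[int n * b = a] (mod int p)" by (simp add: ac_simps cong_def)
  hence "int p dvd a - int n * b" by (metis cong_iff_dvd_diff cong_sym)
  hence "v (of_int (a - int n * b)) < 1" by (rule abs_of_int_dvd)
  moreover have "of_rat r - of_nat n = (of_int (a - int n * b) / of_int b :: 'q)"
    using b(1) by (simp add: r field_simps)
  ultimately show ?thesis using abs_of_int_not_dvd[OF b(2)] n(2) by (auto simp: divide)
qed

lemma residue_digit: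
  assumes "v q \<le> 1"
  shows "\<exists>n<p. v (q - of_nat n) < 1"
proof -
  obtain r where r: "v (q - of_rat r) < 1" using rat_dense[of 1 q] by auto
  have "v (of_rat r) \<le> 1" using diff_le[of q "q - of_rat r"] r assms by simp
  then obtain n where n: "n < p" "v (of_rat r - of_nat n) < 1" using residue_of_rat by blast
  have "v ((q - of_rat r) + (of_rat r - of_nat n)) < 1" using r n(2) by (rule add_less)
  thus ?thesis using n(1) by auto
qed

end

locale unramified_extension =
  Q: padic_field p absQ + K: nonarch_field absK + incl: field_hom incl
  for p and absQ :: "'q::field_char_0 \<Rightarrow> real" and absK :: "'k::field \<Rightarrow> real" and incl :: "'q \<Rightarrow> 'k" +
  fixes f :: nat
  assumes abs_incl: "absK (incl q) = absQ q"
    and f_pos: "f > 0"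
    and dim_K: "vector_space.dim (\<lambda>q x. incl q * x) (UNIV :: 'k set) = f"
    and card_residue_field: "card ({x. absK x \<le> 1} // K.residue_relation) = p ^ f"
begin

sublocale VK: lin_space "\<lambda>q x. incl q * x"
  by unfold_locales (auto simp: hom_distribs algebra_simps)

sublocale VK: fin_dim_lin_space "\<lambda>q x. incl q * x" "VK.extend_basis {}"
  using VK.finite_dimensional_if_dim_pos dim_K f_pos
  by (simp add: fin_dim_lin_space_def VK.lin_space_axioms)

lemma residue_representatives_exist: "\<exists>T. finite T \<and> card T = p ^ f \<and> K.unit_separated T"
proof -
  let ?Q = "{x. absK x \<le> 1} // K.residue_relation"
  obtain r where "inj_on r ?Q" "K.unit_separated (r ` ?Q)" using K.residue_representatives by blast
  moreover have "finite ?Q" using card_residue_field Q.p_gt_1 by (intro card_ge_0_finite) simp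
  ultimately show ?thesis using card_residue_field by (intro exI[of _ "r ` ?Q"]) (simp add: card_image)
qed

text \<open>Such families lift linearly independent families of the residue field.\<close>

definition orthonormal :: "nat \<Rightarrow> (nat \<Rightarrow> 'k) \<Rightarrow> bool" where
  "orthonormal m w \<longleftrightarrow> (\<forall>l<m. absK (w l) \<le> 1) \<and>
     (\<forall>q. \<forall>j<m. absQ (q j) \<le> absK (\<Sum>l<m. incl (q l) * w l))"

lemma orthonormal_coeff_le: "orthonormal m w \<Longrightarrow> j < m \<Longrightarrow> absQ (q j) \<le> absK (\<Sum>l<m. incl (q l) * w l)"
  by (simp add: orthonormal_def)

lemma orthonormal_indep_family:
  assumes "orthonormal m w"
  shows "VK.indep_family m w"
  unfolding VK.indep_family_def
proof (intro allI impI)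
  fix c l assume "(\<Sum>l<m. incl (c l) * w l) = 0" "l < m"
  hence "absQ (c l) \<le> 0" using orthonormal_coeff_le[OF assms, of l c] by simp
  thus "c l = 0" using Q.nonneg[of "c l"] Q.eq_0_iff[of "c l"] by linarith
qed

lemma integral_combination_digits:
  assumes "\<And>l. l < m \<Longrightarrow> absK (w l) \<le> 1" "\<And>l. l < m \<Longrightarrow> absQ (c l) \<le> 1"
  shows "\<exists>n \<in> {..<m} \<rightarrow>\<^sub>E {..<p}.
    absK ((\<Sum>l<m. incl (c l) * w l) - (\<Sum>l<m. incl (of_nat (n l)) * w l)) < 1"
proof -
  have "\<exists>n. l < m \<longrightarrow> n < p \<and> absQ (c l - of_nat n) < 1" for l
    using Q.residue_digit[OF assms(2)] by blast
  then obtain n where n: "\<And>l. l < m \<Longrightarrow> n l < p \<and> absQ (c l - of_nat (n l)) < 1" by metis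
  have "(\<Sum>l<m. incl (c l) * w l) - (\<Sum>l<m. incl (of_nat (n l)) * w l)
      = (\<Sum>l<m. incl (c l - of_nat (n l)) * w l)"
    by (simp add: hom_distribs left_diff_distrib sum_subtractf)
  moreover have "absK (\<Sum>l<m. incl (c l - of_nat (n l)) * w l) < 1"
    using n assms(1) by (intro K.sum_less K.mult_less_1) (auto simp: abs_incl)
  ultimately show ?thesis using n
    by (intro bexI[of _ "restrict n {..<m}"]) auto
qed

text \<open>There are only \<open>p ^ m\<close> combinations with digits as coefficients, but \<open>p ^ f\<close> residue classes.\<close>

lemma residue_class_avoiding_combinations:
  assumes w: "\<And>l. l < m \<Longrightarrow> absK (w l) \<le> 1" and m: "m < f"
  shows "\<exists>x. absK x \<le> 1 \<and> (\<forall>c. (\<forall>l<m. absQ (c l) \<le> 1) \<longrightarrow> 1 \<le> absK (x - (\<Sum>l<m. incl (c l) * w l)))"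
proof (rule ccontr)
  define comb where "comb n = (\<Sum>l<m. incl (of_nat (n l)) * w l)" for n :: "nat \<Rightarrow> nat"
  define N where "N = ({..<m} \<rightarrow>\<^sub>E {..<p})"
  assume not_avoided: "\<not> ?thesis"
  have "\<exists>n\<in>N. absK (x - comb n) < 1" if x: "absK x \<le> 1" for x
  proof -
    obtain c where c: "\<And>l. l < m \<Longrightarrow> absQ (c l) \<le> 1" "absK (x - (\<Sum>l<m. incl (c l) * w l)) < 1"
      using not_avoided x by (meson not_le)
    then obtain n where n: "n \<in> N" "absK ((\<Sum>l<m. incl (c l) * w l) - comb n) < 1"
      using integral_combination_digits[of m w c] w unfolding N_def comb_def by blast
    show ?thesis using K.add_less[OF c(2) n(2)] n(1) by auto
  qed
  moreover obtain T where T: "finite T" "card T = p ^ f" "K.unit_separated T"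
    using residue_representatives_exist by blast
  ultimately have "\<forall>x\<in>T. \<exists>n\<in>N. absK (x - comb n) < 1" using K.unit_separatedD(1) by blast
  then obtain g where g: "\<And>x. x \<in> T \<Longrightarrow> g x \<in> N \<and> absK (x - comb (g x)) < 1" by metis
  have "inj_on g T"
  proof (rule inj_onI, rule ccontr)
    fix x y assume xy: "x \<in> T" "y \<in> T" "g x = g y" "x \<noteq> y"
    hence "absK ((x - comb (g x)) - (y - comb (g x))) < 1" using g[of x] g[of y]
      by (intro K.diff_less[of "x - comb (g x)"]) auto
    thus False using K.unit_separatedD(2)[OF T(3) xy(1,2,4)] by simp
  qed
  moreover have "finite N" "card N = p ^ m" by (auto simp: N_def card_PiE intro: finite_PiE)
  ultimately have "p ^ f \<le> p ^ m" using g T(2) card_inj_on_le[of g T N] by auto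
  thus False using power_strict_increasing[OF m Q.p_gt_1] by simp
qed

lemma orthonormal_extend:
  assumes w: "orthonormal m w" and m: "m < f"
  shows "\<exists>w'. orthonormal (Suc m) w'"
proof -
  obtain x where x: "absK x \<le> 1"
    and avoid: "\<And>c. (\<forall>l<m. absQ (c l) \<le> 1) \<Longrightarrow> 1 \<le> absK (x - (\<Sum>l<m. incl (c l) * w l))"
    using residue_class_avoiding_combinations[of m w] w m unfolding orthonormal_def by blast
  have last: "absQ (q m) \<le> absK ((\<Sum>l<m. incl (q l) * w l) + incl (q m) * x)" (is "_ \<le> absK ?y") for q
  proof (rule ccontr)
    assume "\<not> ?thesis"
    hence less: "absK ?y < absQ (q m)" by simp
    hence q: "q m \<noteq> 0" using K.nonneg[of ?y] by (metis Q.zero not_le)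
    define z where "z = (\<Sum>l<m. incl (q l / q m) * w l)"
    have "?y / incl (q m) = x + z"
      using q unfolding z_def by (simp add: add_divide_distrib sum_divide_distrib incl.hom_div)
    moreover have "absK (?y / incl (q m)) < 1" using less q by (simp add: K.divide abs_incl)
    ultimately have xz: "absK (x + z) < 1" by simp
    hence "absK z \<le> 1" using K.diff_le[of "x + z" x] x by simp
    hence "absQ (q l / q m) \<le> 1" if "l < m" for l
      using orthonormal_coeff_le[OF w that, of "\<lambda>l. q l / q m"] unfolding z_def by simp
    hence "1 \<le> absK (x - (\<Sum>l<m. incl (- (q l / q m)) * w l))" by (intro avoid) simp
    also have "x - (\<Sum>l<m. incl (- (q l / q m)) * w l) = x + z"
      by (simp add: z_def hom_distribs sum_negf)
    finally show False using xz by simp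
  qed
  have "absQ (q j) \<le> absK (\<Sum>l<Suc m. incl (q l) * (w(m := x)) l)" (is "_ \<le> absK ?y")
    if j: "j < Suc m" for q j
  proof -
    have y: "?y = (\<Sum>l<m. incl (q l) * w l) + incl (q m) * x" by simp
    have "absQ (q m) \<le> absK ?y" unfolding y by (rule last)
    moreover have "absK (incl (q m) * x) \<le> absQ (q m)"
      using x by (simp add: K.mult abs_incl mult_left_le)
    ultimately have "absK (?y - incl (q m) * x) \<le> absK ?y"
      using K.diff_le[of ?y "incl (q m) * x"] by simp
    moreover have "absQ (q j) \<le> absK (?y - incl (q m) * x)" if "j < m"
      using orthonormal_coeff_le[OF w that] unfolding y by simp
    ultimately show ?thesis using j \<open>absQ (q m) \<le> absK ?y\<close> less_Suc_eq by fastforce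
  qed
  moreover have "absK ((w(m := x)) l) \<le> 1" if "l < Suc m" for l
    using w x that by (auto simp: orthonormal_def less_Suc_eq)
  ultimately show ?thesis unfolding orthonormal_def by blast
qed

lemma orthonormal_exists: "m \<le> f \<Longrightarrow> \<exists>w. orthonormal m w"
proof (induction m)
  case (Suc m)
  thus ?case using orthonormal_extend[of m] by auto
qed (auto simp: orthonormal_def)

lemma coordinates_exist:
  assumes "VK.indep_family f w"
  shows "\<exists>q. x = (\<Sum>l<f. incl (q l) * w l)"
proof -
  have "VK.span (w ` {..<f}) = UNIV"
    using VK.indep_family_spans[of UNIV w, unfolded dim_K] assms by simp
  thus ?thesis unfolding VK.span_family by blast
qed

text \<open>In terms of an orthonormal basis, \<open>u \<circ> g\<close> is bounded by a multiple \<open>C\<close> of the absolute value;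
  applied to powers, this bound holds with \<open>C = 1\<close>.\<close>

lemma hom_le_abs:
  fixes g :: "'k \<Rightarrow> 'e::field"
  assumes g: "field_hom g" and u: "nonarch_abs u" and g_incl: "\<And>q. u (g (incl q)) = absQ q"
  shows "u (g x) \<le> absK x"
proof (rule ccontr)
  interpret g: field_hom g by fact
  interpret u: nonarch_field u by unfold_locales fact
  assume greater: "\<not> ?thesis"
  hence "x \<noteq> 0" by auto
  obtain w where w: "orthonormal f w" using orthonormal_exists by blast
  define C where "C = (\<Sum>l<f. u (g (w l)))"
  have C: "0 \<le> C" "\<And>l. l < f \<Longrightarrow> u (g (w l)) \<le> C"
    unfolding C_def by (auto intro!: sum_nonneg member_le_sum)
  have bounded: "u (g y) \<le> absK y * C" for y
  proof -
    obtain q where y: "y = (\<Sum>l<f. incl (q l) * w l)"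
      using coordinates_exist[OF orthonormal_indep_family[OF w]] by blast
    have "u (g (incl (q l) * w l)) \<le> absK y * C" if "l < f" for l
      using orthonormal_coeff_le[OF w that, of q] C(2)[OF that] unfolding y[symmetric]
      by (simp add: hom_distribs u.mult g_incl mult_mono)
    thus ?thesis using C(1) by (subst y, unfold g.hom_sum, intro u.sum_le) auto
  qed
  have "1 < u (g x) / absK x" using greater \<open>x \<noteq> 0\<close> by simp
  then obtain n where "C < (u (g x) / absK x) ^ n" using real_arch_pow by blast
  thus False using bounded[of "x ^ n"] \<open>x \<noteq> 0\<close>
    by (simp add: hom_distribs K.power u.power power_divide less_divide_eq mult.commute)
qed

lemma hom_isometry:
  fixes g :: "'k \<Rightarrow> 'e::field"
  assumes "field_hom g" and "nonarch_abs u" and "\<And>q. u (g (incl q)) = absQ q"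
  shows "u (g x) = absK x"
proof (rule antisym)
  interpret g: field_hom g by fact
  interpret u: nonarch_field u by unfold_locales fact
  show "u (g x) \<le> absK x" using assms by (rule hom_le_abs)
  have "inverse (u (g x)) \<le> inverse (absK x)"
    using hom_le_abs[OF assms, of "inverse x"] by (simp add: hom_distribs u.inverse K.inverse)
  thus "absK x \<le> u (g x)" by (cases "x = 0") (simp_all add: inverse_le_iff_le)
qed

text \<open>The residue field has at most \<open>p ^ n\<close> solutions of \<open>x ^ (p ^ n) = x\<close>, and the sum of these bounds
  over \<open>0 < n < f\<close> is less than \<open>p ^ f\<close>.\<close>

lemma residue_generator:
  "\<exists>x. absK x \<le> 1 \<and> (\<forall>n. 0 < n \<longrightarrow> n < f \<longrightarrow> absK (x ^ (p ^ n) - x) = 1)"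
proof -
  obtain T where T: "finite T" "card T = p ^ f" "K.unit_separated T"
    using residue_representatives_exist by blast
  define U where "U n = {x \<in> T. absK (x ^ (p ^ n) - x) < 1}" for n
  have card_U: "card (U n) \<le> p ^ n" if "n > 0" for n
  proof -
    define r :: "'k poly" where "r = monom 1 (p ^ n) - monom 1 1"
    have pn: "p ^ n > 1" using one_less_power[OF Q.p_gt_1 that] .
    have degree_r: "degree r = p ^ n"
      unfolding r_def diff_conv_add_uminus using pn
      by (subst degree_add_eq_left) (auto simp: degree_monom_eq)
    have "card (U n) \<le> degree r"
    proof (rule K.card_residue_roots_le_degree)
      show "K.unit_separated (U n)" using T(3) by (rule K.unit_separated_subset) (auto simp: U_def)
      show "absK (coeff r m) \<le> 1" for m by (auto simp: r_def)
      show "absK (lead_coeff r) = 1" unfolding degree_r using pn by (simp add: r_def)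
    qed (use T(1) in \<open>auto simp: U_def r_def poly_monom\<close>)
    thus ?thesis by (simp add: degree_r)
  qed
  have "card (\<Union>n\<in>{1..<f}. U n) \<le> (\<Sum>n\<in>{1..<f}. card (U n))" by (rule card_UN_le) simp
  also have "\<dots> \<le> (\<Sum>n\<in>{1..<f}. p ^ n)" by (intro sum_mono card_U) auto
  also have "\<dots> \<le> (\<Sum>n<f. p ^ n)" by (intro sum_mono2) auto
  also have "\<dots> < card T"
    using sum_powers_less_power[OF Q.p_gt_1] by (simp add: T(2))
  finally have "\<not> T \<subseteq> (\<Union>n\<in>{1..<f}. U n)"
    using card_mono[of "\<Union>n\<in>{1..<f}. U n" T] T(1) by (force simp: U_def)
  then obtain x where x: "x \<in> T" "\<And>n. 0 < n \<Longrightarrow> n < f \<Longrightarrow> \<not> absK (x ^ (p ^ n) - x) < 1"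
    by (fastforce simp: U_def Suc_le_eq)
  have "absK x \<le> 1" using K.unit_separatedD(1)[OF T(3) x(1)] .
  moreover have "absK (x ^ (p ^ n) - x) \<le> 1" for n
    using \<open>absK x \<le> 1\<close> by (intro K.le_1_diff K.le_1_power)
  ultimately show ?thesis using x(2) by (metis linorder_not_less order_antisym)
qed

end

locale unramified_frobenius = unramified_extension p absQ absK incl f + frob: field_isom frob
  for p and absQ :: "'q::field_char_0 \<Rightarrow> real" and absK :: "'k::field \<Rightarrow> real" and incl :: "'q \<Rightarrow> 'k"
    and f
    and frob :: "'k \<Rightarrow> 'k" +
  assumes frob_incl: "frob (incl q) = incl q"
    and frob_cong: "absK x \<le> 1 \<Longrightarrow> absK (frob x - x ^ p) < 1"
begin

lemma abs_frob_funpow: "absK ((frob ^^ n) x) = absK x"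
proof (induction n)
  case (Suc n)
  thus ?case using hom_isometry[OF frob.field_hom_axioms K.nonarch, of "(frob ^^ n) x"]
    by (simp add: frob_incl abs_incl)
qed simp

lemma frob_funpow_cong:
  assumes "absK x \<le> 1"
  shows "absK ((frob ^^ n) x - x ^ (p ^ n)) < 1"
proof (induction n)
  case (Suc n)
  let ?y = "(frob ^^ n) x"
  have "absK (frob ?y - ?y ^ p) < 1" using assms by (intro frob_cong) (simp add: abs_frob_funpow)
  moreover have "absK (?y ^ p - (x ^ (p ^ n)) ^ p) < 1"
    using assms Suc by (intro K.power_diff_less_1 K.le_1_power) (simp_all add: abs_frob_funpow)
  ultimately have "absK ((frob ?y - ?y ^ p) + (?y ^ p - (x ^ (p ^ n)) ^ p)) < 1"
    by (rule K.add_less)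
  thus ?case by (simp add: power_mult[symmetric] mult.commute)
qed simp

lemma frobenius_orbit_unit_separated:
  "\<exists>a. absK a \<le> 1 \<and> (\<forall>n. 0 < n \<longrightarrow> n < f \<longrightarrow> absK ((frob ^^ n) a - a) = 1)"
proof -
  obtain a where a: "absK a \<le> 1" "\<And>n. 0 < n \<Longrightarrow> n < f \<Longrightarrow> absK (a ^ (p ^ n) - a) = 1"
    using residue_generator by blast
  have "absK ((frob ^^ n) a - a) = 1" if n: "0 < n" "n < f" for n
  proof (rule antisym)
    show "absK ((frob ^^ n) a - a) \<le> 1"
      using a(1) by (intro K.le_1_diff) (simp_all add: abs_frob_funpow)
    show "1 \<le> absK ((frob ^^ n) a - a)"
    proof (rule ccontr)
      assume "\<not> ?thesis"
      hence "absK (((frob ^^ n) a - a) - ((frob ^^ n) a - a ^ p ^ n)) < 1"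
        using frob_funpow_cong[OF a(1)] by (intro K.diff_less[of "(frob ^^ n) a - a"]) auto
      thus False using a(2)[OF n] by simp
    qed
  qed
  thus ?thesis using a(1) by blast
qed

end

section \<open>Conjugates and idempotents\<close>

lemma field_hom_comp:
  assumes "field_hom g" "field_hom h"
  shows "field_hom (g \<circ> h)"
proof -
  interpret g: field_hom g by fact
  interpret h: field_hom h by fact
  show ?thesis by unfold_locales (auto simp: hom_distribs)
qed

lemma field_hom_funpow:
  fixes h :: "'k::field \<Rightarrow> 'k"
  assumes "field_hom h"
  shows "field_hom (h ^^ n)"
proof (induction n)
  case 0
  show ?case by unfold_locales auto
next
  case (Suc n)
  thus ?case using field_hom_comp[OF assms] by (simp add: comp_def)
qed

locale coefficient_fields =
  fixes S :: "('q::field_char_0, 'a::field, 'k::field) coeff_data"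
  assumes datum: "coeff_datum S"
begin

abbreviation "p \<equiv> char_p S"
abbreviation "f \<equiv> res_deg S"

lemma field_hom_emb0: "field_hom (emb0 S)"
  and emb0_inclK: "emb0 S (inclK S q) = inclF S q"
  and abs_inclF: "absF S (inclF S q) = absQ S q"
  using datum by (simp_all add: coeff_datum_def)

sublocale F: nonarch_field "absF S"
  using datum by unfold_locales (simp add: coeff_datum_def)

sublocale inclF: field_hom "inclF S"
  using datum by (simp add: coeff_datum_def)

sublocale unramified_frobenius p "absQ S" "absK S" "inclK S" f "frob S"
proof -
  interpret Q: padic_field p "absQ S" using datum by unfold_locales (simp add: coeff_datum_def)
  interpret K: nonarch_field "absK S" using datum by unfold_locales (simp add: coeff_datum_def)
  interpret incl: field_hom "inclK S" using datum by (simp add: coeff_datum_def)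
  interpret frob: field_hom "frob S" using datum by (simp add: coeff_datum_def)
  have "surj (frob S)" using datum by (simp add: coeff_datum_def bij_is_surj)
  moreover have "residue_field_K S = {x. absK S x \<le> 1} // K.residue_relation"
    by (simp add: residue_field_K_def ringK_def K.residue_relation_def)
  ultimately show "unramified_frobenius p (absQ S) (absK S) (inclK S) f (frob S)"
    using datum unfolding coeff_datum_def ringK_def by unfold_locales simp_all
qed

lemma abs_p: "absF S (of_nat p) = 1 / real p"
  using abs_inclF[of "of_nat p"] by (simp add: hom_distribs Q.abs_p)

abbreviation "frob_inv \<equiv> inv_into UNIV (frob S)"

lemma frob_inv_inclK: "frob_inv (inclK S q) = inclK S q"
  using inv_f_f[OF frob.inj_f, of "inclK S q"] unfolding frob_incl .

lemma field_hom_emb: "field_hom (emb S i)"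
  unfolding emb_def
  by (rule field_hom_comp[OF field_hom_emb0 field_hom_funpow[OF frob.inv.field_hom_axioms]])

sublocale emb: field_hom "emb S i" for i by (rule field_hom_emb)

lemma emb_inclK: "emb S i (inclK S q) = inclF S q"
proof -
  have "(frob_inv ^^ i) (inclK S q) = inclK S q" by (induction i) (auto simp: frob_inv_inclK)
  thus ?thesis by (simp add: emb_def emb0_inclK)
qed

lemma abs_emb: "absF S (emb S i x) = absK S x"
  using hom_isometry[OF field_hom_emb F.nonarch] by (simp add: emb_inclK abs_inclF)

lemma emb_frob_funpow: "emb S (i + n) ((frob S ^^ n) x) = emb S i x"
proof (induction n)
  case (Suc n)
  have "(frob_inv ^^ Suc m) (frob S y) = (frob_inv ^^ m) y" for m y
    by (simp add: funpow_Suc_right del: funpow.simps)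
  thus ?case using Suc by (simp add: emb_def del: funpow.simps(2)) (simp add: emb_def)
qed simp

definition separating :: "'k \<Rightarrow> bool" where
  "separating a \<longleftrightarrow> absK S a \<le> 1 \<and> inj_on (\<lambda>i. emb S i a) {..<f} \<and>
    F.unit_separated ((\<lambda>i. emb S i a) ` {..<f})"

lemma separating_exists: "\<exists>a. separating a"
proof -
  obtain a where a: "absK S a \<le> 1" "\<And>n. 0 < n \<Longrightarrow> n < f \<Longrightarrow> absK S ((frob S ^^ n) a - a) = 1"
    using frobenius_orbit_unit_separated by blast
  have ordered: "absF S (emb S i a - emb S j a) = 1" if ij: "i < j" "j < f" for i j
  proof -
    have "emb S i a - emb S j a = emb S j ((frob S ^^ (j - i)) a - a)"
      using emb_frob_funpow[of i "j - i" a] ij(1) by (simp add: hom_distribs)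
    thus ?thesis using a(2)[of "j - i"] ij by (simp add: abs_emb)
  qed
  have distinct: "absF S (emb S i a - emb S j a) = 1" if "i < f" "j < f" "i \<noteq> j" for i j
    using ordered[of i j] ordered[of j i] that F.diff_commute[of "emb S i a" "emb S j a"]
    by (cases i j rule: linorder_cases) auto
  hence "inj_on (\<lambda>i. emb S i a) {..<f}" by (force intro: inj_onI)
  moreover have "F.unit_separated ((\<lambda>i. emb S i a) ` {..<f})"
    using a(1) distinct by (auto simp: F.unit_separated_def abs_emb)
  ultimately show ?thesis using a(1) unfolding separating_def by blast
qed

lemma emb_poly: "emb S i (\<Sum>j<n. inclK S (q j) * a ^ j) = (\<Sum>j<n. inclF S (q j) * emb S i a ^ j)"
  by (simp add: hom_distribs emb_inclK)

lemma zero_if_vanishes_on_conjugates: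
  assumes a: "separating a" and zero: "\<And>l. l < f \<Longrightarrow> (\<Sum>j<f. c j * emb S l a ^ j) = 0" and j: "j < f"
  shows "c j = 0"
proof (rule polyfun_zero_of_many_roots)
  show "f \<le> card ((\<lambda>l. emb S l a) ` {..<f})" using a by (simp add: separating_def card_image)
qed (use zero j in auto)

lemma power_basis:
  assumes "separating a"
  shows "\<exists>q. x = (\<Sum>j<f. inclK S (q j) * a ^ j)"
proof (rule coordinates_exist, unfold VK.indep_family_def, intro allI impI)
  fix c l assume c: "(\<Sum>j<f. inclK S (c j) * a ^ j) = 0" and l: "l < f"
  have "(\<Sum>j<f. inclF S (c j) * emb S i a ^ j) = 0" for i
    using emb_poly[of i c a f] c by simp
  hence "inclF S (c l) = 0"
    using zero_if_vanishes_on_conjugates[OF assms, of "\<lambda>j. inclF S (c j)"] l by blast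
  thus "c l = 0" by simp
qed

text \<open>The image of a separating element is a root of its minimal polynomial, whose \<open>f\<close> roots are the
  conjugates \<open>\<tau>\<^sub>j(a)\<close>.\<close>

lemma hom_eq_emb:
  assumes g: "field_hom g" and g_incl: "\<And>q. g (inclK S q) = inclF S q"
  shows "\<exists>j<f. g = emb S j"
proof -
  interpret g: field_hom g by fact
  have g_poly: "g (\<Sum>j<n. inclK S (q j) * a ^ j) = (\<Sum>j<n. inclF S (q j) * g a ^ j)" for n q a
    by (simp add: hom_distribs g_incl)
  obtain a where a: "separating a" using separating_exists by blast
  obtain q where q: "a ^ f = (\<Sum>j<f. inclK S (q j) * a ^ j)" using power_basis[OF a] by blast
  have "g a \<in> (\<lambda>i. emb S i a) ` {..<f}" (is "_ \<in> ?X")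
  proof (rule ccontr)
    assume "g a \<notin> ?X"
    hence "card (insert (g a) ?X) = Suc f" using a by (simp add: separating_def card_image)
    define c where "c j = (if j = f then 1 else - inclF S (q j))" for j
    have "c f = 0"
    proof (rule polyfun_zero_of_many_roots[of "Suc f" "insert (g a) ?X"])
      fix x assume "x \<in> insert (g a) ?X"
      hence "x ^ f = (\<Sum>j<f. inclF S (q j) * x ^ j)"
        using arg_cong[OF q, of g] g_poly arg_cong[OF q, of "emb S _"] emb_poly
        by (auto simp: hom_distribs)
      thus "(\<Sum>j<Suc f. c j * x ^ j) = 0" by (simp add: c_def sum_negf)
    qed (use \<open>card (insert (g a) ?X) = Suc f\<close> in auto)
    thus False by (simp add: c_def)
  qed
  then obtain j where j: "j < f" "g a = emb S j a" by auto
  have "g x = emb S j x" for x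
  proof -
    obtain r where r: "x = (\<Sum>j<f. inclK S (r j) * a ^ j)" using power_basis[OF a] by blast
    show ?thesis by (simp only: r g_poly emb_poly j(2))
  qed
  thus ?thesis using j(1) by blast
qed

lemma emb_res_deg: "emb S f = emb S 0"
proof -
  obtain j where j: "j < f" "emb S f = emb S j" using hom_eq_emb[OF field_hom_emb emb_inclK] by blast
  have "emb S (f - j) x = emb S 0 x" for x
    using emb_frob_funpow[of "f - j" j x] emb_frob_funpow[of 0 j x] j by simp
  moreover obtain a where "separating a" using separating_exists by blast
  ultimately have "f - j \<ge> f" using f_pos j(1) unfolding separating_def
    by (metis (no_types, lifting) diff_is_0_eq inj_onD lessThan_iff not_le)
  hence "j = 0" using j(1) by simp
  thus ?thesis using j(2) by simp
qed

lemma prev_less: "prev S i < f"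
  using f_pos by (simp add: prev_def)

lemma emb_frob:
  assumes "i < f"
  shows "emb S i (frob S x) = emb S (prev S i) x"
proof (cases i)
  case 0
  thus ?thesis using emb_frob_funpow[of "f - 1" 1 x] f_pos by (simp add: prev_def emb_res_deg)
next
  case (Suc n)
  thus ?thesis using emb_frob_funpow[of n 1 x] assms by (simp add: prev_def)
qed

lemma idempotent_exists:
  assumes "i < f"
  shows "\<exists>t. set t \<subseteq> ringF S \<times> ringK S \<and>
     (\<forall>l<f. (\<Sum>(x, y)\<leftarrow>t. x * emb S l y) = (if l = i then 1 else 0))"
proof -
  obtain a where a: "separating a" using separating_exists by blast
  let ?X = "(\<lambda>l. emb S l a) ` {..<f}"
  have "finite ?X" "F.unit_separated ?X" "emb S i a \<in> ?X"
    using a assms by (auto simp: separating_def)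
  from F.integral_lagrange_basis_poly[OF this]
  obtain q where q: "\<forall>n. absF S (coeff q n) \<le> 1"
    "\<forall>y\<in>?X. poly q y = (if y = emb S i a then 1 else 0)" by blast
  define t where "t = map (\<lambda>j. (coeff q j, a ^ j)) [0..<Suc (degree q)]"
  have "(\<Sum>(x, y)\<leftarrow>t. x * emb S l y) = poly q (emb S l a)" for l
    unfolding t_def poly_altdef map_map comp_def
    by (simp add: sum_list_distinct_conv_sum_set emb.hom_power atLeast0_lessThan_Suc
        flip: lessThan_Suc_atMost atLeast0LessThan)
  moreover have "poly q (emb S l a) = (if l = i then 1 else 0)" if "l < f" for l
  proof -
    have "emb S l a = emb S i a \<longleftrightarrow> l = i"
      using a assms that unfolding separating_def by (auto dest: inj_onD)
    thus ?thesis using q(2) that by simp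
  qed
  moreover have "set t \<subseteq> ringF S \<times> ringK S"
    using q(1) a K.le_1_power by (auto simp: t_def ringF_def ringK_def separating_def)
  ultimately show ?thesis by (intro exI[of _ t]) simp
qed

lemma idem_spec:
  assumes "i < f"
  shows "set (idem S i) \<subseteq> ringF S \<times> ringK S"
    "l < f \<Longrightarrow> (\<Sum>(x, y)\<leftarrow>idem S i. x * emb S l y) = (if l = i then 1 else 0)"
  using someI_ex[OF idempotent_exists[OF assms]] unfolding idem_def by auto

definition nxt :: "nat \<Rightarrow> nat" where "nxt i = (i + 1) mod f"

lemma nxt_less: "nxt i < f"
  using f_pos by (simp add: nxt_def)

lemma prev_nxt: "i < f \<Longrightarrow> prev S (nxt i) = i"
  by (cases "i = f - 1") (auto simp: prev_def nxt_def)

lemma nxt_prev: "i < f \<Longrightarrow> nxt (prev S i) = i"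
  by (cases i) (auto simp: prev_def nxt_def)

lemma bij_betw_prev: "bij_betw (prev S) {..<f} {..<f}"
  by (rule bij_betw_byWitness[of _ nxt]) (auto simp: prev_nxt nxt_prev prev_less nxt_less)

lemma prev_eq_iff: "i < f \<Longrightarrow> j < f \<Longrightarrow> prev S i = prev S j \<longleftrightarrow> i = j"
  using nxt_prev by metis

end

section \<open>Jumps of a filtration\<close>

definition jump_count :: "nat \<Rightarrow> (nat \<Rightarrow> int) \<Rightarrow> int \<Rightarrow> nat" where
  "jump_count n h j = card {m. m < n \<and> j \<le> h m}"

lemma jump_count_le: "jump_count n h j \<le> n"
  using card_mono[of "{..<n}" "{m. m < n \<and> j \<le> h m}"] by (auto simp: jump_count_def)

lemma less_jump_count_iff:
  assumes h: "antimono_on {..<n} h"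
  shows "m < jump_count n h j \<longleftrightarrow> m < n \<and> j \<le> h m"
proof -
  let ?A = "{m. m < n \<and> j \<le> h m}"
  have "{..m} \<subseteq> ?A" if "m \<in> ?A" for m
  proof
    fix l assume "l \<in> {..m}"
    thus "l \<in> ?A" using monotone_onD[OF h, of l m] that by auto
  qed
  hence "m < card ?A" if "m \<in> ?A" for m
    using card_mono[of ?A "{..m}"] that by auto
  hence "?A \<subseteq> {..<card ?A}" by blast
  hence "?A = {..<card ?A}" by (intro card_subset_eq) auto
  from eqset_imp_iff[OF this, of m] show ?thesis by (simp add: jump_count_def)
qed

lemma jump_count_Suc: "jump_count n h j = card {m. m < n \<and> h m = j} + jump_count n h (j + 1)"
proof -
  have "j \<le> h m \<longleftrightarrow> h m = j \<or> j + 1 \<le> h m" for m by (metis add1_zle_eq le_less)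
  hence "{m. m < n \<and> j \<le> h m} = {m. m < n \<and> h m = j} \<union> {m. m < n \<and> j + 1 \<le> h m}"
    by (simp only: Collect_disj_eq[symmetric] conj_disj_distribL[symmetric])
  moreover have "{m. m < n \<and> h m = j} \<inter> {m. m < n \<and> j + 1 \<le> h m} = {}" by force
  ultimately show ?thesis by (simp add: jump_count_def card_Un_disjoint)
qed

lemma jump_count_eventually_0: "\<exists>b. \<forall>j\<ge>b. jump_count n h j = 0"
proof -
  obtain b where "\<And>m. m < n \<Longrightarrow> h m \<le> b"
    using bdd_above_finite[of "h ` {..<n}"] by (auto simp: bdd_above_def)
  hence "jump_count n h j = 0" if "b + 1 \<le> j" for j
    using that unfolding jump_count_def by (subst card_eq_0_iff) fastforce
  thus ?thesis by blast
qed

lemma jump_count_eventually_all: "\<exists>b. \<forall>j\<le>b. jump_count n h j = n"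
proof -
  obtain b where b: "\<And>m. m < n \<Longrightarrow> b \<le> h m"
    using bdd_below_finite[of "h ` {..<n}"] by (auto simp: bdd_below_def)
  have "{m. m < n \<and> j \<le> h m} = {..<n}" if "j \<le> b" for j
    using b that by fastforce
  hence "jump_count n h j = n" if "j \<le> b" for j using that by (simp add: jump_count_def)
  thus ?thesis by blast
qed

lemma eq_jump_count_if_differences:
  fixes q :: "int \<Rightarrow> nat"
  assumes step: "\<And>j. int (q j) - int (q (j + 1)) = int (card {m. m < n \<and> h m = j})"
    and top: "\<And>j. b \<le> j \<Longrightarrow> q j = 0"
  shows "q j = jump_count n h j"
proof -
  obtain b' where b': "\<And>j. b' \<le> j \<Longrightarrow> jump_count n h j = 0" using jump_count_eventually_0 by blast
  show ?thesis
  proof (cases "max b b' \<le> j")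
    case False
    hence "j \<le> max b b'" by linarith
    thus ?thesis
    proof (induction j rule: int_le_induct)
      case base
      show ?case using top b' by simp
    next
      case (step j)
      thus ?case using assms(1)[of "j - 1"] jump_count_Suc[of n h "j - 1"] by simp
    qed
  qed (use top b' in simp)
qed

lemma antimono_eq_jump_count:
  fixes q :: "int \<Rightarrow> nat"
  assumes q: "antimono q" and bottom: "\<And>j. j \<le> b \<Longrightarrow> q j = n" and top: "\<And>j. b' \<le> j \<Longrightarrow> q j = 0"
  shows "\<exists>h. antimono_on {..<n} h \<and> (\<forall>j. q j = jump_count n h j)"
proof -
  have q_le: "q j \<le> n" for j
    using antimonoD[OF q, of "min b j" j] bottom[of "min b j"] by simp
  have "\<exists>c. \<forall>j. m < q j \<longleftrightarrow> j \<le> c" if m: "m < n" for m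
  proof (intro exI allI iffI)
    let ?J = "{j \<in> {b..b'}. m < q j}"
    have below: "j < b'" if "m < q j" for j using top[of j] that by force
    have fin: "finite ?J" by (rule finite_subset[of _ "{b..b'}"]) auto
    have "b \<in> ?J" using bottom[of b] m below[of b] by simp
    hence Max_in: "Max ?J \<in> ?J" using Max_in[OF fin] by blast
    show "j \<le> Max ?J" if "m < q j" for j
    proof (cases "b \<le> j")
      case True
      thus ?thesis using that below[of j] by (intro Max_ge[OF fin]) simp
    next
      case False
      thus ?thesis using Max_ge[OF fin \<open>b \<in> ?J\<close>] by simp
    qed
    show "m < q j" if "j \<le> Max ?J" for j
      using antimonoD[OF q that] Max_in by simp
  qed
  then obtain h where h: "\<And>m j. m < n \<Longrightarrow> m < q j \<longleftrightarrow> j \<le> h m" by metis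
  have "h m' \<le> h m" if "m \<le> m'" "m' < n" for m m'
    using h[of m' "h m'"] h[of m "h m'"] that by simp
  hence "antimono_on {..<n} h" by (auto intro: monotone_onI)
  moreover have "q j = jump_count n h j" for j
  proof -
    have "m < q j \<longleftrightarrow> m < n \<and> j \<le> h m" for m using h[of m j] q_le[of j] by auto
    hence "{m. m < n \<and> j \<le> h m} = {..<q j}" by auto
    thus ?thesis by (simp add: jump_count_def)
  qed
  ultimately show ?thesis by blast
qed

section \<open>Integral and parabolic matrices\<close>

context coefficient_fields
begin

lemma integral_mat_iff: "F.integral_mat n A \<longleftrightarrow> A \<in> carrier_mat n n \<and> elements_mat A \<subseteq> ringF S"
proof -
  have "elements_mat A \<subseteq> ringF S \<longleftrightarrow> (\<forall>i<n. \<forall>j<n. absF S (A $$ (i, j)) \<le> 1)" if A: "A \<in> carrier_mat n n"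
    using elements_matI[OF A _ _ refl] elements_matD[of _ A] carrier_matD[OF A]
    by (fastforce simp: ringF_def)
  thus ?thesis by (auto simp: F.integral_mat_def)
qed

lemma GLO_iff: "A \<in> GLO S n \<longleftrightarrow> F.integral_mat n A \<and> (\<exists>B. F.integral_mat n B \<and> A * B = 1\<^sub>m n)"
  unfolding GLO_def integral_mat_iff using mat_mult_left_right_inverse[of A n] by blast

lemma GLO_carrier: "A \<in> GLO S n \<Longrightarrow> A \<in> carrier_mat n n"
  by (simp add: GLO_def)

lemma GLO_integral: "A \<in> GLO S n \<Longrightarrow> F.integral_mat n A"
  by (simp add: GLO_iff)

lemma GLO_minv:
  assumes "A \<in> GLO S n"
  shows "minv A \<in> GLO S n" "A * minv A = 1\<^sub>m n" "minv A * A = 1\<^sub>m n"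
proof -
  obtain B where B: "B \<in> carrier_mat n n" "elements_mat B \<subseteq> ringF S" "A * B = 1\<^sub>m n" "B * A = 1\<^sub>m n"
    using assms unfolding GLO_def by blast
  have "minv A = B" using minv_eq[OF GLO_carrier[OF assms] B(1,3)] .
  thus "minv A \<in> GLO S n" "A * minv A = 1\<^sub>m n" "minv A * A = 1\<^sub>m n"
    using assms B unfolding GLO_def by auto
qed

lemma GLO_one: "1\<^sub>m n \<in> GLO S n"
  unfolding GLO_iff using F.integral_mat_one by (intro conjI exI[of _ "1\<^sub>m n"]) auto

lemma GLO_mult:
  assumes A: "A \<in> GLO S n" and B: "B \<in> GLO S n"
  shows "A * B \<in> GLO S n"
proof -
  note carrier = A[THEN GLO_carrier] B[THEN GLO_carrier] GLO_minv(1)[OF A, THEN GLO_carrier]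
    GLO_minv(1)[OF B, THEN GLO_carrier]
  have "(A * B) * (minv B * minv A) = A * (B * minv B) * minv A"
    using carrier by (simp add: assoc_mult_mat[of _ n n _ n _ n] mult_carrier_mat[of _ n n _ n])
  also have "\<dots> = 1\<^sub>m n" using carrier GLO_minv(2) A B by simp
  finally show ?thesis
    using A B GLO_minv(1)[OF A] GLO_minv(1)[OF B] F.integral_mat_mult unfolding GLO_iff by blast
qed

lemma abs_det_GLO:
  assumes "A \<in> GLO S n"
  shows "absF S (det A) = 1"
  using assms F.det_unit_if_inverse_integral unfolding GLO_iff by blast

lemma of_nat_p_nonzero: "(of_nat p :: 'a) \<noteq> 0"
  using abs_p Q.p_gt_1 F.eq_0_iff[of "of_nat p"] by auto

lemma p_powi_integral: "0 \<le> j \<Longrightarrow> absF S (of_nat p powi j) \<le> 1"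
  using F.le_1_power[OF F.of_nat_le_1] by (simp add: power_int_def)

lemma Delta_carrier [simp]: "Delta S d h \<in> carrier_mat d d"
  by (simp add: Delta_def)

lemma Delta_minv:
  "Delta S d h * minv (Delta S d h) = 1\<^sub>m d" "minv (Delta S d h) * Delta S d h = 1\<^sub>m d"
  "minv (Delta S d h) \<in> carrier_mat d d"
proof -
  have inverse: "Delta S d h * mat_diag d (\<lambda>m. of_nat p powi - h m) = 1\<^sub>m d"
    unfolding Delta_def mat_diag_diag using of_nat_p_nonzero by (simp add: power_int_minus)
  have minv: "minv (Delta S d h) = mat_diag d (\<lambda>m. of_nat p powi - h m)"
    by (rule minv_eq[OF Delta_carrier mat_diag_dim inverse])
  show "Delta S d h * minv (Delta S d h) = 1\<^sub>m d" "minv (Delta S d h) \<in> carrier_mat d d"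
    using inverse unfolding minv by auto
  from mat_mult_left_right_inverse[OF Delta_carrier this(2,1)]
  show "minv (Delta S d h) * Delta S d h = 1\<^sub>m d" .
qed

lemma mult_Delta_index:
  "A \<in> carrier_mat d d \<Longrightarrow> l < d \<Longrightarrow> m < d \<Longrightarrow>
    (A * Delta S d h) $$ (l, m) = A $$ (l, m) * of_nat p powi h m"
  by (simp add: Delta_def mat_diag_mult_right)

lemma twist_eq_iff:
  assumes "A \<in> carrier_mat d d" "B \<in> carrier_mat d d" "C \<in> GLO S d" "C' \<in> GLO S d"
  shows "B = C * A * Delta S d h * minv C' * minv (Delta S d h) \<longleftrightarrow>
    B * Delta S d h * C' = C * (A * Delta S d h)"
proof -
  let ?E = "Delta S d h"
  note carrier = assms(1,2) GLO_carrier[OF assms(3)] GLO_carrier[OF assms(4)]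
    GLO_minv(1)[OF assms(4), THEN GLO_carrier] Delta_carrier[of d h] Delta_minv(3)[of d h]
  note assoc = assoc_mult_mat[of _ d d _ d _ d] mult_carrier_mat[of _ d d _ d]
  show ?thesis
  proof
    assume B: "B = C * A * ?E * minv C' * minv ?E"
    have "B * ?E * C' = C * A * ?E * minv C' * (minv ?E * ?E) * C'"
      unfolding B using carrier by (simp add: assoc)
    also have "\<dots> = C * (A * ?E) * (minv C' * C')" using carrier Delta_minv(2) by (simp add: assoc)
    also have "\<dots> = C * (A * ?E)"
      using carrier GLO_minv(3)[OF assms(4)] by (simp add: assoc right_mult_one_mat[of _ d d])
    finally show "B * ?E * C' = C * (A * ?E)" .
  next
    assume eq: "B * ?E * C' = C * (A * ?E)"
    have "C * A * ?E * minv C' * minv ?E = B * ?E * (C' * minv C') * minv ?E"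
      using carrier eq[symmetric] by (simp add: assoc)
    also have "\<dots> = B * (?E * minv ?E)" using carrier GLO_minv(2)[OF assms(4)] by (simp add: assoc)
    also have "\<dots> = B" using carrier Delta_minv(1)[of d h] by simp
    finally show "B = C * A * ?E * minv C' * minv ?E" ..
  qed
qed

lemma diag_block_GLO:
  assumes C: "C \<in> GLO S d" and "r + n \<le> d" "zero_below r C" "zero_below (r + n) C"
  shows "diag_block r n C \<in> GLO S n"
proof -
  note inv = GLO_minv[OF C]
  have "zero_below (r + n) (minv C)"
    using zero_below_inverse[OF GLO_carrier[OF C] GLO_carrier[OF inv(1)] inv(3)] assms by blast
  hence "diag_block r n C * diag_block r n (minv C) = diag_block r n (1\<^sub>m d)"
    using diag_block_mult[OF GLO_carrier[OF C] GLO_carrier[OF inv(1)]] assms inv(2) by simp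
  also have "\<dots> = 1\<^sub>m n" using \<open>r + n \<le> d\<close> by (intro eq_matI) (auto simp: diag_block_def)
  finally show ?thesis
    unfolding GLO_iff
    using F.integral_mat_diag_block[OF GLO_integral] C inv(1) \<open>r + n \<le> d\<close> by blast
qed

lemma zero_below_jump_count_iff:
  assumes h: "antimono_on {..<d} h" and "C \<in> carrier_mat d d"
  shows "(\<forall>j. zero_below (jump_count d h j) C) \<longleftrightarrow> (\<forall>a<d. \<forall>b<d. h a < h b \<longrightarrow> C $$ (a, b) = 0)"
proof -
  have "jump_count d h j \<le> a \<longleftrightarrow> h a < j" if "a < d" for a j
    using less_jump_count_iff[OF h, of a j] that by auto
  hence "zero_below (jump_count d h j) C \<longleftrightarrow> (\<forall>a<d. \<forall>b<d. h a < j \<longrightarrow> j \<le> h b \<longrightarrow> C $$ (a, b) = 0)" for j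
    using less_jump_count_iff[OF h] assms(2) unfolding zero_below_def by auto
  thus ?thesis by force
qed

lemma block_bound_eq: "block_bound d h j = (if j = 0 then 0 else jump_count d h (h (j - 1)))"
  by (simp add: block_bound_def jump_count_def)

lemma block_bound_le: "block_bound d h j \<le> d"
  using jump_count_le by (simp add: block_bound_eq)

lemma zero_below_block_bound_iff:
  assumes h: "antimono_on {..<d} h" and C: "C \<in> carrier_mat d d"
  shows "(\<forall>j\<le>d. zero_below (block_bound d h j) C) \<longleftrightarrow> (\<forall>a<d. \<forall>b<d. h a < h b \<longrightarrow> C $$ (a, b) = 0)"
proof (intro iffI allI impI)
  fix a b assume zero: "\<forall>j\<le>d. zero_below (block_bound d h j) C" and ab: "a < d" "b < d" "h a < h b"
  have "zero_below (jump_count d h (h b)) C"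
    using zero[rule_format, of "Suc b"] ab by (simp add: block_bound_eq)
  moreover have "jump_count d h (h b) \<le> a" "b < jump_count d h (h b)"
    using less_jump_count_iff[OF h, of a "h b"] less_jump_count_iff[OF h, of b "h b"] ab by linarith+
  ultimately show "C $$ (a, b) = 0" using ab C by (simp add: zero_below_def)
next
  fix j assume "\<forall>a<d. \<forall>b<d. h a < h b \<longrightarrow> C $$ (a, b) = 0"
  hence "zero_below (jump_count d h (h (j - 1))) C"
    using zero_below_jump_count_iff[OF h C] by blast
  thus "zero_below (block_bound d h j) C" by (simp add: block_bound_eq zero_below_def)
qed

lemma parabolic_iff:
  assumes h: "antimono_on {..<d} h"
  shows "C \<in> parabolic S d h \<longleftrightarrow> C \<in> GLO S d \<and> (\<forall>a<d. \<forall>b<d. h a < h b \<longrightarrow> C $$ (a, b) = 0)"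
proof (cases "C \<in> GLO S d")
  case True
  note C = GLO_carrier[OF True]
  define r where "r j = block_bound d h j" for j
  have r_le: "r j \<le> d" for j by (simp add: r_def block_bound_le)
  have "(\<forall>a<d. \<forall>b<d. r j \<le> a \<longrightarrow> b < r j \<longrightarrow> C $$ (a, b) = 0) \<longleftrightarrow> zero_below (r j) C" for j
    using C r_le[of j] by (auto simp: zero_below_def)
  moreover have "diag_block (r j) (r (j + 1) - r j) C \<in> GLO S (r (j + 1) - r j)"
    if "\<forall>j\<le>d. zero_below (r j) C" "j < d" for j
  proof (cases "r j \<le> r (j + 1)")
    case True
    thus ?thesis using that r_le[of "j + 1"] by (intro diag_block_GLO[OF \<open>C \<in> GLO S d\<close>]) simp_all
  next
    case False
    thus ?thesis using that r_le[of j] by (intro diag_block_GLO[OF \<open>C \<in> GLO S d\<close>]) simp_all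
  qed
  ultimately have "C \<in> parabolic S d h \<longleftrightarrow> (\<forall>j\<le>d. zero_below (r j) C)"
    using True unfolding parabolic_def Let_def diag_block_def r_def by blast
  thus ?thesis using True zero_below_block_bound_iff[OF h C] by (simp add: r_def)
qed (simp add: parabolic_def)

lemma parabolic_GLO: "C \<in> parabolic S d h \<Longrightarrow> C \<in> GLO S d"
  by (simp add: parabolic_def)

lemma parabolic_one: "antimono_on {..<d} h \<Longrightarrow> 1\<^sub>m d \<in> parabolic S d h"
  using GLO_one by (auto simp: parabolic_iff)

lemma parabolic_mult:
  assumes h: "antimono_on {..<d} h" and C: "C \<in> parabolic S d h" and C': "C' \<in> parabolic S d h"
  shows "C * C' \<in> parabolic S d h"
proof -
  note carrier = GLO_carrier[OF parabolic_GLO[OF C]] GLO_carrier[OF parabolic_GLO[OF C']]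
  have "(C * C') $$ (a, b) = 0" if ab: "a < d" "b < d" "h a < h b" for a b
  proof -
    have "C $$ (a, c) * C' $$ (c, b) = 0" if "c < d" for c
      using C C' ab that unfolding parabolic_iff[OF h] by (cases "h a < h c") auto
    thus ?thesis by (subst index_mult_mat_sum[OF carrier ab(1,2)]) (intro sum.neutral, simp)
  qed
  thus ?thesis using C C' GLO_mult unfolding parabolic_iff[OF h] by blast
qed

lemma parabolic_minv:
  assumes h: "antimono_on {..<d} h" and C: "C \<in> parabolic S d h"
  shows "minv C \<in> parabolic S d h"
proof -
  note G = parabolic_GLO[OF C]
  note carrier = GLO_carrier[OF G] GLO_carrier[OF GLO_minv(1)[OF G]]
  have "\<forall>j. zero_below (jump_count d h j) C"
    using C unfolding parabolic_iff[OF h] zero_below_jump_count_iff[OF h carrier(1)] by blast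
  hence "\<forall>j. zero_below (jump_count d h j) (minv C)"
    using zero_below_inverse[OF carrier GLO_minv(3)[OF G] jump_count_le] by blast
  thus ?thesis
    using GLO_minv(1)[OF G]
    unfolding parabolic_iff[OF h] zero_below_jump_count_iff[OF h carrier(2)] by blast
qed

lemma intertwining_minv:
  assumes C: "C \<in> GLO S d" and C': "C' \<in> GLO S d" and M: "M \<in> carrier_mat d d"
    and N: "N \<in> carrier_mat d d"
    and eq: "N * C' = C * M"
  shows "M * minv C' = minv C * N"
proof -
  note carrier = M N C[THEN GLO_carrier] C'[THEN GLO_carrier] GLO_minv(1)[OF C, THEN GLO_carrier]
    GLO_minv(1)[OF C', THEN GLO_carrier]
  note assoc = assoc_mult_mat[of _ d d _ d _ d] mult_carrier_mat[of _ d d _ d]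
    left_mult_one_mat[of _ d d] right_mult_one_mat[of _ d d]
  have "M * minv C' = (minv C * C) * M * minv C'"
    unfolding GLO_minv(3)[OF C] left_mult_one_mat[OF M] ..
  also have "\<dots> = minv C * (N * C') * minv C'" unfolding eq using carrier by (simp add: assoc)
  also have "\<dots> = minv C * N * (C' * minv C')" using carrier by (simp add: assoc)
  also have "\<dots> = minv C * N" using carrier GLO_minv(2)[OF C'] by (simp add: assoc)
  finally show ?thesis .
qed

lemma intertwining_mult:
  fixes M N P :: "'a mat"
  assumes "C1 \<in> carrier_mat d d" "C1' \<in> carrier_mat d d" "C2 \<in> carrier_mat d d" "C2' \<in> carrier_mat d d"
    and "M \<in> carrier_mat d d" "N \<in> carrier_mat d d" "P \<in> carrier_mat d d"
    and "N * C1' = C1 * M" "P * C2' = C2 * N"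
  shows "P * (C2' * C1') = C2 * C1 * M"
proof -
  note assoc = assoc_mult_mat[of _ d d _ d _ d] mult_carrier_mat[of _ d d _ d]
  note carrier = assms(1-7)
  have "P * (C2' * C1') = P * C2' * C1'" using carrier by (simp add: assoc)
  also have "\<dots> = C2 * (N * C1')" unfolding assms(9) using carrier by (simp add: assoc)
  also have "\<dots> = C2 * C1 * M" unfolding assms(8) using carrier by (simp add: assoc)
  finally show ?thesis .
qed

end

locale hodge_type = coefficient_fields S
  for S :: "('q::field_char_0, 'a::field, 'k::field) coeff_data" +
  fixes d :: nat and k :: "nat \<Rightarrow> nat \<Rightarrow> int"
  assumes decreasing: "i < f \<Longrightarrow> antimono_on {..<d} (k i)"
begin

abbreviation "\<Delta> i \<equiv> Delta S d (k (prev S i))"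

lemma GLO_tuples_D: "A \<in> GLO_tuples S d \<Longrightarrow> i < f \<Longrightarrow> A i \<in> GLO S d"
  by (auto simp: GLO_tuples_def)

lemma frobenius_matrix_carrier: "A \<in> GLO_tuples S d \<Longrightarrow> i < f \<Longrightarrow> A i * \<Delta> i \<in> carrier_mat d d"
  using mult_carrier_mat[OF GLO_carrier[OF GLO_tuples_D] Delta_carrier] .

definition intertwiner :: "(nat \<Rightarrow> 'a mat) \<Rightarrow> (nat \<Rightarrow> 'a mat) \<Rightarrow> (nat \<Rightarrow> 'a mat) \<Rightarrow> bool" where
  "intertwiner C A B \<longleftrightarrow> (\<forall>i<f. C i \<in> parabolic S d (k i)) \<and>
    (\<forall>i<f. B i * \<Delta> i * C (prev S i) = C i * (A i * \<Delta> i))"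

lemma intertwinerD:
  assumes "intertwiner C A B" "i < f"
  shows "C i \<in> parabolic S d (k i)" and "B i * \<Delta> i * C (prev S i) = C i * (A i * \<Delta> i)"
    and "C i \<in> GLO S d" and "C (prev S i) \<in> GLO S d"
  using assms prev_less by (auto simp: intertwiner_def intro: parabolic_GLO)

lemma sim_iff:
  "(A, B) \<in> sim S d k \<longleftrightarrow> A \<in> GLO_tuples S d \<and> B \<in> GLO_tuples S d \<and> (\<exists>C. intertwiner C A B)"
proof -
  have "B i = C i * A i * \<Delta> i * minv (C (prev S i)) * minv (\<Delta> i) \<longleftrightarrow>
      B i * \<Delta> i * C (prev S i) = C i * (A i * \<Delta> i)"
    if "A \<in> GLO_tuples S d" "B \<in> GLO_tuples S d" "\<forall>i<f. C i \<in> parabolic S d (k i)" "i < f" for i C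
    using that prev_less[of i] GLO_tuples_D parabolic_GLO
    by (intro twist_eq_iff) (auto intro: GLO_carrier)
  thus ?thesis
    unfolding sim_def intertwiner_def mem_Collect_eq prod.case by (metis (no_types, lifting))
qed

lemma intertwiner_one:
  assumes "A \<in> GLO_tuples S d"
  shows "intertwiner (\<lambda>_. 1\<^sub>m d) A A"
  using parabolic_one[OF decreasing] frobenius_matrix_carrier[OF assms]
  by (simp add: intertwiner_def left_mult_one_mat[of _ d d] right_mult_one_mat[of _ d d])

lemma intertwiner_minv:
  assumes C: "intertwiner C A B" and "A \<in> GLO_tuples S d" "B \<in> GLO_tuples S d"
  shows "intertwiner (\<lambda>i. minv (C i)) B A"
  unfolding intertwiner_def
proof (intro conjI allI impI)
  fix i assume i: "i < f"
  show "minv (C i) \<in> parabolic S d (k i)"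
    by (rule parabolic_minv[OF decreasing[OF i] intertwinerD(1)[OF C i]])
  show "A i * \<Delta> i * minv (C (prev S i)) = minv (C i) * (B i * \<Delta> i)"
    by (rule intertwining_minv[OF intertwinerD(3,4)[OF C i] frobenius_matrix_carrier[OF assms(2) i]
          frobenius_matrix_carrier[OF assms(3) i] intertwinerD(2)[OF C i]])
qed

lemma intertwiner_mult:
  assumes C: "intertwiner C A B" and C': "intertwiner C' B E"
    and "A \<in> GLO_tuples S d" "B \<in> GLO_tuples S d" "E \<in> GLO_tuples S d"
  shows "intertwiner (\<lambda>i. C' i * C i) A E"
  unfolding intertwiner_def
proof (intro conjI allI impI)
  fix i assume i: "i < f"
  note D = intertwinerD[OF C i] and D' = intertwinerD[OF C' i]
  show "C' i * C i \<in> parabolic S d (k i)" by (rule parabolic_mult[OF decreasing[OF i] D'(1) D(1)])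
  show "E i * \<Delta> i * (C' (prev S i) * C (prev S i)) = C' i * C i * (A i * \<Delta> i)"
    by (rule intertwining_mult[OF D(3)[THEN GLO_carrier] D(4)[THEN GLO_carrier]
          D'(3)[THEN GLO_carrier] D'(4)[THEN GLO_carrier] frobenius_matrix_carrier[OF assms(3) i]
          frobenius_matrix_carrier[OF assms(4) i] frobenius_matrix_carrier[OF assms(5) i] D(2) D'(2)])
qed

theorem equiv_sim: "equiv (GLO_tuples S d) (sim S d k)"
proof (rule equivI)
  show "sim S d k \<subseteq> GLO_tuples S d \<times> GLO_tuples S d" by (auto simp only: sim_iff)
  show "refl_on (GLO_tuples S d) (sim S d k)"
    unfolding refl_on_def sim_iff by (metis intertwiner_one)
  show "sym (sim S d k)"
    unfolding sym_def sim_iff by (metis intertwiner_minv)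
  show "trans (sim S d k)"
    unfolding trans_def sim_iff by (metis intertwiner_mult)
qed

end

section \<open>Filtered \<open>\<phi>\<close>-modules and their components\<close>

locale phi_module = coefficient_fields S
  for S :: "('q::field_char_0, 'a::field, 'k::field) coeff_data" +
  fixes D :: "('a, 'k, 'v::ab_group_add) fil_phi_module"
  assumes filtered_phi_module: "filtered_phi_module S D"
begin

sublocale V: lin_space "sF D"
  using filtered_phi_module by (simp add: filtered_phi_module_def lin_space_def)

sublocale KD: vector_space "sK D"
  using filtered_phi_module by (simp add: filtered_phi_module_def)

lemma sF_sK: "sF D a (sK D b x) = sK D b (sF D a x)"
  and sF_inclF: "sF D (inclF S q) x = sK D (inclK S q) x"
  and finitely_spanned: "\<exists>B. finite B \<and> V.span B = UNIV"
  and phi_linear: "Vector_Spaces.linear (sF D) (sF D) (phi D)"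
  and phi_sK: "phi D (sK D b x) = sK D (frob S b) (phi D x)"
  and bij_phi: "bij (phi D)"
  and submod_Fil: "submod D UNIV UNIV (Fil D j)"
  and Fil_Suc: "Fil D (j + 1) \<subseteq> Fil D j"
  and Fil_UNIV: "\<exists>j. Fil D j = UNIV"
  and Fil_0: "\<exists>j. Fil D j = {0}"
  using filtered_phi_module by (simp_all add: filtered_phi_module_def)

sublocale V: nonarch_space "sF D" "V.extend_basis {}" "absF S"
proof -
  obtain B where "finite B" "V.span B = UNIV" using finitely_spanned by blast
  then interpret finite_dimensional_vector_space "sF D" "V.extend_basis {}"
    by (rule V.finite_dimensional_if_spanned)
  show "nonarch_space (sF D) (V.extend_basis {}) (absF S)" ..
qed

sublocale phi: Vector_Spaces.linear "sF D" "sF D" "phi D" by (rule phi_linear)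

lemma Fil_mono: "i \<le> j \<Longrightarrow> Fil D j \<subseteq> Fil D i"
  by (induction j rule: int_ge_induct) (use Fil_Suc in blast)+

lemma submod_UNIV_iff: "submod D UNIV UNIV M \<longleftrightarrow> V.subspace M \<and> (\<forall>b. \<forall>x\<in>M. sK D b x \<in> M)"
  by (auto simp: submod_def V.subspace_def V.subspace_neg)

lemma submod_ring_iff:
  "submod D (ringF S) (ringK S) M \<longleftrightarrow> V.integral_submodule M \<and> (\<forall>b\<in>ringK S. \<forall>x\<in>M. sK D b x \<in> M)"
proof -
  have "- x \<in> M" if "V.integral_submodule M" "x \<in> M" for x
    using V.integral_submodule_scale[OF that(1) _ that(2), of "- 1"] by simp
  thus ?thesis by (auto simp: submod_def V.integral_submodule_def ringF_def)
qed

lemma submod_mono: "submod D R R' M \<Longrightarrow> T \<subseteq> R \<Longrightarrow> T' \<subseteq> R' \<Longrightarrow> submod D T T' M"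
  unfolding submod_def by blast

lemma submod_ring_Fil: "submod D (ringF S) (ringK S) (Fil D j)"
  by (rule submod_mono[OF submod_Fil]) auto

lemma subspace_Fil: "V.subspace (Fil D j)"
  using submod_Fil submod_UNIV_iff by blast

lemma tensor_act_Nil [simp]: "tensor_act D [] x = 0"
  and tensor_act_Cons [simp]: "tensor_act D ((a, b) # t) x = sF D a (sK D b x) + tensor_act D t x"
  and tensor_act_append: "tensor_act D (t @ u) x = tensor_act D t x + tensor_act D u x"
  by (auto simp: tensor_act_def)

lemma tensor_act_add: "tensor_act D t (x + y) = tensor_act D t x + tensor_act D t y"
  by (induction t) (auto simp: V.scale_right_distrib KD.scale_right_distrib)

lemma tensor_act_sF: "tensor_act D t (sF D a x) = sF D a (tensor_act D t x)"
  by (induction t) (auto simp: V.scale_right_distrib sF_sK[symmetric] V.scale_left_commute)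

lemma tensor_act_mem:
  assumes "submod D R R' M" "set t \<subseteq> R \<times> R'" "x \<in> M"
  shows "tensor_act D t x \<in> M"
  using assms(2) by (induction t) (use assms(1,3) in \<open>auto simp: submod_def\<close>)

abbreviation tensor_value :: "nat \<Rightarrow> ('a \<times> 'k) list \<Rightarrow> 'a" where
  "tensor_value l t \<equiv> (\<Sum>(x, y)\<leftarrow>t. x * emb S l y)"

lemma tensor_power_basis:
  assumes a: "separating a"
  shows "\<exists>c. (\<forall>l. tensor_value l t = (\<Sum>j<f. c j * emb S l a ^ j)) \<and>
    (\<forall>x. tensor_act D t x = (\<Sum>j<f. sF D (c j) (sK D (a ^ j) x)))"
proof (induction t)
  case Nil
  show ?case by (intro exI[of _ "\<lambda>_. 0"]) simp
next
  case (Cons uy t)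
  obtain u y where uy: "uy = (u, y)" by force
  obtain c where c: "\<And>l. tensor_value l t = (\<Sum>j<f. c j * emb S l a ^ j)"
    "\<And>x. tensor_act D t x = (\<Sum>j<f. sF D (c j) (sK D (a ^ j) x))" using Cons by blast
  obtain q where q: "y = (\<Sum>j<f. inclK S (q j) * a ^ j)" using power_basis[OF a] by blast
  have "sK D y x = (\<Sum>j<f. sF D (inclF S (q j)) (sK D (a ^ j) x))" for x
    by (simp add: q KD.scale_sum_left sF_inclF)
  moreover have "emb S l y = (\<Sum>j<f. inclF S (q j) * emb S l a ^ j)" for l
    by (simp add: q emb_poly)
  ultimately show ?case
    by (intro exI[of _ "\<lambda>j. u * inclF S (q j) + c j"])
      (simp add: uy c V.scale_left_distrib V.scale_sum_right distrib_right sum.distrib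
        sum_distrib_left mult.assoc)
qed

lemma tensor_act_cong:
  assumes "\<And>l. l < f \<Longrightarrow> tensor_value l t = tensor_value l u"
  shows "tensor_act D t x = tensor_act D u x"
proof -
  obtain a where a: "separating a" using separating_exists by blast
  obtain c where c: "\<forall>l. tensor_value l t = (\<Sum>j<f. c j * emb S l a ^ j)"
    "\<forall>x. tensor_act D t x = (\<Sum>j<f. sF D (c j) (sK D (a ^ j) x))"
    using tensor_power_basis[OF a, of t] by blast
  obtain c' where c': "\<forall>l. tensor_value l u = (\<Sum>j<f. c' j * emb S l a ^ j)"
    "\<forall>x. tensor_act D u x = (\<Sum>j<f. sF D (c' j) (sK D (a ^ j) x))"
    using tensor_power_basis[OF a, of u] by blast
  have "(\<Sum>j<f. (c j - c' j) * emb S l a ^ j) = 0" if "l < f" for l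
    using assms[OF that] c(1) c'(1) by (simp add: left_diff_distrib sum_subtractf)
  hence "c j - c' j = 0" if "j < f" for j by (rule zero_if_vanishes_on_conjugates[OF a _ that])
  thus ?thesis by (simp add: c(2) c'(2))
qed

definition eigenspace :: "nat \<Rightarrow> 'v set" where
  "eigenspace i = {x. \<forall>b. sK D b x = sF D (emb S i b) x}"

lemma sK_eigenspace: "x \<in> eigenspace i \<Longrightarrow> sK D b x = sF D (emb S i b) x"
  by (simp add: eigenspace_def)

lemma subspace_eigenspace: "V.subspace (eigenspace i)"
  by (rule V.subspaceI)
    (auto simp: eigenspace_def V.scale_right_distrib KD.scale_right_distrib sF_sK[symmetric]
      V.scale_left_commute)

lemma tensor_act_eigenspace:
  assumes "x \<in> eigenspace l"
  shows "tensor_act D t x = sF D (tensor_value l t) x"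
  by (induction t) (auto simp: V.scale_left_distrib sK_eigenspace[OF assms])

abbreviation proj :: "nat \<Rightarrow> 'v \<Rightarrow> 'v" where "proj i \<equiv> tensor_act D (idem S i)"

sublocale proj: Vector_Spaces.linear "sF D" "sF D" "proj i" for i
  by unfold_locales (simp_all add: tensor_act_add tensor_act_sF)

lemma proj_eigenspace: "i < f \<Longrightarrow> l < f \<Longrightarrow> x \<in> eigenspace l \<Longrightarrow> proj i x = (if l = i then x else 0)"
  by (simp add: tensor_act_eigenspace idem_spec)

lemma proj_in_eigenspace:
  assumes "i < f"
  shows "proj i x \<in> eigenspace i"
  unfolding eigenspace_def
proof (intro CollectI allI)
  fix b
  let ?t = "map (\<lambda>(u, y). (u, b * y)) (idem S i)"
    and ?u = "map (\<lambda>(u, y). (emb S i b * u, y)) (idem S i)"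
  have "tensor_value l (map (\<lambda>(u, y). (u, b * y)) t) = emb S l b * tensor_value l t"
    "tensor_value l (map (\<lambda>(u, y). (emb S i b * u, y)) t) = emb S i b * tensor_value l t" for l t
    by (induction t) (auto simp: emb.hom_mult algebra_simps)
  hence "tensor_act D ?t x = tensor_act D ?u x"
    using assms by (intro tensor_act_cong) (simp add: idem_spec)
  moreover have "tensor_act D (map (\<lambda>(u, y). (u, b * y)) t) x = sK D b (tensor_act D t x)"
    "tensor_act D (map (\<lambda>(u, y). (emb S i b * u, y)) t) x = sF D (emb S i b) (tensor_act D t x)" for t
    by (induction t) (auto simp: V.scale_right_distrib KD.scale_right_distrib sF_sK)
  ultimately show "sK D b (proj i x) = sF D (emb S i b) (proj i x)" by simp
qed

lemma sum_proj: "(\<Sum>i<f. proj i x) = x"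
proof -
  have "tensor_act D (concat (map (idem S) [0..<f])) x = tensor_act D [(1, 1)] x"
  proof (rule tensor_act_cong)
    fix l assume l: "l < f"
    have "tensor_value l (concat (map (idem S) [0..<n])) = (if l < n then 1 else 0)" if "n \<le> f" for n
      using that l by (induction n) (auto simp: idem_spec)
    thus "tensor_value l (concat (map (idem S) [0..<f])) = tensor_value l [(1, 1)]" using l by simp
  qed
  moreover have "tensor_act D (concat (map (idem S) [0..<n])) x = (\<Sum>i<n. proj i x)" for n
    by (induction n) (auto simp: tensor_act_append)
  ultimately show ?thesis by simp
qed

lemma component_eq:
  assumes "submod D (ringF S) (ringK S) M" and i: "i < f"
  shows "component S D i M = M \<inter> eigenspace i"
proof -
  have "proj i x \<in> M" if "x \<in> M" for x
    using tensor_act_mem[OF assms(1) idem_spec(1)[OF i] that] .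
  moreover have "proj i x = x" if "x \<in> eigenspace i" for x
    using proj_eigenspace[OF i i that] by simp
  ultimately show ?thesis using proj_in_eigenspace[OF i]
    unfolding component_def by (auto intro: image_eqI[OF sym])
qed

lemma component_Fil: "i < f \<Longrightarrow> component S D i (Fil D j) = Fil D j \<inter> eigenspace i"
  by (rule component_eq[OF submod_ring_Fil])

lemma phi_eigenspace:
  assumes "i < f" "x \<in> eigenspace (prev S i)"
  shows "phi D x \<in> eigenspace i"
  unfolding eigenspace_def
proof (intro CollectI allI)
  fix b
  have frob: "frob S (frob_inv b) = b" using frob.bij by (simp add: bij_is_surj surj_f_inv_f)
  have "sK D b (phi D x) = phi D (sK D (frob_inv b) x)" by (simp add: phi_sK frob)
  also have "\<dots> = sF D (emb S (prev S i) (frob_inv b)) (phi D x)"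
    by (simp add: sK_eigenspace[OF assms(2)] phi.scale)
  also have "emb S (prev S i) (frob_inv b) = emb S i b"
    using emb_frob[OF assms(1), of "frob_inv b"] by (simp add: frob)
  finally show "sK D b (phi D x) = sF D (emb S i b) (phi D x)" .
qed

lemma proj_phi:
  assumes "i < f"
  shows "proj i (phi D x) = phi D (proj (prev S i) x)"
proof -
  have "phi D x = (\<Sum>j<f. phi D (proj j x))"
    by (subst sum_proj[symmetric, of x]) (simp add: phi.sum)
  also have "\<dots> = (\<Sum>j<f. phi D (proj (prev S j) x))"
    using sum.reindex_bij_betw[OF bij_betw_prev, of "\<lambda>j. phi D (proj j x)"] by simp
  finally have "proj i (phi D x) = (\<Sum>j<f. proj i (phi D (proj (prev S j) x)))"
    by (simp add: proj.sum)
  also have "\<dots> = (\<Sum>j<f. if j = i then phi D (proj (prev S j) x) else 0)"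
    using assms
    by (intro sum.cong refl proj_eigenspace phi_eigenspace proj_in_eigenspace prev_less) auto
  finally show ?thesis using assms by simp
qed

lemma is_basis_ring_iff:
  "is_basis D (ringF S) M n b \<longleftrightarrow> V.indep_family n b \<and> M = V.integral_span n b"
proof -
  have ringF: "c ` {..<n} \<subseteq> ringF S \<longleftrightarrow> (\<forall>l<n. absF S (c l) \<le> 1)" for c by (auto simp: ringF_def)
  have "V.indep_family n b \<longleftrightarrow>
      (\<forall>c. (\<forall>l<n. absF S (c l) \<le> 1) \<longrightarrow> (\<Sum>l<n. sF D (c l) (b l)) = 0 \<longrightarrow> (\<forall>l<n. c l = 0))"
    using V.indep_family_if_integral[of n b] by (metis V.indep_family_def)
  thus ?thesis unfolding is_basis_def ringF V.integral_span_def by blast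
qed

lemma is_basis_UNIV_iff: "is_basis D UNIV W n b \<longleftrightarrow> V.indep_family n b \<and> W = V.span (b ` {..<n})"
  unfolding is_basis_def V.indep_family_def V.span_family by auto

end

section \<open>Lattices adapted to the filtration\<close>

lemma sum_jumps:
  "(\<Sum>j | jump_count n h j \<noteq> jump_count n h (j + 1).
      j * (int (jump_count n h j) - int (jump_count n h (j + 1)))) = (\<Sum>m<n. h m)"
proof -
  define J where "J j = {m \<in> {..<n}. h m = j}" for j
  have step: "jump_count n h j = card (J j) + jump_count n h (j + 1)" for j
    using jump_count_Suc[of n h j] by (simp add: J_def)
  have "jump_count n h j \<noteq> jump_count n h (j + 1) \<longleftrightarrow> J j \<noteq> {}" for j
    using step[of j] by (simp add: J_def)
  moreover have "J j \<noteq> {} \<longleftrightarrow> j \<in> h ` {..<n}" for j unfolding J_def by blast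
  ultimately have "{j. jump_count n h j \<noteq> jump_count n h (j + 1)} = h ` {..<n}" by blast
  moreover have "j * (int (jump_count n h j) - int (jump_count n h (j + 1))) = (\<Sum>m\<in>J j. h m)" for j
  proof -
    have "(\<Sum>m\<in>J j. h m) = (\<Sum>m\<in>J j. j)" by (rule sum.cong) (simp_all add: J_def)
    thus ?thesis using step[of j] by simp
  qed
  moreover have "(\<Sum>m<n. h m) = (\<Sum>j\<in>h ` {..<n}. \<Sum>m\<in>J j. h m)"
    unfolding J_def by (rule sum.image_gen) simp
  ultimately show ?thesis by simp
qed

locale filtered_lattice = phi_module S D
  for S :: "('q::field_char_0, 'a::field, 'k::field) coeff_data"
    and D :: "('a, 'k, 'v::ab_group_add) fil_phi_module" +
  fixes L :: "'v set"
  assumes lattice: "\<exists>N g. L = V.integral_span N g \<and> V.span (g ` {..<N}) = UNIV"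
begin

lemma integral_submodule_L: "V.integral_submodule L"
  using lattice V.integral_submodule_integral_span by blast

lemma span_L_Int:
  assumes "V.subspace W"
  shows "V.span (L \<inter> W) = W"
proof -
  have "V.span L = UNIV" using lattice V.span_integral_span by blast
  thus ?thesis using V.span_Int_subspace[OF integral_submodule_L assms] by simp
qed

definition adapted :: "nat \<Rightarrow> (nat \<Rightarrow> int) \<Rightarrow> 'v set \<Rightarrow> (nat \<Rightarrow> 'v) \<Rightarrow> bool" where
  "adapted n h W e \<longleftrightarrow> V.indep_family n e \<and> L \<inter> W = V.integral_span n e \<and>
    (\<forall>j. Fil D j \<inter> (L \<inter> W) = V.integral_span (jump_count n h j) e)"

lemma adaptedD:
  assumes "adapted n h W e"
  shows "V.indep_family n e" "L \<inter> W = V.integral_span n e"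
    "Fil D j \<inter> (L \<inter> W) = V.integral_span (jump_count n h j) e"
  using assms by (auto simp: adapted_def)

lemma subspace_Fil_Int: "V.subspace W \<Longrightarrow> V.subspace (Fil D j \<inter> W)"
  by (rule V.subspace_inter[OF subspace_Fil])

lemma jump_function_exists:
  assumes W: "V.subspace W"
  shows "\<exists>h. antimono_on {..<V.dim W} h \<and> (\<forall>j. V.dim (Fil D j \<inter> W) = jump_count (V.dim W) h j)"
proof -
  obtain b b' where b: "Fil D b = UNIV" and b': "Fil D b' = {0}" using Fil_UNIV Fil_0 by blast
  show ?thesis
  proof (rule antimono_eq_jump_count)
    show "antimono (\<lambda>j. V.dim (Fil D j \<inter> W))"
      using Fil_mono by (intro antimonoI V.dim_subset) blast
    show "V.dim (Fil D j \<inter> W) = V.dim W" if "j \<le> b" for j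
    proof -
      have "Fil D j = UNIV" using Fil_mono[OF that] b by blast
      thus ?thesis by simp
    qed
    show "V.dim (Fil D j \<inter> W) = 0" if "b' \<le> j" for j
    proof -
      have "Fil D j \<inter> W \<subseteq> {0}" using Fil_mono[OF that] b' by blast
      thus ?thesis by (simp add: V.dim_eq_0)
    qed
  qed
qed

lemma adapted_exists:
  assumes W: "V.subspace W" and h: "\<forall>j. V.dim (Fil D j \<inter> W) = jump_count (V.dim W) h j"
  shows "\<exists>e. adapted (V.dim W) h W e"
proof -
  obtain N g where g: "L = V.integral_span N g" "V.span (g ` {..<N}) = UNIV" using lattice by blast
  define C where "C = insert W (range (\<lambda>j. Fil D j \<inter> W))"
  have "\<forall>U\<in>C. V.subspace U \<and> U \<subseteq> V.span (g ` {..<N})"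
    using W subspace_Fil_Int[OF W] by (auto simp: C_def g(2))
  moreover have "Fil D j \<inter> W \<subseteq> Fil D j' \<inter> W \<or> Fil D j' \<inter> W \<subseteq> Fil D j \<inter> W" for j j'
    using Fil_mono[of j j'] Fil_mono[of j' j] by (cases "j \<le> j'") auto
  hence "chain_subset C" unfolding chain_subset_def C_def by blast
  ultimately obtain e where e: "V.indep_family (V.dim UNIV) e"
      "\<forall>U\<in>C. L \<inter> U = V.integral_span (V.dim U) e"
    using V.integral_basis_adapted_to_chain[of g N _ C] unfolding g by blast
  have "V.indep_family (V.dim W) e" using V.indep_family_mono[OF e(1)] V.dim_subset by blast
  moreover have "Fil D j \<inter> (L \<inter> W) = L \<inter> (Fil D j \<inter> W)" for j by blast
  ultimately show ?thesis using e(2) h unfolding adapted_def C_def by auto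
qed

context
  fixes n :: nat and h :: "nat \<Rightarrow> int" and W :: "'v set" and e :: "nat \<Rightarrow> 'v"
  assumes adapted: "adapted n h W e" and W: "V.subspace W"
begin

lemma span_adapted: "V.span (e ` {..<n}) = W"
  using span_L_Int[OF W] adaptedD(2)[OF adapted] V.span_integral_span by simp

lemma span_adapted_Fil: "V.span (e ` {..<jump_count n h j}) = Fil D j \<inter> W"
proof -
  have "L \<inter> (Fil D j \<inter> W) = V.integral_span (jump_count n h j) e"
    using adaptedD(3)[OF adapted] by blast
  thus ?thesis using span_L_Int[OF subspace_Fil_Int[OF W]] V.span_integral_span by metis
qed

lemma dim_Fil_adapted: "V.dim (Fil D j \<inter> W) = jump_count n h j"
proof -
  have "V.indep_family (jump_count n h j) e"
    using V.indep_family_mono[OF adaptedD(1)[OF adapted] jump_count_le] .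
  thus ?thesis unfolding span_adapted_Fil[symmetric] V.dim_span by (simp add: V.indep_family_iff_dim)
qed

lemma hodge_number_adapted: "hodge_number D W = (\<Sum>m<n. h m)"
proof -
  have "Fil D j \<inter> W = Fil D (j + 1) \<inter> W \<longleftrightarrow> jump_count n h j = jump_count n h (j + 1)" for j
    using span_adapted_Fil[of j] span_adapted_Fil[of "j + 1"]
      dim_Fil_adapted[of j] dim_Fil_adapted[of "j + 1"] by metis
  thus ?thesis unfolding hodge_number_def dim_Fil_adapted sum_jumps[of n h, symmetric] by simp
qed

end

end

section \<open>Divided images under Frobenius\<close>

context phi_module
begin

lemma scale_p_add_index: "scale_p S D i (scale_p S D j x) = scale_p S D (i + j) x"
  using of_nat_p_nonzero by (simp add: scale_p_def power_int_add)

lemma scale_p_0 [simp]: "scale_p S D 0 x = x"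
  by (simp add: scale_p_def)

lemma scale_p_subspace: "V.subspace W \<Longrightarrow> x \<in> W \<Longrightarrow> scale_p S D j x \<in> W"
  by (simp add: scale_p_def V.subspace_scale)

lemma row_mult_Delta:
  assumes "T \<in> carrier_mat n n" "m < n"
  shows "V.row_mult n e (T * Delta S n h) m = scale_p S D (h m) (V.row_mult n e T m)"
  using assms by (simp add: V.row_mult_def scale_p_def V.scale_sum_right mult_Delta_index mult.commute)

definition divided_image :: "'v set \<Rightarrow> 'v set" where
  "divided_image M = {(\<Sum>j\<in>J. scale_p S D (- j) (phi D (x j))) | J x.
    finite J \<and> (\<forall>j\<in>J. x j \<in> Fil D j \<inter> M)}"

lemma divided_image_base: "x \<in> Fil D j \<inter> M \<Longrightarrow> scale_p S D (- j) (phi D x) \<in> divided_image M"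
  unfolding divided_image_def by (intro CollectI exI[of _ "{j}"] exI[of _ "\<lambda>_. x"]) simp

lemma divided_image_minimal:
  assumes "V.integral_submodule N" "\<And>j x. x \<in> Fil D j \<inter> M \<Longrightarrow> scale_p S D (- j) (phi D x) \<in> N"
  shows "divided_image M \<subseteq> N"
  using assms(2) by (auto simp: divided_image_def intro!: V.integral_submodule_sum[OF assms(1)])

lemma divided_image_mono: "M \<subseteq> N \<Longrightarrow> divided_image M \<subseteq> divided_image N"
  unfolding divided_image_def by blast

lemma divided_image_finite_support:
  assumes "y \<in> divided_image M" "0 \<in> M"
  shows "\<exists>J x. finite J \<and> (\<forall>j. x j \<in> Fil D j \<inter> M) \<and>
    (\<forall>K. finite K \<and> J \<subseteq> K \<longrightarrow> y = (\<Sum>j\<in>K. scale_p S D (- j) (phi D (x j))))"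
proof -
  obtain J x where J: "finite J" "\<forall>j\<in>J. x j \<in> Fil D j \<inter> M"
    and y: "y = (\<Sum>j\<in>J. scale_p S D (- j) (phi D (x j)))"
    using assms(1) unfolding divided_image_def by blast
  define x' where "x' j = (if j \<in> J then x j else 0)" for j
  have "x' j \<in> Fil D j \<inter> M" for j
    using J(2) assms(2) V.subspace_0[OF subspace_Fil] by (simp add: x'_def)
  moreover have "y = (\<Sum>j\<in>K. scale_p S D (- j) (phi D (x' j)))" if K: "finite K" "J \<subseteq> K" for K
    unfolding y
    by (rule sum.mono_neutral_cong_left[OF K]) (simp_all add: x'_def scale_p_def phi.zero)
  ultimately show ?thesis using J(1) by blast
qed

lemma divided_imageI:
  assumes "finite J" "\<And>j. j \<in> J \<Longrightarrow> x j \<in> Fil D j \<inter> M"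
  shows "(\<Sum>j\<in>J. scale_p S D (- j) (phi D (x j))) \<in> divided_image M"
  using assms unfolding divided_image_def by blast

lemma integral_submodule_divided_image:
  assumes M: "V.integral_submodule M"
  shows "V.integral_submodule (divided_image M)"
  unfolding V.integral_submodule_def
proof (intro conjI ballI allI impI)
  note M0 = V.integral_submodule_zero[OF M]
  have FilM: "V.integral_submodule (Fil D j \<inter> M)" for j
    by (rule V.integral_submodule_Int[OF V.integral_submodule_subspace[OF subspace_Fil] M])
  show "0 \<in> divided_image M"
    unfolding divided_image_def by (intro CollectI exI[of _ "{}"]) simp
  fix y assume "y \<in> divided_image M"
  from divided_image_finite_support[OF this M0] obtain J x where J: "finite J"
    and x: "\<forall>j. x j \<in> Fil D j \<inter> M"
    and y: "\<forall>K. finite K \<and> J \<subseteq> K \<longrightarrow> y = (\<Sum>j\<in>K. scale_p S D (- j) (phi D (x j)))"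
    by iprover
  show "y + z \<in> divided_image M" if "z \<in> divided_image M" for z
  proof -
    from divided_image_finite_support[OF that M0] obtain J' x' where J': "finite J'"
      and x': "\<forall>j. x' j \<in> Fil D j \<inter> M"
      and z: "\<forall>K. finite K \<and> J' \<subseteq> K \<longrightarrow> z = (\<Sum>j\<in>K. scale_p S D (- j) (phi D (x' j)))"
      by iprover
    have "y + z = (\<Sum>j\<in>J \<union> J'. scale_p S D (- j) (phi D (x j + x' j)))"
      using y[rule_format, of "J \<union> J'"] z[rule_format, of "J \<union> J'"] J J'
      by (simp add: phi.add scale_p_def V.scale_right_distrib sum.distrib)
    also have "\<dots> \<in> divided_image M"
      using J J' x x' by (intro divided_imageI V.integral_submodule_add[OF FilM]) auto
    finally show ?thesis .
  qed
  show "sF D a y \<in> divided_image M" if "absF S a \<le> 1" for a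
  proof -
    have "y = (\<Sum>j\<in>J. scale_p S D (- j) (phi D (x j)))" using y J by blast
    hence "sF D a y = (\<Sum>j\<in>J. scale_p S D (- j) (phi D (sF D a (x j))))"
      by (simp add: V.scale_sum_right phi.scale scale_p_def mult.commute)
    also have "\<dots> \<in> divided_image M"
      by (rule divided_imageI[OF J V.integral_submodule_scale[OF FilM that x[rule_format]]])
    finally show ?thesis .
  qed
qed

lemma strongly_divisible_iff:
  "strongly_divisible S D L \<longleftrightarrow> weakly_admissible S D \<and> phi_lattice S D L \<and> divided_image L = L"
proof -
  have eq: "{(\<Sum>j\<in>J. scale_p S D (- j) (phi D (x j))) | J x. finite J \<and> (\<forall>j\<in>J. x j \<in> FilL D L j)}
      = divided_image L" by (simp add: divided_image_def FilL_def)
  have "phi D x \<in> scale_p S D j ` L" if "divided_image L = L" "x \<in> FilL D L j" for x j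
  proof (rule image_eqI)
    show "scale_p S D (- j) (phi D x) \<in> L"
      using divided_image_base[of x j L] that by (simp add: FilL_def)
  qed (simp add: scale_p_add_index)
  thus ?thesis unfolding strongly_divisible_def eq by blast
qed

end

context filtered_lattice
begin

lemma divided_image_adapted:
  assumes h: "antimono_on {..<n} h" and e: "adapted n h W e" and W: "V.subspace W"
  shows "divided_image (L \<inter> W) = V.integral_span n (\<lambda>m. scale_p S D (- h m) (phi D (e m)))"
    (is "_ = ?R")
proof
  have LW: "V.integral_submodule (L \<inter> W)"
    by (rule V.integral_submodule_Int[OF integral_submodule_L V.integral_submodule_subspace[OF W]])
  show "?R \<subseteq> divided_image (L \<inter> W)"
  proof (rule V.integral_span_minimal[OF integral_submodule_divided_image[OF LW]])
    fix m assume "m < n"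
    hence "e m \<in> V.integral_span (jump_count n h (h m)) e"
      using less_jump_count_iff[OF h] by (intro V.integral_span_base) simp
    thus "scale_p S D (- h m) (phi D (e m)) \<in> divided_image (L \<inter> W)"
      unfolding adaptedD(3)[OF e, symmetric] by (rule divided_image_base)
  qed
  note R = V.integral_submodule_integral_span[of n "\<lambda>m. scale_p S D (- h m) (phi D (e m))"]
  show "divided_image (L \<inter> W) \<subseteq> ?R"
  proof (rule divided_image_minimal[OF R])
    fix j x assume "x \<in> Fil D j \<inter> (L \<inter> W)"
    hence x: "x \<in> V.integral_span (jump_count n h j) e" unfolding adaptedD(3)[OF e] .
    have "V.integral_span (jump_count n h j) e \<subseteq> {x. scale_p S D (- j) (phi D x) \<in> ?R}"
    proof (rule V.integral_span_minimal)
      show "V.integral_submodule {x. scale_p S D (- j) (phi D x) \<in> ?R}"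
        by (rule V.integral_submodule_vimage[OF R])
          (simp_all add: scale_p_def phi.add phi.scale V.scale_right_distrib mult.commute)
      fix m assume "m < jump_count n h j"
      hence m: "m < n" "j \<le> h m" using less_jump_count_iff[OF h] by auto
      have "scale_p S D (h m - j) (scale_p S D (- h m) (phi D (e m))) \<in> ?R"
        unfolding scale_p_def[of _ _ "h m - j"] using p_powi_integral[of "h m - j"] m
        by (intro V.integral_submodule_scale[OF R] V.integral_span_base) auto
      thus "e m \<in> {x. scale_p S D (- j) (phi D x) \<in> ?R}"
        by (simp add: scale_p_add_index)
    qed
    thus "scale_p S D (- j) (phi D x) \<in> ?R" using x by blast
  qed
qed

context
  fixes n :: nat and h h' :: "nat \<Rightarrow> int" and W W' :: "'v set" and e e' :: "nat \<Rightarrow> 'v"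
  assumes h: "antimono_on {..<n} h" and e: "adapted n h W e" and W: "V.subspace W"
    and e': "adapted n h' W' e'"
begin

lemma frobenius_matrix_exists:
  assumes "divided_image (L \<inter> W) \<subseteq> W'" "divided_image (L \<inter> W) \<subseteq> L"
  shows "\<exists>T. F.integral_mat n T \<and> (\<forall>m<n. phi D (e m) = V.row_mult n e' (T * Delta S n h) m)"
proof -
  let ?x = "\<lambda>m. scale_p S D (- h m) (phi D (e m))"
  have "V.integral_span n ?x \<subseteq> V.integral_span n e'"
    using assms unfolding divided_image_adapted[OF h e W] adaptedD(2)[OF e', symmetric] by blast
  hence "n \<le> n \<and> ?x m \<in> V.integral_span n e'" if "m < n" for m
    using V.integral_span_base[OF that, of ?x] by blast
  then obtain T where T: "F.integral_mat n T" "\<forall>m<n. ?x m = V.row_mult n e' T m"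
    using V.integral_transition_matrix[of n "\<lambda>_. n" ?x e'] by blast
  have "phi D (e m) = V.row_mult n e' (T * Delta S n h) m" if "m < n" for m
    using scale_p_add_index[of "h m" "- h m" "phi D (e m)"] T(2) that
    by (simp add: row_mult_Delta[OF F.integral_mat_carrier[OF T(1)] that])
  thus ?thesis using T(1) by blast
qed

lemma frobenius_matrix_GLO:
  assumes "divided_image (L \<inter> W) = L \<inter> W'" and T: "F.integral_mat n T"
    and phi_e: "\<forall>m<n. phi D (e m) = V.row_mult n e' (T * Delta S n h) m"
  shows "T \<in> GLO S n"
proof -
  note carrier = F.integral_mat_carrier[OF T]
  have "scale_p S D (- h m) (phi D (e m)) = V.row_mult n e' T m" if "m < n" for m
    using phi_e that by (simp add: row_mult_Delta[OF carrier] scale_p_add_index)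
  hence "V.integral_span n e' = V.integral_span n (V.row_mult n e' T)"
    using assms(1) unfolding divided_image_adapted[OF h e W] adaptedD(2)[OF e']
    by (simp cong: V.integral_span_cong)
  hence "\<exists>U. F.integral_mat n U \<and> T * U = 1\<^sub>m n"
    using V.integral_right_inverse_if_span_subset[OF adaptedD(1)[OF e'] carrier] by blast
  thus ?thesis using T by (simp add: GLO_iff)
qed

end

end

section \<open>Weak admissibility\<close>

context phi_module
begin

lemma det_phi_eq:
  assumes b: "V.indep_family n b" and M: "M \<in> carrier_mat n n"
    and phi_b: "\<forall>m<n. phi D (b m) = V.row_mult n b M m"
  shows "det_phi D (V.span (b ` {..<n})) = det M"
  unfolding det_phi_def
proof (rule the_equality)
  show "\<exists>n' b' M'. is_basis D UNIV (V.span (b ` {..<n})) n' b' \<and> M' \<in> carrier_mat n' n' \<and>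
      (\<forall>m<n'. phi D (b' m) = (\<Sum>l<n'. sF D (M' $$ (l, m)) (b' l))) \<and> det M = det M'"
    using assms unfolding is_basis_UNIV_iff V.row_mult_def by blast
next
  fix \<delta> assume "\<exists>n' b' M'. is_basis D UNIV (V.span (b ` {..<n})) n' b' \<and> M' \<in> carrier_mat n' n' \<and>
      (\<forall>m<n'. phi D (b' m) = (\<Sum>l<n'. sF D (M' $$ (l, m)) (b' l))) \<and> \<delta> = det M'"
  then obtain n' b' M' where b': "V.indep_family n' b'" "V.span (b ` {..<n}) = V.span (b' ` {..<n'})"
    and M': "M' \<in> carrier_mat n' n'" "\<forall>m<n'. phi D (b' m) = V.row_mult n' b' M' m" "\<delta> = det M'"
    unfolding is_basis_UNIV_iff V.row_mult_def by blast
  have "n' = n"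
    using b b'(1) arg_cong[OF b'(2), of V.dim] unfolding V.indep_family_iff_dim V.dim_span by simp
  thus "\<delta> = det M"
    using V.det_basis_independent[OF phi_linear _ _ M _ _, of b' b M'] b' M' phi_b by simp
qed

lemma ordF_mult: "x \<noteq> 0 \<Longrightarrow> y \<noteq> 0 \<Longrightarrow> ordF S (x * y) = ordF S x + ordF S y"
  by (simp add: ordF_def F.mult log_mult)

lemma ordF_nonneg: "x \<noteq> 0 \<Longrightarrow> absF S x \<le> 1 \<Longrightarrow> 0 \<le> ordF S x"
  using Q.p_gt_1 by (simp add: ordF_def)

lemma ordF_p_powi: "ordF S (of_nat p powi j) = real_of_int j"
proof -
  have "absF S (of_nat p powi j) = real p powr (- real_of_int j)"
    unfolding F.powi abs_p using Q.p_gt_1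
    by (simp add: powr_minus powr_real_of_int' power_int_divide_distrib field_simps)
  thus ?thesis using Q.p_gt_1 by (simp add: ordF_def)
qed

lemma ordF_prod_p_powi: "ordF S (\<Prod>m<(n::nat). of_nat p powi h m) = real_of_int (\<Sum>m<n. h m)"
proof (induction n)
  case 0
  show ?case by (simp add: ordF_def)
next
  case (Suc n)
  thus ?case using of_nat_p_nonzero by (simp add: ordF_mult ordF_p_powi)
qed

end

locale divisible_lattice = filtered_lattice S D L
  for S :: "('q::field_char_0, 'a::field, 'k::field) coeff_data"
    and D :: "('a, 'k, 'v::ab_group_add) fil_phi_module" and L +
  assumes divided_image_L: "divided_image L = L"
begin

text \<open>\<open>T\<close> arises as the matrix of Frobenius, up to \<open>Diag(p\<^sup>h)\<close>, in an adapted basis of \<open>L \<inter> W\<close>.\<close>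

lemma newton_number_eq:
  assumes W: "V.subspace W" and stable: "phi D ` W \<subseteq> W"
  shows "\<exists>n T. F.integral_mat n T \<and> det T \<noteq> 0 \<and> (W = UNIV \<longrightarrow> T \<in> GLO S n) \<and>
    newton_number S D W = ordF S (det T) + real_of_int (hodge_number D W)"
proof -
  define n where "n = V.dim W"
  obtain h where h: "antimono_on {..<n} h" and dims: "\<forall>j. V.dim (Fil D j \<inter> W) = jump_count n h j"
    using jump_function_exists[OF W] unfolding n_def by blast
  obtain e where e: "adapted n h W e" using adapted_exists[OF W] dims unfolding n_def by blast
  note indep = adaptedD(1)[OF e]
  have "divided_image (L \<inter> W) \<subseteq> W"
    using stable
    by (intro divided_image_minimal V.integral_submodule_subspace[OF W] scale_p_subspace[OF W]) auto
  moreover have "divided_image (L \<inter> W) \<subseteq> divided_image L"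
    by (rule divided_image_mono) simp
  ultimately obtain T where T: "F.integral_mat n T"
    and phi_e: "\<forall>m<n. phi D (e m) = V.row_mult n e (T * Delta S n h) m"
    using frobenius_matrix_exists[OF h e W e] divided_image_L by blast
  have carrier: "T * Delta S n h \<in> carrier_mat n n"
    using F.integral_mat_carrier[OF T] by (rule mult_carrier_mat) simp
  have det: "det (T * Delta S n h) = det T * (\<Prod>m<n. of_nat p powi h m)"
    using F.integral_mat_carrier[OF T] by (simp add: det_mult[of _ n] Delta_def det_mat_diag)
  have "det (T * Delta S n h) \<noteq> 0"
    using bij_is_inj[OF bij_phi] phi_e
    by (intro V.det_nonzero_if_inj[OF phi_linear _ indep carrier]) auto
  hence nonzero: "det T \<noteq> 0" "(\<Prod>m<n. of_nat p powi h m) \<noteq> (0 :: 'a)" by (auto simp: det)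
  have "newton_number S D W = ordF S (det (T * Delta S n h))"
    unfolding newton_number_def
    using det_phi_eq[OF indep carrier phi_e] span_adapted[OF e W] by simp
  also have "\<dots> = ordF S (det T) + real_of_int (hodge_number D W)"
    using nonzero by (simp add: det ordF_mult ordF_prod_p_powi hodge_number_adapted[OF e W])
  finally have "newton_number S D W = ordF S (det T) + real_of_int (hodge_number D W)" .
  moreover have "T \<in> GLO S n" if "W = UNIV"
    using that divided_image_L by (intro frobenius_matrix_GLO[OF h e W e _ T phi_e]) simp
  ultimately show ?thesis using T nonzero(1) by blast
qed

theorem weakly_admissible: "weakly_admissible S D"
  unfolding weakly_admissible_def
proof (intro conjI allI impI)
  show "filtered_phi_module S D" by (rule filtered_phi_module)
  obtain n T where T: "T \<in> GLO S n"
    "newton_number S D UNIV = ordF S (det T) + real_of_int (hodge_number D UNIV)"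
    using newton_number_eq[of UNIV] by auto
  have "ordF S (det T) = 0" using abs_det_GLO[OF T(1)] by (simp add: ordF_def)
  thus "real_of_int (hodge_number D UNIV) = newton_number S D UNIV" using T(2) by simp
next
  fix W assume "submod D UNIV UNIV W" and stable: "phi D ` W \<subseteq> W"
  hence W: "V.subspace W" by (simp add: submod_UNIV_iff)
  obtain n T where T: "F.integral_mat n T" "det T \<noteq> 0"
    "newton_number S D W = ordF S (det T) + real_of_int (hodge_number D W)"
    using newton_number_eq[OF W stable] by blast
  have "0 \<le> ordF S (det T)" using ordF_nonneg[OF T(2) F.det_integral[OF T(1)]] .
  thus "real_of_int (hodge_number D W) \<le> newton_number S D W" using T(3) by simp
qed

end

section \<open>Lattices with Hodge polygon data and their frames\<close>

context phi_module
begin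

lemma proj_mem: "submod D (ringF S) (ringK S) M \<Longrightarrow> i < f \<Longrightarrow> x \<in> M \<Longrightarrow> proj i x \<in> M"
  by (rule tensor_act_mem[OF _ idem_spec(1)])

lemma sK_eq_sum_proj: "sK D b x = (\<Sum>i<f. sF D (emb S i b) (proj i x))"
proof -
  have "sK D b x = (\<Sum>i<f. sK D b (proj i x))"
    by (subst sum_proj[symmetric, of x]) (rule KD.scale_sum_right)
  also have "\<dots> = (\<Sum>i<f. sF D (emb S i b) (proj i x))"
    by (rule sum.cong) (simp_all add: sK_eigenspace[OF proj_in_eigenspace])
  finally show ?thesis .
qed

lemma divided_image_Int_eigenspace:
  assumes M: "submod D (ringF S) (ringK S) M" and i: "i < f"
  shows "divided_image (M \<inter> eigenspace (prev S i)) = divided_image M \<inter> eigenspace i"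
proof (intro equalityI Int_greatest subsetI)
  fix y assume y: "y \<in> divided_image (M \<inter> eigenspace (prev S i))"
  thus "y \<in> divided_image M" using divided_image_mono[of "M \<inter> eigenspace (prev S i)" M] by blast
  have "divided_image (M \<inter> eigenspace (prev S i)) \<subseteq> eigenspace i"
    using phi_eigenspace[OF i]
    by (intro divided_image_minimal V.integral_submodule_subspace scale_p_subspace subspace_eigenspace) auto
  thus "y \<in> eigenspace i" using y by blast
next
  fix y assume y: "y \<in> divided_image M \<inter> eigenspace i"
  then obtain J x where J: "finite J" and x: "\<forall>j\<in>J. x j \<in> Fil D j \<inter> M"
    and y_eq: "y = (\<Sum>j\<in>J. scale_p S D (- j) (phi D (x j)))" unfolding divided_image_def by blast
  have "y = proj i y" using proj_eigenspace[OF i i] y by simp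
  also have "\<dots> = (\<Sum>j\<in>J. scale_p S D (- j) (phi D (proj (prev S i) (x j))))"
    by (simp add: y_eq proj.sum scale_p_def proj.scale proj_phi[OF i])
  finally have y_proj: "y = (\<Sum>j\<in>J. scale_p S D (- j) (phi D (proj (prev S i) (x j))))" .
  show "y \<in> divided_image (M \<inter> eigenspace (prev S i))"
    unfolding y_proj
    using x proj_mem[OF submod_ring_Fil prev_less] proj_mem[OF M prev_less]
      proj_in_eigenspace[OF prev_less] by (intro divided_imageI[OF J]) blast
qed

end

locale phi_lattice_module = phi_module S D
  for S :: "('q::field_char_0, 'a::field, 'k::field) coeff_data"
    and D :: "('a, 'k, 'v::ab_group_add) fil_phi_module" +
  fixes L :: "'v set"
  assumes phi_lattice: "phi_lattice S D L"
begin

lemma submod_L: "submod D (ringF S) (ringK S) L"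
  and span_submod_L: "submod D UNIV UNIV hull L = UNIV"
  using phi_lattice by (simp_all add: phi_lattice_def)

lemma span_L: "V.span L = UNIV"
proof -
  have "sK D b x \<in> V.span L" if "x \<in> V.span L" for b x
    using that
  proof (induction rule: V.span_induct)
    show "V.subspace {x. sK D b x \<in> V.span L}"
      by (rule V.subspaceI)
        (auto simp: KD.scale_right_distrib sF_sK[symmetric] intro: V.span_add V.span_scale V.span_zero)
    show "sK D b x \<in> V.span L" if "x \<in> L" for x
      unfolding sK_eq_sum_proj
      using proj_mem[OF submod_L _ that] by (intro V.span_sum V.span_scale V.span_base) auto
  qed
  hence "submod D UNIV UNIV (V.span L)" by (simp add: submod_UNIV_iff V.subspace_span)
  thus ?thesis using hull_minimal[of L "V.span L"] V.span_superset span_submod_L by blast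
qed

lemma lattice_eq_integral_hull:
  assumes B: "finite B" and L: "L = submod D (ringF S) (ringK S) hull B"
  shows "L = V.integral_submodule hull (\<Union>i<f. proj i ` B)"
proof
  let ?G = "\<Union>i<f. proj i ` B"
  let ?H = "V.integral_submodule hull ?G"
  have "finite ?G" using B by simp
  then obtain n e where "?H = V.integral_span n e" using V.finite_integral_hull by blast
  hence H: "V.integral_submodule ?H" using V.integral_submodule_integral_span by simp
  have G: "?G \<subseteq> ?H" by (rule hull_subset)
  have "?H \<subseteq> {x. sK D b x \<in> ?H}" if b: "b \<in> ringK S" for b
  proof (rule hull_minimal)
    show "?G \<subseteq> {x. sK D b x \<in> ?H}"
    proof
      fix x assume x: "x \<in> ?G"
      then obtain i where "i < f" "x \<in> eigenspace i" using proj_in_eigenspace by blast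
      thus "x \<in> {x. sK D b x \<in> ?H}"
        using V.integral_submodule_scale[OF H, of "emb S i b" x] G x b
        by (auto simp: sK_eigenspace abs_emb ringK_def)
    qed
    show "V.integral_submodule {x. sK D b x \<in> ?H}"
      by (rule V.integral_submodule_vimage[OF H]) (simp_all add: KD.scale_right_distrib sF_sK)
  qed
  hence "submod D (ringF S) (ringK S) ?H" using H unfolding submod_ring_iff by blast
  moreover have "x \<in> ?H" if "x \<in> B" for x
    using V.integral_submodule_sum[OF H, of "{..<f}" "\<lambda>i. proj i x"] G that by (auto simp: sum_proj)
  ultimately show "L \<subseteq> ?H" unfolding L by (intro hull_minimal) auto
  have "B \<subseteq> L" unfolding L by (rule hull_subset)
  hence "?G \<subseteq> L" using proj_mem[OF submod_L] by blast
  thus "?H \<subseteq> L" using submod_L unfolding submod_ring_iff by (intro hull_minimal) auto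
qed

sublocale filtered_lattice S D L
proof
  obtain B where B: "finite B" "L = submod D (ringF S) (ringK S) hull B"
    using phi_lattice unfolding phi_lattice_def by blast
  have "finite (\<Union>i<f. proj i ` B)" using B(1) by simp
  then obtain N g where g: "L = V.integral_span N g"
    using V.finite_integral_hull lattice_eq_integral_hull[OF B] by metis
  thus "\<exists>N g. L = V.integral_span N g \<and> V.span (g ` {..<N}) = UNIV"
    using span_L V.span_integral_span by metis
qed

end

context filtered_lattice
begin

lemma row_mult_parabolic_mem:
  assumes h: "antimono_on {..<n} h" and C: "C \<in> parabolic S n h" and m: "m < jump_count n h j"
  shows "V.row_mult n e C m \<in> V.integral_span (jump_count n h j) e"
proof -
  let ?r = "jump_count n h j"
  have "C $$ (l, m) = 0" if "l < n" "?r \<le> l" for l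
    using C m that less_jump_count_iff[OF h, of m j] less_jump_count_iff[OF h, of l j]
    unfolding parabolic_iff[OF h] by auto
  hence "V.row_mult n e C m = (\<Sum>l<?r. sF D (C $$ (l, m)) (e l))"
    unfolding V.row_mult_def using jump_count_le[of n h j] by (intro sum.mono_neutral_right) auto
  moreover have "absF S (C $$ (l, m)) \<le> 1" if "l < ?r" for l
    using GLO_integral[OF parabolic_GLO[OF C]] that m jump_count_le[of n h j]
    unfolding F.integral_mat_def by simp
  ultimately show ?thesis using V.integral_spanI by simp
qed

lemma integral_span_row_mult_parabolic:
  assumes h: "antimono_on {..<n} h" and C: "C \<in> parabolic S n h"
  shows "V.integral_span (jump_count n h j) (V.row_mult n e C) = V.integral_span (jump_count n h j) e"
proof
  let ?r = "jump_count n h j"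
  show "V.integral_span ?r (V.row_mult n e C) \<subseteq> V.integral_span ?r e"
    by (intro V.integral_span_minimal V.integral_submodule_integral_span row_mult_parabolic_mem[OF h C])
  note G = parabolic_GLO[OF C]
  have "e m = V.row_mult n (V.row_mult n e C) (minv C) m" if "m < ?r" for m
    using that jump_count_le[of n h j] GLO_carrier[OF G] GLO_carrier[OF GLO_minv(1)[OF G]]
      GLO_minv(2)[OF G]
    by (simp add: V.row_mult_assoc V.row_mult_one)
  thus "V.integral_span ?r e \<subseteq> V.integral_span ?r (V.row_mult n e C)"
    using row_mult_parabolic_mem[OF h parabolic_minv[OF h C], of _ j "V.row_mult n e C"]
    by (intro V.integral_span_minimal V.integral_submodule_integral_span) simp
qed

lemma adapted_row_mult:
  assumes h: "antimono_on {..<n} h" and e: "adapted n h W e" and C: "C \<in> parabolic S n h"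
  shows "adapted n h W (V.row_mult n e C)"
proof -
  note G = parabolic_GLO[OF C]
  have "V.indep_family n (V.row_mult n e C)"
    using V.indep_family_row_mult[OF adaptedD(1)[OF e] GLO_carrier[OF G]
        GLO_carrier[OF GLO_minv(1)[OF G]] GLO_minv(3)[OF G]] .
  moreover obtain j where "jump_count n h j = n" using jump_count_eventually_all by blast
  hence "V.integral_span n (V.row_mult n e C) = V.integral_span n e"
    using integral_span_row_mult_parabolic[OF h C, of j e] by simp
  ultimately show ?thesis
    using e unfolding adapted_def integral_span_row_mult_parabolic[OF h C] by metis
qed

lemma transition_integral:
  assumes h: "antimono_on {..<n} h" and e: "adapted n h W e" and e': "adapted n h W e'"
  shows "\<exists>T. F.integral_mat n T \<and> (\<forall>m<n. e' m = V.row_mult n e T m) \<and>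
    (\<forall>l<n. \<forall>m<n. h l < h m \<longrightarrow> T $$ (l, m) = 0)"
proof -
  have "jump_count n h (h m) \<le> n \<and> e' m \<in> V.integral_span (jump_count n h (h m)) e" if "m < n" for m
  proof -
    have "e' m \<in> V.integral_span (jump_count n h (h m)) e'"
      using that less_jump_count_iff[OF h] by (intro V.integral_span_base) simp
    thus ?thesis using adaptedD(3)[OF e] adaptedD(3)[OF e'] jump_count_le by simp
  qed
  then obtain T where "F.integral_mat n T" "\<forall>m<n. e' m = V.row_mult n e T m"
    "\<forall>l<n. \<forall>m<n. jump_count n h (h m) \<le> l \<longrightarrow> T $$ (l, m) = 0"
    using V.integral_transition_matrix[of n "\<lambda>m. jump_count n h (h m)" e' e] by blast
  moreover have "jump_count n h (h m) \<le> l" if "l < n" "h l < h m" for l m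
    using less_jump_count_iff[OF h, of l "h m"] that by linarith
  ultimately show ?thesis by blast
qed

lemma transition_parabolic:
  assumes h: "antimono_on {..<n} h" and e: "adapted n h W e" and e': "adapted n h W e'"
  shows "\<exists>C\<in>parabolic S n h. \<forall>m<n. e' m = V.row_mult n e C m"
proof -
  obtain T where T: "F.integral_mat n T" "\<forall>m<n. e' m = V.row_mult n e T m"
    "\<forall>l<n. \<forall>m<n. h l < h m \<longrightarrow> T $$ (l, m) = 0" using transition_integral[OF h e e'] by blast
  obtain U where U: "F.integral_mat n U" "\<forall>m<n. e m = V.row_mult n e' U m"
    using transition_integral[OF h e' e] by blast
  note carrier = F.integral_mat_carrier[OF T(1)] F.integral_mat_carrier[OF U(1)]
  have eq: "V.row_mult n e (T * U) m = V.row_mult n e (1\<^sub>m n) m" if m: "m < n" for m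
  proof -
    have "V.row_mult n e (T * U) m = V.row_mult n (V.row_mult n e T) U m"
      using V.row_mult_assoc[OF carrier m] by simp
    also have "\<dots> = V.row_mult n e' U m" using T(2) by (intro V.row_mult_cong) simp
    also have "\<dots> = e m" using U(2) m by simp
    finally show ?thesis using V.row_mult_one[OF m] by simp
  qed
  have "T * U = 1\<^sub>m n"
    by (rule V.row_mult_inj[OF adaptedD(1)[OF e] mult_carrier_mat[OF carrier] one_carrier_mat eq])
  hence "T \<in> GLO S n" unfolding GLO_iff using T(1) U(1) by (intro conjI exI)
  hence "T \<in> parabolic S n h" using T(3) unfolding parabolic_iff[OF h] ..
  thus ?thesis using T(2) ..
qed

end

locale hodge_lattice = hodge_type S d k + phi_lattice_module S D L
  for S :: "('q::field_char_0, 'a::field, 'k::field) coeff_data" and d k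
    and D :: "('a, 'k, 'v::ab_group_add) fil_phi_module" and L +
  assumes hodge_data: "has_hodge_data S d k D"
begin

lemma dim_Fil_eigenspace:
  assumes i: "i < f"
  shows "V.dim (Fil D j \<inter> eigenspace i) = jump_count d (k i) j"
proof -
  obtain b where b: "Fil D b = {0}" using Fil_0 by blast
  show ?thesis
  proof (rule eq_jump_count_if_differences)
    show "int (V.dim (Fil D j \<inter> eigenspace i)) - int (V.dim (Fil D (j + 1) \<inter> eigenspace i))
        = int (card {m. m < d \<and> k i m = j})" for j
      using hodge_data i unfolding has_hodge_data_def component_Fil[OF i, symmetric] by blast
    show "V.dim (Fil D j \<inter> eigenspace i) = 0" if "b \<le> j" for j
    proof -
      have "Fil D j \<inter> eigenspace i \<subseteq> {0}" using Fil_mono[OF that] b by blast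
      thus ?thesis by (simp add: V.dim_eq_0)
    qed
  qed
qed

lemma dim_eigenspace:
  assumes i: "i < f"
  shows "V.dim (eigenspace i) = d"
proof -
  obtain b b' where b: "Fil D b = UNIV" and b': "\<forall>j\<le>b'. jump_count d (k i) j = d"
    using Fil_UNIV jump_count_eventually_all by metis
  have "Fil D (min b b') = UNIV" using Fil_mono[of "min b b'" b] b by auto
  thus ?thesis using dim_Fil_eigenspace[OF i, of "min b b'"] b' by simp
qed

lemma submod_FilL: "submod D (ringF S) (ringK S) (FilL D L j)"
  using submod_L submod_ring_Fil
  unfolding submod_ring_iff FilL_def by (auto intro: V.integral_submodule_Int)

lemma adapted_basis_iff:
  assumes i: "i < f"
  shows "adapted_basis S d D L i e \<longleftrightarrow> adapted d (k i) (eigenspace i) e"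
proof -
  have FilL: "component S D i (FilL D L j) = Fil D j \<inter> (L \<inter> eigenspace i)" for j
    using component_eq[OF submod_FilL i] by (auto simp: FilL_def)
  have "V.dim (Fil D j \<inter> (L \<inter> eigenspace i)) = V.dim (Fil D j \<inter> eigenspace i)" for j
    using span_L_Int[OF subspace_Fil_Int[OF subspace_eigenspace], of j i]
    by (metis V.dim_span inf.left_commute)
  hence "V.dim (component S D i (FilL D L j)) = jump_count d (k i) j" for j
    by (simp add: FilL dim_Fil_eigenspace[OF i])
  thus ?thesis
    unfolding adapted_basis_def is_basis_ring_iff adapted_def component_eq[OF submod_L i] FilL
    using V.indep_family_mono[OF _ jump_count_le] by metis
qed

definition frame :: "(nat \<Rightarrow> 'a mat) \<Rightarrow> (nat \<Rightarrow> nat \<Rightarrow> 'v) \<Rightarrow> bool" where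
  "frame A e \<longleftrightarrow> (\<forall>i<f. adapted d (k i) (eigenspace i) (e i)) \<and>
    (\<forall>i<f. \<forall>m<d. phi D (e (prev S i) m) = V.row_mult d (e i) (A i * \<Delta> i) m)"

lemma presented_by_iff: "presented_by S d k A (D, L) \<longleftrightarrow> (\<exists>e. frame A e)"
  by (simp add: presented_by_def frame_def adapted_basis_iff V.row_mult_def)

lemma frameD:
  assumes "frame A e" "i < f"
  shows "adapted d (k i) (eigenspace i) (e i)"
    and "m < d \<Longrightarrow> phi D (e (prev S i) m) = V.row_mult d (e i) (A i * \<Delta> i) m"
  using assms by (auto simp: frame_def)

lemma phi_row_mult_frame:
  assumes e: "frame A e" and A: "A \<in> GLO_tuples S d" and i: "i < f"
    and C: "C \<in> carrier_mat d d" and m: "m < d"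
  shows "phi D (V.row_mult d (e (prev S i)) C m) = V.row_mult d (e i) (A i * \<Delta> i * C) m"
proof -
  have "phi D (V.row_mult d (e (prev S i)) C m) = V.row_mult d (\<lambda>l. phi D (e (prev S i) l)) C m"
    by (rule V.linear_row_mult[OF phi_linear])
  also have "\<dots> = V.row_mult d (V.row_mult d (e i) (A i * \<Delta> i)) C m"
    using frameD(2)[OF e i] by (intro V.row_mult_cong)
  also have "\<dots> = V.row_mult d (e i) (A i * \<Delta> i * C) m"
    by (rule V.row_mult_assoc[OF frobenius_matrix_carrier[OF A i] C m])
  finally show ?thesis .
qed

lemma frame_change:
  assumes e: "frame A e" and A: "A \<in> GLO_tuples S d" and B: "B \<in> GLO_tuples S d"
    and C: "intertwiner C B A"
  shows "frame B (\<lambda>i. V.row_mult d (e i) (C i))"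
  unfolding frame_def
proof (intro conjI allI impI)
  fix i assume i: "i < f"
  note Ci = intertwinerD[OF C i]
  show "adapted d (k i) (eigenspace i) (V.row_mult d (e i) (C i))"
    by (rule adapted_row_mult[OF decreasing[OF i] frameD(1)[OF e i] Ci(1)])
  fix m assume m: "m < d"
  have "phi D (V.row_mult d (e (prev S i)) (C (prev S i)) m) = V.row_mult d (e i) (C i * (B i * \<Delta> i)) m"
    unfolding phi_row_mult_frame[OF e A i GLO_carrier[OF Ci(4)] m] Ci(2) ..
  thus "phi D (V.row_mult d (e (prev S i)) (C (prev S i)) m)
      = V.row_mult d (V.row_mult d (e i) (C i)) (B i * \<Delta> i) m"
    using V.row_mult_assoc[OF GLO_carrier[OF Ci(3)] frobenius_matrix_carrier[OF B i] m] by simp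
qed

lemma frames_intertwined:
  assumes e: "frame A e" and e': "frame B e'"
    and A: "A \<in> GLO_tuples S d" and B: "B \<in> GLO_tuples S d"
  shows "\<exists>C. intertwiner C B A"
proof -
  have "\<exists>C\<in>parabolic S d (k i). \<forall>m<d. e' i m = V.row_mult d (e i) C m" if "i < f" for i
    by (rule transition_parabolic[OF decreasing[OF that] frameD(1)[OF e that] frameD(1)[OF e' that]])
  then obtain C where C: "\<And>i. i < f \<Longrightarrow> C i \<in> parabolic S d (k i)"
    and e'_eq: "\<And>i. i < f \<Longrightarrow> \<forall>m<d. e' i m = V.row_mult d (e i) (C i) m" by metis
  have carrier: "C i \<in> carrier_mat d d" if "i < f" for i
    by (rule GLO_carrier[OF parabolic_GLO[OF C[OF that]]])
  have "A i * \<Delta> i * C (prev S i) = C i * (B i * \<Delta> i)" if i: "i < f" for i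
  proof (rule V.row_mult_inj[OF adaptedD(1)[OF frameD(1)[OF e i]]])
    note Ai = frobenius_matrix_carrier[OF A i] and Bi = frobenius_matrix_carrier[OF B i]
    show "A i * \<Delta> i * C (prev S i) \<in> carrier_mat d d" "C i * (B i * \<Delta> i) \<in> carrier_mat d d"
      by (rule mult_carrier_mat[OF Ai carrier[OF prev_less]], rule mult_carrier_mat[OF carrier[OF i] Bi])
    fix m assume m: "m < d"
    have "V.row_mult d (e i) (A i * \<Delta> i * C (prev S i)) m = phi D (e' (prev S i) m)"
      using phi_row_mult_frame[OF e A i carrier[OF prev_less] m] e'_eq[OF prev_less] m by simp
    also have "\<dots> = V.row_mult d (e' i) (B i * \<Delta> i) m" by (rule frameD(2)[OF e' i m])
    also have "\<dots> = V.row_mult d (V.row_mult d (e i) (C i)) (B i * \<Delta> i) m"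
      using e'_eq[OF i] by (intro V.row_mult_cong) simp
    also have "\<dots> = V.row_mult d (e i) (C i * (B i * \<Delta> i)) m"
      by (rule V.row_mult_assoc[OF carrier[OF i] Bi m])
    finally show "V.row_mult d (e i) (A i * \<Delta> i * C (prev S i)) m
      = V.row_mult d (e i) (C i * (B i * \<Delta> i)) m" .
  qed
  thus ?thesis using C unfolding intertwiner_def by blast
qed

theorem frame_exists:
  assumes divisible: "divided_image L = L"
  shows "\<exists>A\<in>GLO_tuples S d. \<exists>e. frame A e"
proof -
  have "\<forall>i<f. \<exists>e. adapted d (k i) (eigenspace i) e"
    using adapted_exists[OF subspace_eigenspace] dim_Fil_eigenspace dim_eigenspace by metis
  then obtain e where e: "\<forall>i<f. adapted d (k i) (eigenspace i) (e i)" by metis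
  have "\<exists>T\<in>GLO S d. \<forall>m<d. phi D (e (prev S i) m) = V.row_mult d (e i) (T * \<Delta> i) m" if i: "i < f" for i
  proof -
    note adapted = e[rule_format, OF prev_less[of i]] e[rule_format, OF i]
    note matrix = decreasing[OF prev_less] adapted(1) subspace_eigenspace adapted(2)
    have image: "divided_image (L \<inter> eigenspace (prev S i)) = L \<inter> eigenspace i"
      unfolding divided_image_Int_eigenspace[OF submod_L i] divisible ..
    obtain T where "F.integral_mat d T" "\<forall>m<d. phi D (e (prev S i) m) = V.row_mult d (e i) (T * \<Delta> i) m"
      using frobenius_matrix_exists[OF matrix] image by blast
    thus ?thesis using frobenius_matrix_GLO[OF matrix image] by blast
  qed
  then obtain A where A: "\<forall>i<f. A i \<in> GLO S d"
    "\<forall>i<f. \<forall>m<d. phi D (e (prev S i) m) = V.row_mult d (e i) (A i * \<Delta> i) m" by metis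
  have "frame (restrict A {..<f}) e" using e A(2) by (simp add: frame_def)
  moreover have "restrict A {..<f} \<in> GLO_tuples S d" using A(1) by (simp add: GLO_tuples_def)
  ultimately show ?thesis by blast
qed

end

section \<open>Coordinates with respect to a frame\<close>

locale coordinate_lattice =
  hodge_type S d k + V: grid_coordinates "sF D" "res_deg S" d e co
  for S :: "('q::field_char_0, 'a::field, 'k::field) coeff_data" and d k
    and D :: "('a, 'k, 'v::ab_group_add) fil_phi_module" and e co +
  fixes L :: "'v set" and A :: "nat \<Rightarrow> 'a mat"
  assumes GLO: "A \<in> GLO_tuples S d"
    and co_sK: "i < f \<Longrightarrow> m < d \<Longrightarrow> co (sK D b x) i m = emb S i b * co x i m"
    and co_phi: "i < f \<Longrightarrow> l < d \<Longrightarrow>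
      co (phi D x) i l = (\<Sum>m<d. (A i * \<Delta> i) $$ (l, m) * co x (prev S i) m)"
    and mem_Fil_iff: "x \<in> Fil D j \<longleftrightarrow> (\<forall>i<f. \<forall>m<d. co x i m \<noteq> 0 \<longrightarrow> j \<le> k i m)"
    and mem_L_iff: "x \<in> L \<longleftrightarrow> (\<forall>i<f. \<forall>m<d. absF S (co x i m) \<le> 1)"

context phi_module
begin

lemma tensor_act_sK: "tensor_act D t (sK D b x) = sK D b (tensor_act D t x)"
  by (induction t) (auto simp: KD.scale_right_distrib sF_sK KD.scale_left_commute)

lemma mem_iff_proj_mem:
  assumes "submod D (ringF S) (ringK S) M"
  shows "x \<in> M \<longleftrightarrow> (\<forall>i<f. proj i x \<in> M)"
proof
  assume "\<forall>i<f. proj i x \<in> M"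
  hence "(\<Sum>i<f. proj i x) \<in> M"
    using assms unfolding submod_ring_iff by (intro V.integral_submodule_sum) auto
  thus "x \<in> M" by (simp add: sum_proj)
qed (use proj_mem[OF assms] in blast)

end

context hodge_lattice
begin

definition frame_coord :: "(nat \<Rightarrow> nat \<Rightarrow> 'v) \<Rightarrow> 'v \<Rightarrow> nat \<Rightarrow> nat \<Rightarrow> 'a" where
  "frame_coord e x i = (SOME c. proj i x = (\<Sum>m<d. sF D (c m) (e i m)))"

context
  fixes A e
  assumes frame: "frame A e"
begin

lemma proj_eq_frame_sum:
  assumes i: "i < f"
  shows "proj i x = (\<Sum>m<d. sF D (frame_coord e x i m) (e i m))"
proof -
  have "proj i x \<in> V.span (e i ` {..<d})"
    unfolding span_adapted[OF frameD(1)[OF frame i] subspace_eigenspace]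
    by (rule proj_in_eigenspace[OF i])
  hence "\<exists>c. proj i x = (\<Sum>m<d. sF D (c m) (e i m))" unfolding V.span_family by blast
  thus ?thesis unfolding frame_coord_def by (rule someI_ex)
qed

lemma frame_coord_eqI:
  assumes i: "i < f" and "proj i x = (\<Sum>m<d. sF D (c m) (e i m))" and "m < d"
  shows "frame_coord e x i m = c m"
  using V.indep_family_coeff_eq[OF adaptedD(1)[OF frameD(1)[OF frame i]] _ \<open>m < d\<close>,
      of "frame_coord e x i" c]
    proj_eq_frame_sum[OF i, of x] assms(2) by simp

lemma integral_frame_coord_iff:
  assumes i: "i < f"
  shows "proj i x \<in> L \<longleftrightarrow> (\<forall>m<d. absF S (frame_coord e x i m) \<le> 1)"
proof -
  have "proj i x \<in> L \<longleftrightarrow> proj i x \<in> V.integral_span d (e i)"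
    using adaptedD(2)[OF frameD(1)[OF frame i]] proj_in_eigenspace[OF i] by blast
  also have "\<dots> \<longleftrightarrow> (\<forall>m<d. absF S (frame_coord e x i m) \<le> 1)"
  proof
    assume "proj i x \<in> V.integral_span d (e i)"
    then obtain c where "proj i x = (\<Sum>m<d. sF D (c m) (e i m))" "\<And>m. m < d \<Longrightarrow> absF S (c m) \<le> 1"
      by (auto elim: V.integral_spanE)
    thus "\<forall>m<d. absF S (frame_coord e x i m) \<le> 1" using frame_coord_eqI[OF i] by metis
  next
    assume "\<forall>m<d. absF S (frame_coord e x i m) \<le> 1"
    thus "proj i x \<in> V.integral_span d (e i)"
      unfolding proj_eq_frame_sum[OF i, of x] by (intro V.integral_spanI) simp
  qed
  finally show ?thesis .
qed

lemma Fil_frame_coord_iff: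
  assumes i: "i < f"
  shows "proj i x \<in> Fil D j \<longleftrightarrow> (\<forall>m<d. frame_coord e x i m \<noteq> 0 \<longrightarrow> j \<le> k i m)"
proof -
  let ?r = "jump_count d (k i) j"
  have less_r: "m < ?r \<longleftrightarrow> m < d \<and> j \<le> k i m" for m by (rule less_jump_count_iff[OF decreasing[OF i]])
  have extend: "(\<Sum>m<?r. sF D (c m) (e i m)) = (\<Sum>m<d. sF D (if m < ?r then c m else 0) (e i m))" for c
    using jump_count_le by (intro sum.mono_neutral_cong_left) auto
  have "proj i x \<in> Fil D j \<longleftrightarrow> proj i x \<in> V.span (e i ` {..<?r})"
    unfolding span_adapted_Fil[OF frameD(1)[OF frame i] subspace_eigenspace]
    using proj_in_eigenspace[OF i] by blast
  also have "\<dots> \<longleftrightarrow> (\<forall>m<d. frame_coord e x i m \<noteq> 0 \<longrightarrow> m < ?r)"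
  proof
    assume "proj i x \<in> V.span (e i ` {..<?r})"
    then obtain c where c: "proj i x = (\<Sum>m<d. sF D (if m < ?r then c m else 0) (e i m))"
      unfolding V.span_family extend by blast
    have "frame_coord e x i m = (if m < ?r then c m else 0)" if "m < d" for m
      by (rule frame_coord_eqI[OF i c that])
    thus "\<forall>m<d. frame_coord e x i m \<noteq> 0 \<longrightarrow> m < ?r" by auto
  next
    assume "\<forall>m<d. frame_coord e x i m \<noteq> 0 \<longrightarrow> m < ?r"
    hence "proj i x = (\<Sum>m<?r. sF D (frame_coord e x i m) (e i m))"
      unfolding proj_eq_frame_sum[OF i, of x] extend by (intro sum.cong) auto
    thus "proj i x \<in> V.span (e i ` {..<?r})" unfolding V.span_family by blast
  qed
  finally show ?thesis unfolding less_r by blast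
qed

lemma frame_coord_sum:
  assumes i: "i < f" and m: "m < d"
  shows "frame_coord e (\<Sum>i<f. \<Sum>m<d. sF D (c i m) (e i m)) i m = c i m"
proof (rule frame_coord_eqI[OF i _ m])
  have e_mem: "e i' m \<in> eigenspace i'" if "i' < f" "m < d" for i' m
    using V.span_base[of "e i' m" "e i' ` {..<d}"] that
    unfolding span_adapted[OF frameD(1)[OF frame that(1)] subspace_eigenspace] by blast
  let ?row = "\<lambda>i'. \<Sum>m<d. sF D (c i' m) (e i' m)"
  have row_mem: "?row i' \<in> eigenspace i'" if "i' < f" for i'
    using e_mem[OF that] by (intro V.subspace_sum V.subspace_scale subspace_eigenspace) auto
  have "proj i (\<Sum>i'<f. ?row i') = (\<Sum>i'<f. proj i (?row i'))" by (rule proj.sum)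
  also have "\<dots> = (\<Sum>i'<f. if i' = i then ?row i' else 0)"
    using proj_eigenspace[OF i _ row_mem] by (intro sum.cong) auto
  also have "\<dots> = ?row i" using i by simp
  finally show "proj i (\<Sum>i'<f. ?row i') = ?row i" .
qed

lemma frame_coord_phi:
  assumes i: "i < f" and l: "l < d"
  shows "frame_coord e (phi D x) i l = (\<Sum>m<d. (A i * \<Delta> i) $$ (l, m) * frame_coord e x (prev S i) m)"
proof (rule frame_coord_eqI[OF i _ l])
  let ?c = "frame_coord e x (prev S i)"
  have "proj i (phi D x) = phi D (\<Sum>m<d. sF D (?c m) (e (prev S i) m))"
    by (simp add: proj_phi[OF i] flip: proj_eq_frame_sum[OF prev_less])
  also have "\<dots> = (\<Sum>m<d. sF D (?c m) (V.row_mult d (e i) (A i * \<Delta> i) m))"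
    by (simp add: phi.sum phi.scale frameD(2)[OF frame i])
  also have "\<dots> = (\<Sum>l<d. sF D (\<Sum>m<d. (A i * \<Delta> i) $$ (l, m) * ?c m) (e i l))"
    by (rule V.sum_row_mult)
  finally show "proj i (phi D x) = \<dots>" .
qed

theorem coordinate_lattice_frame:
  assumes "A \<in> GLO_tuples S d"
  shows "coordinate_lattice S d k D e (frame_coord e) L A"
proof unfold_locales
  show "(\<Sum>i<f. \<Sum>m<d. sF D (frame_coord e x i m) (e i m)) = x" for x
    using sum_proj[of x] by (simp add: proj_eq_frame_sum)
  show "frame_coord e (sK D b x) i m = emb S i b * frame_coord e x i m" if "i < f" "m < d" for b x i m
  proof (rule frame_coord_eqI[OF that(1) _ that(2)])
    have "proj i (sK D b x) = sF D (emb S i b) (proj i x)"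
      by (simp add: tensor_act_sK sK_eigenspace[OF proj_in_eigenspace[OF that(1)]])
    thus "proj i (sK D b x) = (\<Sum>m<d. sF D (emb S i b * frame_coord e x i m) (e i m))"
      by (simp add: proj_eq_frame_sum[OF that(1), of x] V.scale_sum_right)
  qed
  show "x \<in> Fil D j \<longleftrightarrow> (\<forall>i<f. \<forall>m<d. frame_coord e x i m \<noteq> 0 \<longrightarrow> j \<le> k i m)" for x j
    using mem_iff_proj_mem[OF submod_ring_Fil] Fil_frame_coord_iff by blast
  show "x \<in> L \<longleftrightarrow> (\<forall>i<f. \<forall>m<d. absF S (frame_coord e x i m) \<le> 1)" for x
    using mem_iff_proj_mem[OF submod_L] integral_frame_coord_iff by blast
  show "frame_coord e (\<Sum>i<f. \<Sum>m<d. sF D (c i m) (e i m)) i m = c i m" if "i < f" "m < d" for c i m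
    by (rule frame_coord_sum[OF that])
  show "frame_coord e (phi D x) i l = (\<Sum>m<d. (A i * \<Delta> i) $$ (l, m) * frame_coord e x (prev S i) m)"
    if "i < f" "l < d" for x i l
    by (rule frame_coord_phi[OF that])
qed (rule assms)

end

end

locale coordinate_lattice_pair =
  X: coordinate_lattice S d k D e co L A + Y: coordinate_lattice S d k D' e' co' L' A
  for S :: "('q::field_char_0, 'a::field, 'k::field) coeff_data" and d k
    and D D' :: "('a, 'k, 'v::ab_group_add) fil_phi_module" and e e' co co' L L' A
begin

definition transfer :: "'v \<Rightarrow> 'v" where "transfer x = Y.V.grid_vector (co x)"

lemma co_transfer [simp]: "i < X.f \<Longrightarrow> m < d \<Longrightarrow> co' (transfer x) i m = co x i m"
  by (simp add: transfer_def)

lemma transfer_eqI: "(\<And>i m. i < X.f \<Longrightarrow> m < d \<Longrightarrow> co x i m = co' y i m) \<Longrightarrow> transfer x = y"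
  by (rule Y.V.co_eqI) simp

lemma transfer_image:
  assumes "\<And>x. x \<in> M \<longleftrightarrow> P (\<lambda>i m. if i < X.f \<and> m < d then co x i m else 0)"
    and "\<And>y. y \<in> N \<longleftrightarrow> P (\<lambda>i m. if i < X.f \<and> m < d then co' y i m else 0)"
  shows "transfer ` M = N"
proof (intro equalityI subsetI)
  fix y assume "y \<in> transfer ` M"
  then obtain x where "x \<in> M" "y = transfer x" by blast
  thus "y \<in> N" by (simp add: assms cong: if_cong)
next
  fix y assume y: "y \<in> N"
  have "transfer (X.V.grid_vector (co' y)) = y" by (rule transfer_eqI) simp
  moreover have "X.V.grid_vector (co' y) \<in> M" using y by (simp add: assms cong: if_cong)
  ultimately show "y \<in> transfer ` M" by (metis imageI)
qed

theorem lattice_iso_transfer: "lattice_iso S (D, L) (D', L') transfer"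
  unfolding lattice_iso_def prod.case
proof (intro conjI ballI allI)
  have "inj transfer"
  proof (rule injI)
    fix x y assume "transfer x = transfer y"
    thus "x = y" by (intro X.V.co_eqI) (metis co_transfer)
  qed
  moreover have "transfer ` L = L'"
    by (rule transfer_image[where P = "\<lambda>c. \<forall>i<X.f. \<forall>m<d. absF S (c i m) \<le> 1"])
      (simp_all add: X.mem_L_iff Y.mem_L_iff)
  ultimately show "bij_betw transfer L L'" by (auto simp: bij_betw_def inj_on_def)
  show "transfer ` FilL D L j = FilL D' L' j" for j
    unfolding FilL_def
    by (rule transfer_image[where P = "\<lambda>c. \<forall>i<X.f. \<forall>m<d. absF S (c i m) \<le> 1 \<and> (c i m \<noteq> 0 \<longrightarrow> j \<le> k i m)"])
      (auto simp: X.mem_L_iff Y.mem_L_iff X.mem_Fil_iff Y.mem_Fil_iff)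
  show "transfer (x + y) = transfer x + transfer y" for x y by (rule transfer_eqI) simp
  show "transfer (sF D a x) = sF D' a (transfer x)" for a x by (rule transfer_eqI) simp
  show "transfer (sK D b x) = sK D' b (transfer x)" for b x
    by (rule transfer_eqI) (simp add: X.co_sK Y.co_sK)
  show "transfer (phi D x) = phi D' (transfer x)" for x
    by (rule transfer_eqI) (simp add: X.co_phi Y.co_phi X.prev_less)
qed

end

section \<open>Lattices defined by coordinates\<close>

context phi_module
begin

lemma divided_image_eq_if_components:
  assumes M: "submod D (ringF S) (ringK S) M"
    and components: "\<And>i. i < f \<Longrightarrow> divided_image (M \<inter> eigenspace (prev S i)) = M \<inter> eigenspace i"
  shows "divided_image M = M"
proof
  have integral: "V.integral_submodule M" using M submod_ring_iff by blast
  show "divided_image M \<subseteq> M"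
  proof (rule divided_image_minimal[OF integral])
    fix j x assume x: "x \<in> Fil D j \<inter> M"
    have "proj i (scale_p S D (- j) (phi D x)) \<in> M" if "i < f" for i
      using divided_image_base[of "proj (prev S i) x" j "M \<inter> eigenspace (prev S i)"]
        components[OF that] proj_mem[OF submod_ring_Fil prev_less] proj_mem[OF M prev_less]
        proj_in_eigenspace[OF prev_less] x
      by (simp add: scale_p_def proj.scale proj_phi[OF that])
    thus "scale_p S D (- j) (phi D x) \<in> M" using mem_iff_proj_mem[OF M] by blast
  qed
  show "M \<subseteq> divided_image M"
  proof
    fix x assume "x \<in> M"
    hence "proj i x \<in> divided_image M" if "i < f" for i
      using components[OF that] proj_mem[OF M that] proj_in_eigenspace[OF that]
        divided_image_mono[of "M \<inter> eigenspace (prev S i)" M] by blast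
    hence "(\<Sum>i<f. proj i x) \<in> divided_image M"
      by (intro V.integral_submodule_sum integral_submodule_divided_image integral) auto
    thus "x \<in> divided_image M" by (simp add: sum_proj)
  qed
qed

end

context filtered_lattice
begin

lemma integral_span_row_mult_GLO:
  assumes "C \<in> GLO S n"
  shows "V.integral_span n (V.row_mult n e C) = V.integral_span n e"
proof -
  have h: "antimono_on {..<n} (\<lambda>_. 0 :: int)" by (simp add: monotone_on_def)
  have "jump_count n (\<lambda>_. 0) 0 = n" by (simp add: jump_count_def)
  thus ?thesis
    using integral_span_row_mult_parabolic[OF h, of C 0 e] assms by (simp add: parabolic_iff[OF h])
qed

end

context hodge_lattice
begin

lemma divided_image_frame:
  assumes e: "frame A e" and A: "A \<in> GLO_tuples S d"
  shows "divided_image L = L"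
proof (rule divided_image_eq_if_components[OF submod_L])
  fix i assume i: "i < f"
  note A_GLO = GLO_tuples_D[OF A i]
  have "scale_p S D (- k (prev S i) m) (phi D (e (prev S i) m)) = V.row_mult d (e i) (A i) m"
    if "m < d" for m
    unfolding frameD(2)[OF e i that] row_mult_Delta[OF GLO_carrier[OF A_GLO] that]
    by (simp add: scale_p_add_index)
  hence "divided_image (L \<inter> eigenspace (prev S i)) = V.integral_span d (V.row_mult d (e i) (A i))"
    unfolding divided_image_adapted[OF decreasing[OF prev_less] frameD(1)[OF e prev_less]
        subspace_eigenspace]
    by (rule V.integral_span_cong)
  thus "divided_image (L \<inter> eigenspace (prev S i)) = L \<inter> eigenspace i"
    using adaptedD(2)[OF frameD(1)[OF e i]] integral_span_row_mult_GLO[OF A_GLO] by simp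
qed

end

context coordinate_lattice
begin

lemma vector_space_sK: "vector_space (sK D)"
  by unfold_locales
    (rule V.co_eqI, simp add: co_sK emb.hom_add emb.hom_mult emb.hom_one distrib_left distrib_right)+

lemma frobenius_matrix_minv:
  assumes "i < f"
  shows "minv (\<Delta> i) * minv (A i) * (A i * \<Delta> i) = 1\<^sub>m d"
    and "A i * \<Delta> i * (minv (\<Delta> i) * minv (A i)) = 1\<^sub>m d"
    and "minv (\<Delta> i) * minv (A i) \<in> carrier_mat d d"
proof -
  note A = GLO_tuples_D[OF GLO assms]
  note carrier = GLO_carrier[OF A] GLO_carrier[OF GLO_minv(1)[OF A]]
    Delta_carrier[of d "k (prev S i)"] Delta_minv(3)[of d "k (prev S i)"]
  note assoc = assoc_mult_mat[of _ d d _ d _ d] mult_carrier_mat[of _ d d _ d]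
  have "minv (\<Delta> i) * minv (A i) * (A i * \<Delta> i) = minv (\<Delta> i) * (minv (A i) * A i) * \<Delta> i"
    using carrier by (simp add: assoc)
  thus "minv (\<Delta> i) * minv (A i) * (A i * \<Delta> i) = 1\<^sub>m d"
    using carrier GLO_minv(3)[OF A] Delta_minv(2) by simp
  have "A i * \<Delta> i * (minv (\<Delta> i) * minv (A i)) = A i * (\<Delta> i * minv (\<Delta> i)) * minv (A i)"
    using carrier by (simp add: assoc)
  thus "A i * \<Delta> i * (minv (\<Delta> i) * minv (A i)) = 1\<^sub>m d"
    using carrier GLO_minv(2)[OF A] Delta_minv(1) by simp
  show "minv (\<Delta> i) * minv (A i) \<in> carrier_mat d d" using carrier by (simp add: assoc)
qed

lemma bij_phi_coordinates: "bij (phi D)"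
proof (rule o_bij)
  define U where "U i = minv (\<Delta> i) * minv (A i)" for i
  define \<psi> where "\<psi> y = V.grid_vector (\<lambda>i m. \<Sum>l<d. U (nxt i) $$ (m, l) * co y (nxt i) l)" for y
  note carrier = frobenius_matrix_carrier[OF GLO] frobenius_matrix_minv(3)[folded U_def]
  show "\<psi> \<circ> phi D = id"
  proof
    fix x
    have "(\<Sum>l<d. U (nxt i) $$ (m, l) * co (phi D x) (nxt i) l) = co x i m" if "i < f" "m < d" for i m
      using matrix_inverse_mult_cancel[OF carrier(1)[OF nxt_less[of i]] carrier(2)[OF nxt_less[of i]]
          frobenius_matrix_minv(1)[OF nxt_less[of i], folded U_def] that(2), of "co x i"] that
      by (simp add: co_phi nxt_less prev_nxt)
    thus "(\<psi> \<circ> phi D) x = id x" by (intro V.co_eqI) (simp add: \<psi>_def)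
  qed
  show "phi D \<circ> \<psi> = id"
  proof
    fix y
    have "co (phi D (\<psi> y)) i l = co y i l" if "i < f" "l < d" for i l
      using matrix_inverse_mult_cancel[OF carrier(2)[OF that(1)] carrier(1)[OF that(1)]
          frobenius_matrix_minv(2)[OF that(1), folded U_def] that(2)] that
      by (simp add: co_phi \<psi>_def prev_less nxt_prev)
    thus "(phi D \<circ> \<psi>) y = id y" by (intro V.co_eqI) simp
  qed
qed

lemma span_grid: "V.span ((\<lambda>(i, m). e i m) ` ({..<f} \<times> {..<d})) = UNIV"
proof -
  let ?E = "(\<lambda>(i, m). e i m) ` ({..<f} \<times> {..<d})"
  have "x \<in> V.span ?E" for x
  proof (rule V.mem_if_grid_terms)
    fix i m assume "i < f" "m < d"
    hence "e i m \<in> ?E" by force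
    thus "sF D (co x i m) (e i m) \<in> V.span ?E" by (intro V.span_scale V.span_base)
  qed (simp_all add: V.span_zero V.span_add)
  thus ?thesis by blast
qed

lemma submod_Fil_coordinates: "submod D UNIV UNIV (Fil D j)"
  unfolding submod_def
proof (intro conjI ballI)
  show "x + y \<in> Fil D j" if "x \<in> Fil D j" "y \<in> Fil D j" for x y
    unfolding mem_Fil_iff
  proof (intro allI impI)
    fix i m assume im: "i < f" "m < d" "co (x + y) i m \<noteq> 0"
    hence "co x i m \<noteq> 0 \<or> co y i m \<noteq> 0" by auto
    thus "j \<le> k i m" using that im(1,2) unfolding mem_Fil_iff by blast
  qed
qed (simp_all add: mem_Fil_iff co_sK)

lemma Fil_bounds: "(\<exists>j. Fil D j = UNIV) \<and> (\<exists>j. Fil D j = {0})"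
proof -
  have "bdd_above ((\<lambda>(i, m). \<bar>k i m\<bar>) ` ({..<f} \<times> {..<d}))" by (rule bdd_above_finite) simp
  then obtain b where "\<And>i m. i < f \<Longrightarrow> m < d \<Longrightarrow> \<bar>k i m\<bar> \<le> b" unfolding bdd_above_def by fastforce
  hence b: "- b \<le> k i m" "k i m < b + 1" if "i < f" "m < d" for i m
    using that by (fastforce simp: abs_le_iff)+
  have "Fil D (- b) = UNIV" using b(1) by (auto simp: mem_Fil_iff)
  moreover have "Fil D (b + 1) = {0}"
  proof -
    have "x = 0" if "x \<in> Fil D (b + 1)" for x
      using b(2) that by (intro V.co_eqI) (force simp: mem_Fil_iff)
    thus ?thesis by (auto simp: mem_Fil_iff)
  qed
  ultimately show ?thesis by blast
qed

lemma filtered_phi_module_coordinates: "filtered_phi_module S D"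
  unfolding filtered_phi_module_def
proof (intro conjI allI)
  show "vector_space (sF D)" by (rule V.vector_space_axioms)
  show "vector_space (sK D)" by (rule vector_space_sK)
  show "sF D a (sK D b x) = sK D b (sF D a x)" for a b x by (rule V.co_eqI) (simp add: co_sK)
  show "sF D (inclF S q) x = sK D (inclK S q) x" for q x by (rule V.co_eqI) (simp add: co_sK emb_inclK)
  show "\<exists>B. finite B \<and> V.span B = UNIV" using span_grid by (intro exI conjI) auto
  show "Vector_Spaces.linear (sF D) (sF D) (phi D)"
    by (intro Vector_Spaces.linear.intro V.vector_space_axioms module_hom.intro
        module_hom_axioms.intro V.module_axioms; rule V.co_eqI)
      (simp_all add: co_phi prev_less distrib_left sum.distrib sum_distrib_left mult.left_commute)
  show "phi D (sK D b x) = sK D (frob S b) (phi D x)" for b x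
    by (rule V.co_eqI) (simp add: co_phi co_sK prev_less emb_frob sum_distrib_left mult.left_commute)
  show "bij (phi D)" by (rule bij_phi_coordinates)
  show "submod D UNIV UNIV (Fil D j)" for j by (rule submod_Fil_coordinates)
  show "Fil D (j + 1) \<subseteq> Fil D j" for j by (force simp: mem_Fil_iff)
qed (use Fil_bounds in blast)+

sublocale phi_module S D
  by unfold_locales (rule filtered_phi_module_coordinates)

sublocale V: nonarch_grid "sF D" "V.extend_basis {}" "absF S" "res_deg S" d e co ..

sublocale filtered_lattice S D L
proof
  have L: "L = V.integral_submodule hull (\<lambda>(i, m). e i m) ` ({..<f} \<times> {..<d})"
    unfolding V.integral_hull_grid using mem_L_iff by blast
  then obtain N g where g: "L = V.integral_span N g"
    using V.finite_integral_hull[of "(\<lambda>(i, m). e i m) ` ({..<f} \<times> {..<d})"] by auto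
  have "(\<lambda>(i, m). e i m) ` ({..<f} \<times> {..<d}) \<subseteq> L" unfolding L by (rule hull_subset)
  hence "V.span L = UNIV" using V.span_mono span_grid by blast
  thus "\<exists>N g. L = V.integral_span N g \<and> V.span (g ` {..<N}) = UNIV"
    using g V.span_integral_span by metis
qed

lemma mem_eigenspace_iff:
  assumes i: "i < f"
  shows "x \<in> eigenspace i \<longleftrightarrow> (\<forall>i'<f. \<forall>m<d. co x i' m \<noteq> 0 \<longrightarrow> i' = i)"
proof
  assume x: "x \<in> eigenspace i"
  obtain a where a: "inj_on (\<lambda>i. emb S i a) {..<f}" using separating_exists separating_def by blast
  show "\<forall>i'<f. \<forall>m<d. co x i' m \<noteq> 0 \<longrightarrow> i' = i"
  proof (intro allI impI)
    fix i' m assume i': "i' < f" and m: "m < d" "co x i' m \<noteq> 0"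
    have "emb S i' a * co x i' m = emb S i a * co x i' m"
      using arg_cong[OF sK_eigenspace[OF x, of a], of "\<lambda>y. co y i' m"] i' m by (simp add: co_sK)
    thus "i' = i" using inj_onD[OF a] i i' m by simp
  qed
next
  assume zero: "\<forall>i'<f. \<forall>m<d. co x i' m \<noteq> 0 \<longrightarrow> i' = i"
  have "sK D b x = sF D (emb S i b) x" for b
  proof (rule V.co_eqI)
    fix i' m assume "i' < f" "m < d"
    thus "co (sK D b x) i' m = co (sF D (emb S i b) x) i' m"
      using zero by (cases "co x i' m = 0") (auto simp: co_sK)
  qed
  thus "x \<in> eigenspace i" by (simp add: eigenspace_def)
qed

lemma adapted_row:
  assumes i: "i < f"
  shows "adapted d (k i) (eigenspace i) (e i)"
  unfolding adapted_def
proof (intro conjI allI)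
  note mem_iff = mem_L_iff mem_eigenspace_iff[OF i]
  show "V.indep_family d (e i)" by (rule V.indep_family_row[OF i])
  show "L \<inter> eigenspace i = V.integral_span d (e i)"
    unfolding V.integral_span_row[OF i order_refl] by (auto simp: mem_iff)
  show "Fil D j \<inter> (L \<inter> eigenspace i) = V.integral_span (jump_count d (k i) j) (e i)" for j
    unfolding V.integral_span_row[OF i jump_count_le] less_jump_count_iff[OF decreasing[OF i]]
    by (fastforce simp: mem_iff mem_Fil_iff)
qed

lemma phi_row:
  assumes i: "i < f" and m: "m < d"
  shows "phi D (e (prev S i) m) = V.row_mult d (e i) (A i * \<Delta> i) m"
  unfolding V.row_mult_def
proof (subst V.row_sum_iff[OF i order_refl], intro allI impI)
  fix i' l assume i': "i' < f" and l: "l < d"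
  have "co (phi D (e (prev S i) m)) i' l
      = (\<Sum>m'<d. if i' = i \<and> m' = m then (A i * \<Delta> i) $$ (l, m) else 0)"
    using i i' l m by (simp add: co_phi prev_less prev_eq_iff) (intro sum.cong, auto)
  thus "co (phi D (e (prev S i) m)) i' l = (if i' = i \<and> l < d then (A i * \<Delta> i) $$ (l, m) else 0)"
    using l m by simp
qed

lemma has_hodge_data_coordinates: "has_hodge_data S d k D"
  unfolding has_hodge_data_def
proof (intro allI impI)
  fix i j assume i: "i < f"
  have "V.dim (component S D i (Fil D j)) = jump_count d (k i) j" for j
    unfolding component_Fil[OF i] by (rule dim_Fil_adapted[OF adapted_row[OF i] subspace_eigenspace])
  thus "int (V.dim (component S D i (Fil D j))) - int (V.dim (component S D i (Fil D (j + 1))))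
      = int (card {m. m < d \<and> k i m = j})"
    by (simp add: jump_count_Suc[of d "k i" j])
qed

lemma submod_hull: "submod D R R' (submod D R R' hull B)"
  by (rule hull_in) (auto simp: submod_def)

lemma mem_submod_if_coordinates:
  assumes M: "submod D R R' M" and "\<And>i m. i < f \<Longrightarrow> m < d \<Longrightarrow> e i m \<in> M"
    and "\<And>i m. i < f \<Longrightarrow> m < d \<Longrightarrow> co x i m \<in> R"
  shows "x \<in> M"
proof (rule V.mem_if_grid_terms)
  show "sF D (co x i m) (e i m) \<in> M" if "i < f" "m < d" for i m
    using M assms(2,3)[OF that] unfolding submod_def by blast
qed (use M in \<open>simp_all add: submod_def\<close>)

lemma phi_L_subset:
  assumes nonneg: "\<And>i m. i < f \<Longrightarrow> m < d \<Longrightarrow> 0 \<le> k i m"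
  shows "phi D ` L \<subseteq> L"
proof -
  have "absF S (co (phi D x) i l) \<le> 1" if x: "x \<in> L" and i: "i < f" and l: "l < d" for x i l
    unfolding co_phi[OF i l]
  proof (rule F.sum_le)
    fix m assume "m \<in> {..<d}"
    hence m: "m < d" by simp
    note A = GLO_tuples_D[OF GLO i]
    have "absF S (A i $$ (l, m) * of_nat p powi k (prev S i) m) \<le> 1"
      using GLO_integral[OF A] p_powi_integral[OF nonneg[OF prev_less m]] l m
      by (intro F.le_1_mult) (auto simp: F.integral_mat_def)
    moreover have "absF S (co x (prev S i) m) \<le> 1" using x m prev_less by (simp add: mem_L_iff)
    ultimately show "absF S ((A i * \<Delta> i) $$ (l, m) * co x (prev S i) m) \<le> 1"
      unfolding mult_Delta_index[OF GLO_carrier[OF A] l m] by (rule F.le_1_mult)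
  qed simp
  hence "phi D x \<in> L" if "x \<in> L" for x
    unfolding mem_L_iff[of "phi D x"] using that by blast
  thus ?thesis by blast
qed

lemma phi_lattice_coordinates:
  assumes nonneg: "\<And>i m. i < f \<Longrightarrow> m < d \<Longrightarrow> 0 \<le> k i m"
  shows "phi_lattice S D L"
  unfolding phi_lattice_def
proof (intro conjI)
  let ?E = "(\<lambda>(i, m). e i m) ` ({..<f} \<times> {..<d})"
  have "e i m \<in> L" if "i < f" "m < d" for i m using that by (simp add: mem_L_iff)
  hence E: "?E \<subseteq> L" by (simp add: image_subset_iff)
  have "sK D b x \<in> L" if "b \<in> ringK S" "x \<in> L" for b x
    using that F.le_1_mult[of "emb S i b" "co x i m" for i m]
    by (simp add: mem_L_iff co_sK ringK_def abs_emb)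
  thus submod_L: "submod D (ringF S) (ringK S) L"
    unfolding submod_ring_iff using integral_submodule_L by blast
  have "x \<in> submod D (ringF S) (ringK S) hull ?E" if "x \<in> L" for x
  proof (rule mem_submod_if_coordinates[OF submod_hull])
    show "e i m \<in> submod D (ringF S) (ringK S) hull ?E" if "i < f" "m < d" for i m
      using that by (intro hull_inc) blast
    show "co x i m \<in> ringF S" if "i < f" "m < d" for i m
      using that \<open>x \<in> L\<close> by (simp add: mem_L_iff ringF_def)
  qed
  hence "L = submod D (ringF S) (ringK S) hull ?E"
    using hull_minimal[of ?E L "submod D (ringF S) (ringK S)", OF E submod_L] by blast
  moreover have "finite ?E" by simp
  ultimately show "\<exists>B. finite B \<and> L = submod D (ringF S) (ringK S) hull B" by (intro exI conjI)
  have "x \<in> submod D UNIV UNIV hull L" for x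
    by (rule mem_submod_if_coordinates[OF submod_hull])
      (use E in \<open>simp_all add: image_subset_iff hull_inc\<close>)
  thus "submod D UNIV UNIV hull L = UNIV" by blast
  show "phi D ` L \<subseteq> L" by (rule phi_L_subset[OF nonneg])
qed

theorem coordinate_lattice_SDL:
  assumes nonneg: "\<And>i m. i < f \<Longrightarrow> m < d \<Longrightarrow> 0 \<le> k i m"
  shows "(D, L) \<in> SDL S d k" and "presented_by S d k A (D, L)"
proof -
  interpret hodge_lattice S d k D L
    using phi_lattice_coordinates[OF nonneg] has_hodge_data_coordinates by unfold_locales
  have frame: "frame A e" unfolding frame_def using adapted_row phi_row by blast
  thus "presented_by S d k A (D, L)" using presented_by_iff by blast
  interpret divisible_lattice S D L
    using divided_image_frame[OF frame GLO] by unfold_locales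
  show "(D, L) \<in> SDL S d k"
    using weakly_admissible phi_lattice divided_image_L hodge_data
    by (simp add: SDL_def strongly_divisible_iff)
qed

end

context hodge_type
begin

theorem coordinate_lattice_exists:
  fixes s :: "'a \<Rightarrow> 'v::ab_group_add \<Rightarrow> 'v"
  assumes s: "grid_coordinates s f d e co" and A: "A \<in> GLO_tuples S d"
  shows "\<exists>D L. coordinate_lattice S d k D e co L A"
proof -
  interpret grid_coordinates s f d e co by (rule s)
  define D where "D = \<lparr>sF = s, sK = \<lambda>b x. grid_vector (\<lambda>i m. emb S i b * co x i m),
    phi = \<lambda>x. grid_vector (\<lambda>i l. \<Sum>m<d. (A i * \<Delta> i) $$ (l, m) * co x (prev S i) m),
    Fil = \<lambda>j. {x. \<forall>i<f. \<forall>m<d. co x i m \<noteq> 0 \<longrightarrow> j \<le> k i m}\<rparr>"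
  have "coordinate_lattice S d k D e co {x. \<forall>i<f. \<forall>m<d. absF S (co x i m) \<le> 1} A"
    unfolding coordinate_lattice_def coordinate_lattice_axioms_def
    using s A hodge_type_axioms by (simp add: D_def)
  thus ?thesis by blast
qed

end

section \<open>Transport of frames along isomorphisms\<close>

locale lattice_isomorphism =
  X: hodge_lattice S d k D L + Y: hodge_lattice S d k D' L'
  for S :: "('q::field_char_0, 'a::field, 'k::field) coeff_data" and d k
    and D D' :: "('a, 'k, 'v::ab_group_add) fil_phi_module" and L L' +
  fixes h :: "'v \<Rightarrow> 'v"
  assumes iso: "lattice_iso S (D, L) (D', L') h"
begin

lemma bij_h: "bij_betw h L L'"
  and h_add: "x \<in> L \<Longrightarrow> y \<in> L \<Longrightarrow> h (x + y) = h x + h y"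
  and h_sF: "absF S a \<le> 1 \<Longrightarrow> x \<in> L \<Longrightarrow> h (sF D a x) = sF D' a (h x)"
  and h_sK: "b \<in> ringK S \<Longrightarrow> x \<in> L \<Longrightarrow> h (sK D b x) = sK D' b (h x)"
  and h_phi: "x \<in> L \<Longrightarrow> h (phi D x) = phi D' (h x)"
  and h_FilL: "h ` FilL D L j = FilL D' L' j"
  using iso by (auto simp: lattice_iso_def ringF_def)

lemma h_zero: "h 0 = 0"
  using h_add[of 0 0] X.V.integral_submodule_zero[OF X.integral_submodule_L] by simp

lemma h_combination:
  fixes n :: nat
  assumes "\<And>l. l < n \<Longrightarrow> e l \<in> L" "\<And>l. l < n \<Longrightarrow> absF S (c l) \<le> 1"
  shows "(\<Sum>l<n. sF D (c l) (e l)) \<in> L \<and> h (\<Sum>l<n. sF D (c l) (e l)) = (\<Sum>l<n. sF D' (c l) (h (e l)))"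
  using assms
proof (induction n)
  case 0
  show ?case using h_zero X.V.integral_submodule_zero[OF X.integral_submodule_L] by simp
next
  case (Suc n)
  have "sF D (c n) (e n) \<in> L"
    using Suc.prems by (intro X.V.integral_submodule_scale[OF X.integral_submodule_L]) auto
  thus ?case
    using Suc X.V.integral_submodule_add[OF X.integral_submodule_L] by (simp add: h_add h_sF)
qed

lemma h_integral_span:
  assumes "\<And>l. l < n \<Longrightarrow> e l \<in> L"
  shows "h ` X.V.integral_span n e = Y.V.integral_span n (\<lambda>l. h (e l))"
proof (intro equalityI subsetI)
  fix y assume "y \<in> h ` X.V.integral_span n e"
  then obtain x where x: "x \<in> X.V.integral_span n e" and y: "y = h x" by blast
  obtain c where "x = (\<Sum>l<n. sF D (c l) (e l))" "\<And>l. l < n \<Longrightarrow> absF S (c l) \<le> 1"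
    using x by (auto elim: X.V.integral_spanE)
  thus "y \<in> Y.V.integral_span n (\<lambda>l. h (e l))"
    using h_combination[of n e c] assms y by (simp add: Y.V.integral_spanI)
next
  fix y assume "y \<in> Y.V.integral_span n (\<lambda>l. h (e l))"
  then obtain c where "y = (\<Sum>l<n. sF D' (c l) (h (e l)))" and c: "\<And>l. l < n \<Longrightarrow> absF S (c l) \<le> 1"
    by (auto elim: Y.V.integral_spanE)
  hence "y = h (\<Sum>l<n. sF D (c l) (e l))" using h_combination[of n e c] assms by simp
  thus "y \<in> h ` X.V.integral_span n e" using X.V.integral_spanI[of n c e] c by blast
qed

lemma h_indep_family:
  assumes e: "\<And>l. l < n \<Longrightarrow> e l \<in> L" and indep: "X.V.indep_family n e"
  shows "Y.V.indep_family n (\<lambda>l. h (e l))"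
proof (rule Y.V.indep_family_if_integral)
  fix c assume c: "\<And>l. l < n \<Longrightarrow> absF S (c l) \<le> 1" and zero: "(\<Sum>l<n. sF D' (c l) (h (e l))) = 0"
  let ?x = "\<Sum>l<n. sF D (c l) (e l)"
  have x: "?x \<in> L" "h ?x = h 0" using h_combination[of n e c] e c zero h_zero by auto
  have "0 \<in> L" by (rule X.V.integral_submodule_zero[OF X.integral_submodule_L])
  hence "?x = 0" using inj_onD[OF bij_betw_imp_inj_on[OF bij_h] x(2) x(1)] by blast
  thus "\<forall>l<n. c l = 0" using X.V.indep_familyD[OF indep] by blast
qed

lemma h_tensor_act:
  assumes "set t \<subseteq> ringF S \<times> ringK S" "x \<in> L"
  shows "tensor_act D t x \<in> L \<and> h (tensor_act D t x) = tensor_act D' t (h x)"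
  using assms(1)
proof (induction t)
  case Nil
  show ?case using h_zero X.V.integral_submodule_zero[OF X.integral_submodule_L] by simp
next
  case (Cons ab t)
  obtain a b where ab: "ab = (a, b)" "a \<in> ringF S" "b \<in> ringK S" using Cons.prems by (cases ab) auto
  hence b: "sK D b x \<in> L" using X.submod_L assms(2) unfolding X.submod_ring_iff by blast
  hence "sF D a (sK D b x) \<in> L"
    using X.V.integral_submodule_scale[OF X.integral_submodule_L] ab(2) by (simp add: ringF_def)
  thus ?case
    using Cons X.V.integral_submodule_add[OF X.integral_submodule_L] ab b assms(2)
    by (simp add: h_add h_sF h_sK ringF_def)
qed

lemma h_component:
  assumes "i < X.f" "M \<subseteq> L"
  shows "h ` component S D i M = component S D' i (h ` M)"
proof -
  have "h (tensor_act D (idem S i) x) = tensor_act D' (idem S i) (h x)" if "x \<in> M" for x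
    using h_tensor_act[OF X.idem_spec(1)[OF assms(1)]] that assms(2) by blast
  thus ?thesis unfolding component_def image_image by (rule image_cong[OF refl])
qed

lemma h_Int_eigenspace:
  assumes i: "i < X.f"
  shows "h ` (L \<inter> X.eigenspace i) = L' \<inter> Y.eigenspace i"
    and "h ` (Fil D j \<inter> (L \<inter> X.eigenspace i)) = Fil D' j \<inter> (L' \<inter> Y.eigenspace i)"
proof -
  show "h ` (L \<inter> X.eigenspace i) = L' \<inter> Y.eigenspace i"
    using h_component[OF i order_refl] bij_betw_imp_surj_on[OF bij_h]
    by (simp add: X.component_eq[OF X.submod_L i] Y.component_eq[OF Y.submod_L i])
  have "FilL D L j \<subseteq> L" by (simp add: FilL_def)
  from h_component[OF i this]
  show "h ` (Fil D j \<inter> (L \<inter> X.eigenspace i)) = Fil D' j \<inter> (L' \<inter> Y.eigenspace i)"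
    unfolding h_FilL X.component_eq[OF X.submod_FilL i] Y.component_eq[OF Y.submod_FilL i]
    by (simp add: FilL_def Int_assoc)
qed

lemma h_adapted:
  assumes i: "i < X.f" and e: "X.adapted d (k i) (X.eigenspace i) e"
  shows "Y.adapted d (k i) (Y.eigenspace i) (\<lambda>m. h (e m))"
proof -
  have e_mem: "e m \<in> L" if "m < d" for m
    using X.V.integral_span_base[OF that, of e] X.adaptedD(2)[OF e] by blast
  show ?thesis
    unfolding Y.adapted_def
  proof (intro conjI allI)
    show "Y.V.indep_family d (\<lambda>m. h (e m))" by (rule h_indep_family[OF e_mem X.adaptedD(1)[OF e]])
    show "L' \<inter> Y.eigenspace i = Y.V.integral_span d (\<lambda>m. h (e m))"
      unfolding h_Int_eigenspace(1)[OF i, symmetric] X.adaptedD(2)[OF e]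
      by (rule h_integral_span[OF e_mem])
    show "Fil D' j \<inter> (L' \<inter> Y.eigenspace i) = Y.V.integral_span (jump_count d (k i) j) (\<lambda>m. h (e m))"
      for j
      unfolding h_Int_eigenspace(2)[OF i, symmetric] X.adaptedD(3)[OF e]
      by (rule h_integral_span[OF e_mem[OF less_le_trans[OF _ jump_count_le]]])
  qed
qed

theorem h_frame:
  assumes nonneg: "\<And>i m. i < X.f \<Longrightarrow> m < d \<Longrightarrow> 0 \<le> k i m"
    and A: "A \<in> GLO_tuples S d" and e: "X.frame A e"
  shows "Y.frame A (\<lambda>i m. h (e i m))"
  unfolding Y.frame_def
proof (intro conjI allI impI)
  fix i assume i: "i < X.f"
  show "Y.adapted d (k i) (Y.eigenspace i) (\<lambda>m. h (e i m))"
    by (rule h_adapted[OF i X.frameD(1)[OF e i]])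
  fix m assume m: "m < d"
  have e_mem: "e i l \<in> L" if "i < X.f" "l < d" for i l
    using X.V.integral_span_base[OF that(2), of "e i"] X.adaptedD(2)[OF X.frameD(1)[OF e that(1)]]
    by blast
  have "absF S ((A i * X.\<Delta> i) $$ (l, m)) \<le> 1" if l: "l < d" for l
    using X.GLO_integral[OF X.GLO_tuples_D[OF A i]] X.p_powi_integral[OF nonneg[OF X.prev_less m]] l m
    by (simp add: X.mult_Delta_index[OF X.GLO_carrier[OF X.GLO_tuples_D[OF A i]]] X.F.integral_mat_def
        X.F.le_1_mult)
  hence "h (phi D (e (prev S i) m)) = Y.V.row_mult d (\<lambda>l. h (e i l)) (A i * X.\<Delta> i) m"
    using h_combination[of d "e i" "\<lambda>l. (A i * X.\<Delta> i) $$ (l, m)"] e_mem[OF i]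
    unfolding X.frameD(2)[OF e i m] X.V.row_mult_def Y.V.row_mult_def by simp
  thus "phi D' (h (e (prev S i) m)) = Y.V.row_mult d (\<lambda>l. h (e i l)) (A i * X.\<Delta> i) m"
    using h_phi[OF e_mem[OF X.prev_less m]] by simp
qed

end

section \<open>The classification\<close>

locale class_correspondence =
  fixes A :: "'x set" and r and B :: "'y set" and s and R :: "'x \<Rightarrow> 'y \<Rightarrow> bool"
  assumes equiv_r: "equiv A r" and s_subset: "s \<subseteq> B \<times> B"
    and left_total: "x \<in> A \<Longrightarrow> \<exists>y\<in>B. R x y" and right_total: "y \<in> B \<Longrightarrow> \<exists>x\<in>A. R x y"
    and related_iff: "x \<in> A \<Longrightarrow> x' \<in> A \<Longrightarrow> y \<in> B \<Longrightarrow> y' \<in> B \<Longrightarrow> R x y \<Longrightarrow> R x' y' \<Longrightarrow>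
      (x, x') \<in> r \<longleftrightarrow> (y, y') \<in> s"
begin

definition related_set :: "'x set \<Rightarrow> 'y set" where
  "related_set T = {y \<in> B. \<exists>x\<in>T. R x y}"

lemma equiv_s: "equiv B s"
proof (rule equivI[OF s_subset])
  show "refl_on B s"
  proof (rule refl_onI)
    fix y assume y: "y \<in> B"
    then obtain x where x: "x \<in> A" "R x y" using right_total by blast
    have "(x, x) \<in> r" using equiv_r x(1) by (simp add: equiv_def refl_on_def)
    thus "(y, y) \<in> s" using related_iff[OF x(1,1) y y x(2,2)] by simp
  qed
  show "sym s"
  proof (rule symI)
    fix y z assume yz: "(y, z) \<in> s"
    hence mem: "y \<in> B" "z \<in> B" using s_subset by auto
    obtain x x' where x: "x \<in> A" "R x y" "x' \<in> A" "R x' z" using right_total mem by meson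
    have "(x, x') \<in> r" using related_iff[OF x(1,3) mem x(2,4)] yz by simp
    hence "(x', x) \<in> r" using equiv_r by (meson equivE symD)
    thus "(z, y) \<in> s" using related_iff[OF x(3,1) mem(2,1) x(4,2)] by simp
  qed
  show "trans s"
  proof (rule transI)
    fix y z w assume yz: "(y, z) \<in> s" and zw: "(z, w) \<in> s"
    hence mem: "y \<in> B" "z \<in> B" "w \<in> B" using s_subset by auto
    obtain x x' x'' where x: "x \<in> A" "R x y" "x' \<in> A" "R x' z" "x'' \<in> A" "R x'' w"
      using right_total mem by meson
    have "(x, x') \<in> r" "(x', x'') \<in> r"
      using related_iff[OF x(1,3) mem(1,2) x(2,4)] related_iff[OF x(3,5) mem(2,3) x(4,6)] yz zw
      by simp_all
    hence "(x, x'') \<in> r" using equiv_r by (meson equivE transD)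
    thus "(y, w) \<in> s" using related_iff[OF x(1,5) mem(1,3) x(2,6)] by simp
  qed
qed

lemma related_set_class:
  assumes x: "x \<in> A" and y: "y \<in> B" and xy: "R x y"
  shows "related_set (r `` {x}) = s `` {y}"
proof (intro equalityI subsetI)
  fix z assume "z \<in> related_set (r `` {x})"
  then obtain x' where x': "(x, x') \<in> r" "z \<in> B" "R x' z" unfolding related_set_def by blast
  have "x' \<in> A" using equiv_class_eq_iff[OF equiv_r, of x x'] x'(1) by simp
  thus "z \<in> s `` {y}" using related_iff[OF x _ y x'(2) xy x'(3)] x'(1) by simp
next
  fix z assume "z \<in> s `` {y}"
  hence z: "(y, z) \<in> s" "z \<in> B" using s_subset by auto
  then obtain x' where x': "x' \<in> A" "R x' z" using right_total by blast
  have "(x, x') \<in> r" using related_iff[OF x x'(1) y z(2) xy x'(2)] z(1) by simp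
  thus "z \<in> related_set (r `` {x})" using z(2) x'(2) unfolding related_set_def by blast
qed

lemma bij_betw_related_set: "bij_betw related_set (A // r) (B // s)"
  unfolding bij_betw_def
proof
  show "inj_on related_set (A // r)"
  proof (rule inj_onI)
    fix T U assume "T \<in> A // r" "U \<in> A // r" and eq: "related_set T = related_set U"
    then obtain x x' where T: "x \<in> A" "T = r `` {x}" and U: "x' \<in> A" "U = r `` {x'}"
      by (auto elim!: quotientE)
    obtain y where y: "y \<in> B" "R x y" using left_total[OF T(1)] by blast
    obtain y' where y': "y' \<in> B" "R x' y'" using left_total[OF U(1)] by blast
    have "s `` {y} = s `` {y'}"
      using eq unfolding T(2) U(2) related_set_class[OF T(1) y] related_set_class[OF U(1) y'] .
    hence "(y, y') \<in> s" using eq_equiv_class[OF _ equiv_s y'(1)] by simp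
    hence "(x, x') \<in> r" using related_iff[OF T(1) U(1) y(1) y'(1) y(2) y'(2)] by simp
    thus "T = U" unfolding T(2) U(2) by (rule equiv_class_eq[OF equiv_r])
  qed
  show "related_set ` (A // r) = B // s"
  proof (intro equalityI subsetI)
    fix Y assume "Y \<in> related_set ` (A // r)"
    then obtain x where x: "x \<in> A" "Y = related_set (r `` {x})" by (auto elim!: quotientE)
    obtain y where y: "y \<in> B" "R x y" using left_total[OF x(1)] by blast
    show "Y \<in> B // s" unfolding x(2) related_set_class[OF x(1) y] by (rule quotientI[OF y(1)])
  next
    fix Y assume "Y \<in> B // s"
    then obtain y where y: "y \<in> B" "Y = s `` {y}" by (auto elim!: quotientE)
    obtain x where x: "x \<in> A" "R x y" using right_total[OF y(1)] by blast
    show "Y \<in> related_set ` (A // r)"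
      unfolding y(2) related_set_class[OF x(1) y(1) x(2), symmetric] by (intro imageI quotientI x(1))
  qed
qed

end

locale effective_hodge_type = hodge_type S d k
  for S :: "('q::field_char_0, 'a::field, 'k::field) coeff_data" and d k +
  assumes nonneg: "i < f \<Longrightarrow> m < d \<Longrightarrow> 0 \<le> k i m"
begin

lemma hodge_lattice_if_SDL:
  assumes "(D, L) \<in> SDL S d k"
  shows "hodge_lattice S d k D L"
  using assms hodge_type_axioms
  by (simp add: SDL_def strongly_divisible_def weakly_admissible_def hodge_lattice_def
      hodge_lattice_axioms_def phi_lattice_module_def phi_lattice_module_axioms_def phi_module_def
      phi_module_axioms_def coefficient_fields_axioms)

lemma presentation_exists:
  assumes X: "X \<in> SDL S d k"
  shows "\<exists>A\<in>GLO_tuples S d. presented_by S d k A X"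
proof -
  obtain D L where X_eq: "X = (D, L)" by force
  interpret hodge_lattice S d k D L using hodge_lattice_if_SDL X X_eq by blast
  have "divided_image L = L" using X by (simp add: X_eq SDL_def strongly_divisible_iff)
  thus ?thesis using frame_exists presented_by_iff unfolding X_eq by blast
qed

lemma presented_by_sim:
  assumes X: "X \<in> SDL S d k" and "presented_by S d k A X" and sim: "(A, B) \<in> sim S d k"
  shows "presented_by S d k B X"
proof -
  obtain D L where X_eq: "X = (D, L)" by force
  interpret hodge_lattice S d k D L using hodge_lattice_if_SDL X X_eq by blast
  have "(B, A) \<in> sim S d k" using sim equiv_sim by (meson equivE symD)
  then obtain C where "intertwiner C B A" "A \<in> GLO_tuples S d" "B \<in> GLO_tuples S d"
    using sim_iff by blast
  thus ?thesis using assms(2) frame_change unfolding X_eq presented_by_iff by blast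
qed

lemma presentations_sim:
  assumes X: "X \<in> SDL S d k" and "presented_by S d k A X" "presented_by S d k B X"
    and A: "A \<in> GLO_tuples S d" and B: "B \<in> GLO_tuples S d"
  shows "(A, B) \<in> sim S d k"
proof -
  obtain D L where X_eq: "X = (D, L)" by force
  interpret hodge_lattice S d k D L using hodge_lattice_if_SDL X X_eq by blast
  obtain C where "intertwiner C A B"
    using frames_intertwined[OF _ _ B A] assms(2,3) unfolding X_eq presented_by_iff by blast
  thus ?thesis using A B sim_iff by blast
qed

lemma presented_by_iso:
  assumes "(X, Y) \<in> iso_rel S d k" and A: "A \<in> GLO_tuples S d" and X: "presented_by S d k A X"
  shows "presented_by S d k A Y"
proof -
  obtain D L D' L' where eq: "X = (D, L)" "Y = (D', L')" by force
  obtain h where "lattice_iso S (D, L) (D', L') h" "X \<in> SDL S d k" "Y \<in> SDL S d k"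
    using assms(1) unfolding iso_rel_def eq by blast
  then interpret lattice_isomorphism S d k D D' L L' h
    using hodge_lattice_if_SDL
    by (auto simp: eq lattice_isomorphism_def lattice_isomorphism_axioms_def)
  obtain e where "X.frame A e" using X unfolding eq X.presented_by_iff by blast
  hence "Y.frame A (\<lambda>i m. h (e i m))" using h_frame[OF nonneg A] by blast
  thus ?thesis unfolding eq Y.presented_by_iff by blast
qed

lemma iso_if_same_presentation:
  fixes X Y :: "('a, 'k, 'v::ab_group_add) fil_phi_module \<times> 'v set"
  assumes X: "X \<in> SDL S d k" "presented_by S d k A X" and Y: "Y \<in> SDL S d k" "presented_by S d k A Y"
    and A: "A \<in> GLO_tuples S d"
  shows "(X, Y) \<in> iso_rel S d k"
proof -
  obtain D L D' L' where eq: "X = (D, L)" "Y = (D', L')" by force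
  have coordinates: "\<exists>e co. coordinate_lattice S d k D e co L A"
    if "(D, L) \<in> SDL S d k" "presented_by S d k A (D, L)" for D :: "('a, 'k, 'v) fil_phi_module" and L
  proof -
    interpret hodge_lattice S d k D L using hodge_lattice_if_SDL that(1) .
    show ?thesis using coordinate_lattice_frame A that(2) presented_by_iff by blast
  qed
  obtain e co e' co'
    where "coordinate_lattice S d k D e co L A" "coordinate_lattice S d k D' e' co' L' A"
    using coordinates X Y unfolding eq by blast
  then interpret coordinate_lattice_pair S d k D D' e e' co co' L L' A
    by (simp add: coordinate_lattice_pair_def)
  show ?thesis using lattice_iso_transfer X(1) Y(1) unfolding iso_rel_def eq by blast
qed

lemma iso_rel_subset: "iso_rel S d k \<subseteq> SDL S d k \<times> SDL S d k"
  by (auto simp: iso_rel_def)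

lemma presented_lattice_exists:
  fixes s :: "'a \<Rightarrow> 'v::ab_group_add \<Rightarrow> 'v"
  assumes "grid_coordinates s f d e co" and A: "A \<in> GLO_tuples S d"
  shows "\<exists>X \<in> (SDL S d k :: (('a, 'k, 'v) fil_phi_module \<times> 'v set) set). presented_by S d k A X"
proof -
  obtain D :: "('a, 'k, 'v) fil_phi_module" and L where "coordinate_lattice S d k D e co L A"
    using coordinate_lattice_exists[OF assms] by blast
  from coordinate_lattice.coordinate_lattice_SDL[OF this nonneg] show ?thesis by blast
qed

theorem sim_iff_iso:
  assumes A: "A \<in> GLO_tuples S d" "presented_by S d k A X"
    and B: "B \<in> GLO_tuples S d" "presented_by S d k B Y"
    and XY: "X \<in> SDL S d k" "Y \<in> SDL S d k"
  shows "(A, B) \<in> sim S d k \<longleftrightarrow> (X, Y) \<in> iso_rel S d k"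
proof
  assume "(A, B) \<in> sim S d k"
  hence "presented_by S d k B X" by (rule presented_by_sim[OF XY(1) A(2)])
  thus "(X, Y) \<in> iso_rel S d k" by (rule iso_if_same_presentation[OF XY(1) _ XY(2) B(2,1)])
next
  assume "(X, Y) \<in> iso_rel S d k"
  hence "presented_by S d k A Y" using A by (rule presented_by_iso)
  thus "(A, B) \<in> sim S d k" by (rule presentations_sim[OF XY(2) _ B(2) A(1) B(1)])
qed

end

theorem theorem3p8:
  fixes S :: "('q::field_char_0, 'a::field, 'k::field) coeff_data"
    and d :: nat
    and k :: "nat \<Rightarrow> nat \<Rightarrow> int"
  assumes datum: "coeff_datum S"
    and decreasing: "\<forall>i<res_deg S. \<forall>m n. m \<le> n \<and> n < d \<longrightarrow> k i n \<le> k i m"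
    and nonneg: "\<forall>i<res_deg S. \<forall>m<d. 0 \<le> k i m"
    and carrier_type: "\<exists>(s :: 'a \<Rightarrow> 'v::ab_group_add \<Rightarrow> 'v) B.
      Vector_Spaces.vector_space s \<and> finite B \<and> card B = res_deg S * d \<and>
      \<not> Modules.module.dependent s B \<and> Modules.module.span s B = UNIV"
  shows "equiv (GLO_tuples S d) (sim S d k)
    \<and> equiv (SDL S d k :: (('a, 'k, 'v) fil_phi_module \<times> 'v set) set) (iso_rel S d k)
    \<and> (\<forall>A \<in> GLO_tuples S d. \<exists>X \<in> (SDL S d k :: (('a, 'k, 'v) fil_phi_module \<times> 'v set) set).
         presented_by S d k A X)
    \<and> (\<forall>A \<in> GLO_tuples S d. \<forall>X \<in> (SDL S d k :: (('a, 'k, 'v) fil_phi_module \<times> 'v set) set).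
         presented_by S d k A X \<longrightarrow> Theta S d k (sim S d k `` {A}) = iso_rel S d k `` {X})
    \<and> bij_betw (Theta S d k)
         (GLO_tuples S d // sim S d k)
         ((SDL S d k :: (('a, 'k, 'v) fil_phi_module \<times> 'v set) set) // iso_rel S d k)"
proof -
  let ?SDL = "SDL S d k :: (('a, 'k, 'v) fil_phi_module \<times> 'v set) set"
  interpret effective_hodge_type S d k
    using assms by unfold_locales (auto simp: monotone_on_def)
  obtain s :: "'a \<Rightarrow> 'v \<Rightarrow> 'v" and B where "vector_space s"
    and B: "finite B" "card B = f * d" "\<not> module.dependent s B" "module.span s B = UNIV"
    using carrier_type by blast
  then interpret s: lin_space s by (simp add: lin_space_def)
  obtain e co where "grid_coordinates s f d e co" using s.grid_coordinates_exist[OF B] by blast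
  note presented = presented_lattice_exists[OF this]
  interpret class_correspondence "GLO_tuples S d" "sim S d k" ?SDL "iso_rel S d k" "presented_by S d k"
    by (intro class_correspondence.intro equiv_sim iso_rel_subset presented presentation_exists
        sim_iff_iso)
  have "Theta S d k = related_set" by (simp add: fun_eq_iff Theta_def related_set_def)
  thus ?thesis
    using equiv_sim equiv_s presented related_set_class bij_betw_related_set by (intro conjI) simp_all
qed

end
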